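(* Let $ST_3^n$ denote the Sierpi\'nski triangle graph of dimension $n\ge 0$. Then (i) $\chi_\rho(ST_3^0)=3$, $\chi_\rho(ST_3^1)=4$, $\chi_\rho(ST_3^2)=8$, $\chi_\rho(ST_3^3)=12$; (ii) $12\le\chi_\rho(ST_3^4)\le 15$; (iii) $12\le\chi_\rho(ST_3^5)\le 19$; and, for every $n\ge 6$, $12\le \chi_\rho(ST_3^n)\le 20$.
   Context: The base-3 Sierpi\'nski graphs $S^n$ are defined by $S^0=K_1$ and, for $n\ge1$, $V(S^n)=[3]^n$ with $[3]=\{0,1,2\}$ and $E(S^n)=\{\{is,it\}: i\in[3],\ \{s,t\}\in E(S^{n-1})\}\cup\{\{ij^{n-1},ji^{n-1}\}: i,j\in[3],\ i\neq j\}$ (here $ij^{n-1}$ is the word $i$ followed by $n-1$ copies of $j$). The edges of $S^n$ lying in triangles (cliques $\{ws0,ws1,ws2\}$) are clique edges; the remaining edges $\{wij^{m},wji^{m}\}$ with $m\ge1$ are non-clique edges. For $n\ge 0$, the Sierpi\'nski triangle graph $ST_3^n$ is obtained from $S^{n+1}$ by contracting all non-clique edges. (Equivalently, $ST_3^0=K_3$ and $ST_3^{n+1}$ consists of three copies of $ST_3^n$ where each pair of copies shares one extreme (corner) vertex.) A packing $c$-coloring of a graph $X$ is a map $f:V(X)\to\{1,\dots,c\}$ such that any two distinct vertices $u,v$ with $f(u)=f(v)=i$ satisfy $d_X(u,v)>i$; the packing chromatic number $\chi_\rho(X)$ is the least such $c$. *)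

theory Defs
  imports "HOL-Library.Extended_Nat"
begin

definition sier_verts :: "nat \<Rightarrow> nat list set" where
  "sier_verts n = {w. length w = n \<and> (\<forall>a\<in>set w. a < 3)}"

fun sier_edge :: "nat \<Rightarrow> nat list \<Rightarrow> nat list \<Rightarrow> bool" where
  "sier_edge 0 u v = False"
| "sier_edge (Suc n) u v =
     ((\<exists>i s t. i < 3 \<and> u = i # s \<and> v = i # t \<and> sier_edge n s t) \<or>
      (\<exists>i j. i < 3 \<and> j < 3 \<and> i \<noteq> j \<and> u = i # replicate n j \<and> v = j # replicate n i))"

definition clique_edge :: "nat \<Rightarrow> nat list \<Rightarrow> nat list \<Rightarrow> bool" where
  "clique_edge n u v = (sier_edge n u v \<and>
     (\<exists>w. {u, v} \<subseteq> {w @ [0], w @ [1], w @ [2]}))"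

definition nonclique_edge :: "nat \<Rightarrow> nat list \<Rightarrow> nat list \<Rightarrow> bool" where
  "nonclique_edge n u v = (sier_edge n u v \<and> \<not> clique_edge n u v)"

section \<open>Sierpinski triangle graphs ST_3^n: contract all non-clique edges of S^(n+1)\<close>

definition contr_rel :: "nat \<Rightarrow> (nat list \<times> nat list) set" where
  "contr_rel n = ({(u, v). nonclique_edge (Suc n) u v} \<union> {(u, v). nonclique_edge (Suc n) v u})\<^sup>*"

definition ST_verts :: "nat \<Rightarrow> nat list set set" where
  "ST_verts n = sier_verts (Suc n) // contr_rel n"

definition ST_edge :: "nat \<Rightarrow> nat list set \<Rightarrow> nat list set \<Rightarrow> bool" where
  "ST_edge n X Y = (X \<noteq> Y \<and> (\<exists>u\<in>X. \<exists>v\<in>Y. sier_edge (Suc n) u v))"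

text \<open>Graph given by vertex set V and adjacency E; distance = length of a shortest walk
  (infinity if there is none).\<close>
definition graph_dist :: "'a set \<Rightarrow> ('a \<Rightarrow> 'a \<Rightarrow> bool) \<Rightarrow> 'a \<Rightarrow> 'a \<Rightarrow> enat" where
  "graph_dist V E u v =
     (INF k \<in> {k. (u, v) \<in> {(x, y). x \<in> V \<and> y \<in> V \<and> E x y} ^^ k}. enat k)"

definition packing_coloring :: "'a set \<Rightarrow> ('a \<Rightarrow> 'a \<Rightarrow> bool) \<Rightarrow> nat \<Rightarrow> ('a \<Rightarrow> nat) \<Rightarrow> bool" where
  "packing_coloring V E c f =
     ((\<forall>v\<in>V. f v \<in> {1..c}) \<and>
      (\<forall>u\<in>V. \<forall>v\<in>V. u \<noteq> v \<and> f u = f v \<longrightarrow> enat (f u) < graph_dist V E u v))"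

definition packing_chromatic_number :: "'a set \<Rightarrow> ('a \<Rightarrow> 'a \<Rightarrow> bool) \<Rightarrow> nat" where
  "packing_chromatic_number V E = (LEAST c. \<exists>f. packing_coloring V E c f)"

abbreviation chi_ST :: "nat \<Rightarrow> nat" where
  "chi_ST n \<equiv> packing_chromatic_number (ST_verts n) (ST_edge n)"

end

theory Submission
  imports Defs
begin

text \<open>
  Words of length n+1 are kept as representatives of the vertices of the triangle graph of dimension n.
  On them the distance obeys a simple recursion: inside a copy nothing changes, and between two
  different copies a shortest path runs either through their common corner or along a side of the third copy.

  Upper bounds: with this recursion a colouring, given as a ternary tree, is checked by computing for
  each colour and each subtree the least distances to the three corners. For n at least 6 copies of
  one fixed coloured piece of dimension 5 with all corners coloured 20 are glued together.

  Lower bound 12: suppose dimension 3 has a colouring with 11 colours. Let R be the set of vertices with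
  colour 4 or at least 8. Each of the three copies of dimension 2 contains colour 4 at most once, and
  the colours from 8 on occur at most once at all, so R has at most 7 elements. Weigh every vertex
  of R in a copy by 2, shared corners by 1; the three weights add up to at most 14. A
  table lists, for all positions of the colours 7, 6, 5 in one copy, the possible weights together with the
  behaviour of the colours 1, 2, 3 near the two shared corners, up to domination. An exhaustive search
  over the colours 1, 2, 3 confirms the table, and joining three table entries always exceeds weight 14.
\<close>

section \<open>Distances in Sierpinski triangle graphs\<close>

text \<open>Dimension 3 has 42 vertices, too many for a direct search by rewriting, so it is cut at
  the three shared corners into copies with 15 vertices. What a copy tells its neighbours is
  deliberately coarse. Colour 1 never conflicts across a corner, colours 2 and 3 only within
  distance 2 of it, and colours 5, 6, 7 have at most one position each in a copy. Colour 4 and the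
  colours from 8 on are only counted: conflicts of colour 4 between copies are ignored, and 14
  arises as 2 in each of three copies for colour 4 plus 2 for each of the four colours 8 to 11. This
  relaxation is already contradictory.

  Prefixing words by zeros embeds dimension 3 isometrically into every higher dimension, so one
  argument gives all lower bounds 12.

  In the periodic colouring the corner common to copies a and b is corner b of one and corner a of
  the other, so only distances to two different corners are ever added. Colour 20 fits at all piece
  corners because a piece of dimension 5 has side 32.\<close>

fun inner_edge :: "nat \<Rightarrow> nat list \<Rightarrow> nat list \<Rightarrow> bool" where
  "inner_edge 0 u v = False"
| "inner_edge (Suc n) u v =
     ((\<exists>i s t. i < 3 \<and> u = i # s \<and> v = i # t \<and> inner_edge n s t) \<or>
      (\<exists>i j. i < 3 \<and> j < 3 \<and> i \<noteq> j \<and> 0 < n \<and> u = i # replicate n j \<and> v = j # replicate n i))"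

lemma sier_edge_length: "sier_edge n u v \<Longrightarrow> length u = n \<and> length v = n"
  by (induction n arbitrary: u v) auto

lemma sier_edge_letters: "sier_edge n u v \<Longrightarrow> (\<forall>a\<in>set u. a < 3) \<and> (\<forall>a\<in>set v. a < 3)"
  by (induction n arbitrary: u v) (auto simp: set_replicate_conv_if split: if_splits)

lemma sier_edge_sym: "sier_edge n u v \<Longrightarrow> sier_edge n v u"
  by (induction n arbitrary: u v) (simp, fastforce)

lemma inner_edge_sier: "inner_edge n u v \<Longrightarrow> sier_edge n u v"
  by (induction n arbitrary: u v) (simp, fastforce)

lemma clique_edge_Cons:
  assumes "clique_edge (Suc n) (i # s) (i # t)" "n > 0"
  shows "clique_edge n s t"
proof -
  have e: "sier_edge (Suc n) (i # s) (i # t)" using assms(1) by (simp add: clique_edge_def)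
  then have e': "sier_edge n s t" by auto
  then have l: "length s = n" "length t = n" using sier_edge_length by auto
  obtain w where w: "{i # s, i # t} \<subseteq> {w @ [0], w @ [1], w @ [2]}"
    using assms(1) unfolding clique_edge_def by blast
  then have "w \<noteq> []" using l assms(2) by auto
  then obtain w' where "w = i # w'" using w by (cases w) auto
  then show ?thesis using w e' unfolding clique_edge_def by (intro conjI exI[of _ w']) auto
qed

lemma clique_edge_Cons': "clique_edge n s t \<Longrightarrow> i < 3 \<Longrightarrow> clique_edge (Suc n) (i # s) (i # t)"
  unfolding clique_edge_def by (elim conjE exE, intro conjI) (simp, rule_tac x = "i # w" in exI, auto)

text \<open>Putting a common letter in front changes neither kind of edge as long as the tails are
  nonempty. What remains is an edge between two copies; it lies in a clique exactly when the tails
  are empty, that is, when the whole graph is a triangle.\<close>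

lemma nonclique_edge_iff: "nonclique_edge n u v = inner_edge n u v"
proof (induction n arbitrary: u v)
  case 0
  then show ?case by (simp add: nonclique_edge_def)
next
  case (Suc n)
  show ?case
  proof
    assume a: "nonclique_edge (Suc n) u v"
    then have e: "sier_edge (Suc n) u v" and nc: "\<not> clique_edge (Suc n) u v"
      by (auto simp: nonclique_edge_def)
    from e consider (1) i s t where "i < 3" "u = i # s" "v = i # t" "sier_edge n s t"
      | (2) i j where "i < 3" "j < 3" "i \<noteq> j" "u = i # replicate n j" "v = j # replicate n i"
      by auto
    then show "inner_edge (Suc n) u v"
    proof cases
      case 1
      have "\<not> clique_edge n s t" using clique_edge_Cons' nc 1 by blast
      then show ?thesis using 1 Suc.IH[of s t] by (auto simp: nonclique_edge_def)
    next
      case 2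
      have "n > 0"
      proof (rule ccontr)
        assume "\<not> n > 0"
        then have "clique_edge (Suc n) u v" using 2 e unfolding clique_edge_def
          by (intro conjI exI[of _ "[]"]) auto
        then show False using nc by simp
      qed
      then show ?thesis using 2 by auto
    qed
  next
    assume a: "inner_edge (Suc n) u v"
    then have e: "sier_edge (Suc n) u v" by (rule inner_edge_sier)
    from a consider (1) i s t where "i < 3" "u = i # s" "v = i # t" "inner_edge n s t"
      | (2) i j where "i < 3" "j < 3" "i \<noteq> j" "0 < n" "u = i # replicate n j" "v = j # replicate n i"
      by auto
    then have "\<not> clique_edge (Suc n) u v"
    proof cases
      case 1
      then have "n > 0" by (cases n) auto
      moreover have "\<not> clique_edge n s t" using 1 Suc.IH[of s t] by (auto simp: nonclique_edge_def)
      ultimately show ?thesis using 1 clique_edge_Cons by blast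
    next
      case 2
      \<comment> \<open>The first letters differ, so a common prefix \<open>w\<close> would have to
        be empty, but the words have length at least 2.\<close>
      then show ?thesis by (auto simp: clique_edge_def Cons_eq_append_conv)
    qed
    then show "nonclique_edge (Suc n) u v" using e by (simp add: nonclique_edge_def)
  qed
qed

lemma inner_edge_sym: "inner_edge n u v \<Longrightarrow> inner_edge n v u"
  by (induction n arbitrary: u v) (simp, fastforce)

section \<open>The classes of the contraction\<close>

lemma contr_rel_alt: "contr_rel n = {(u, v). inner_edge (Suc n) u v}\<^sup>*"
proof -
  have "{(u, v). nonclique_edge (Suc n) u v} \<union> {(u, v). nonclique_edge (Suc n) v u}
     = {(u, v). inner_edge (Suc n) u v}"
    using inner_edge_sym by (auto simp: nonclique_edge_iff)
  then show ?thesis by (simp add: contr_rel_def)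
qed

lemma contr_rel_sym: "(u, v) \<in> contr_rel n \<Longrightarrow> (v, u) \<in> contr_rel n"
proof -
  have "sym {(u, v). inner_edge (Suc n) u v}" using inner_edge_sym by (auto simp: sym_def)
  then show "(u, v) \<in> contr_rel n \<Longrightarrow> (v, u) \<in> contr_rel n"
    unfolding contr_rel_alt by (metis sym_rtrancl symD)
qed

lemma contr_rel_trans: "(u, v) \<in> contr_rel n \<Longrightarrow> (v, w) \<in> contr_rel n \<Longrightarrow> (u, w) \<in> contr_rel n"
  unfolding contr_rel_def by (rule rtrancl_trans)

lemma contr_rel_verts: "(u, v) \<in> contr_rel n \<Longrightarrow> u \<in> sier_verts (Suc n) \<Longrightarrow> v \<in> sier_verts (Suc n)"
  unfolding contr_rel_alt
proof (induction rule: rtrancl_induct)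
  case (step y z)
  then have "sier_edge (Suc n) y z" using inner_edge_sier by auto
  then show ?case using sier_edge_length[of "Suc n" y z] sier_edge_letters[of "Suc n" y z]
    by (simp add: sier_verts_def del: sier_edge.simps)
qed

abbreviation cls :: "nat \<Rightarrow> nat list \<Rightarrow> nat list set" where
  "cls n u \<equiv> contr_rel n `` {u}"

lemma cls_in_verts: "u \<in> sier_verts (Suc n) \<Longrightarrow> cls n u \<in> ST_verts n"
  by (simp add: ST_verts_def quotientI)

lemma cls_eq: "(u, v) \<in> contr_rel n \<Longrightarrow> cls n u = cls n v"
  using contr_rel_sym contr_rel_trans by blast

lemma ST_verts_cls:
  assumes "X \<in> ST_verts n" "u \<in> X"
  shows "X = cls n u \<and> u \<in> sier_verts (Suc n)"
  using assms cls_eq contr_rel_verts unfolding ST_verts_def by (auto elim!: quotientE)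

lemma self_in_cls: "u \<in> cls n u"
  by (simp add: contr_rel_def)

lemma ST_verts_nonempty: "X \<in> ST_verts n \<Longrightarrow> \<exists>u. u \<in> X"
  unfolding ST_verts_def using self_in_cls by (auto elim!: quotientE)

section \<open>A recursive distance on words\<close>

fun corner_dist :: "nat \<Rightarrow> nat list \<Rightarrow> nat" where
  "corner_dist i [] = 0"
| "corner_dist i [a] = (if a = i then 0 else 1)"
| "corner_dist i (a # b # w) = (if a = i then 0 else 2 ^ length w) + corner_dist i (b # w)"

text \<open>Empty tails need a case of their own: the formula for the route through the common
  corner would give 0 there, while two letters of a triangle are at distance 1. For distinct letters
  \<open>a\<close>, \<open>b\<close> below 3 the third letter is \<open>3 - a - b\<close>.\<close>

fun word_dist :: "nat list \<Rightarrow> nat list \<Rightarrow> nat" where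
  "word_dist (a # u) (b # v) =
     (if a = b then word_dist u v
      else if u = [] then 1
      else min (corner_dist b u + corner_dist a v)
        (corner_dist (3 - a - b) u + 2 ^ (length u - 1) + corner_dist (3 - a - b) v))"
| "word_dist u v = 0"

text \<open>The geometric form of the recursion: from \<open>a # w\<close> with \<open>a\<close>
  different from \<open>i\<close>, go to corner \<open>i\<close> of copy \<open>a\<close> and then
  along one side of copy \<open>i\<close>. After contraction a copy with words of length m has side
  \<open>2 ^ (m - 1)\<close>, which explains the exponent.\<close>

lemma corner_dist_Cons: "w \<noteq> [] \<Longrightarrow>
    corner_dist i (a # w) = (if a = i then 0 else 2 ^ (length w - 1)) + corner_dist i w"
  by (cases w) auto

lemma corner_dist_replicate: "corner_dist i (replicate (Suc n) j) = (if i = j then 0 else 2 ^ n)"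
proof (induction n)
  case (Suc n)
  then show ?case by (simp add: corner_dist_Cons del: replicate.simps(2) add: replicate.simps(2)[of "Suc n"])
qed auto

lemma corner_dist_replicate': "n > 0 \<Longrightarrow>
    corner_dist i (replicate n j) = (if i = j then 0 else 2 ^ (n - 1))"
  using corner_dist_replicate[of i "n - 1" j] by simp

lemma corner_dist_le: "w \<noteq> [] \<Longrightarrow> corner_dist i w \<le> 2 ^ (length w - 1)"
proof (induction w)
  case (Cons a w)
  show ?case
  proof (cases "w = []")
    case False
    then have "2 ^ length w = 2 * (2::nat) ^ (length w - 1)" by (cases w) auto
    then show ?thesis using Cons False by (auto simp: corner_dist_Cons)
  qed auto
qed auto

lemma corner_dist_eq_0: "corner_dist i w = 0 \<longleftrightarrow> w = replicate (length w) i"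
  by (induction i w rule: corner_dist.induct) auto

text \<open>This makes \<open>corner_dist\<close> well defined on the classes of the
  contraction.\<close>

lemma corner_dist_inner: "inner_edge n u v \<Longrightarrow> corner_dist i v = corner_dist i u"
proof (induction n arbitrary: u v)
  case (Suc n)
  from Suc.prems consider (1) a s t where "u = a # s" "v = a # t" "inner_edge n s t"
    | (2) a b where "a \<noteq> b" "0 < n" "u = a # replicate n b" "v = b # replicate n a"
    by auto
  then show ?case
  proof cases
    case 1
    then have "length s = n" "length t = n" "n > 0"
      using inner_edge_sier sier_edge_length by (blast, blast, cases n, auto)
    then show ?thesis using 1 Suc.IH[of s t] corner_dist_Cons[of s i a] corner_dist_Cons[of t i a]
      by fastforce
  next
    case 2
    then show ?thesis by (auto simp: corner_dist_Cons corner_dist_replicate')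
  qed
qed auto

lemma corner_dist_edge: "sier_edge n u v \<Longrightarrow> corner_dist i v \<le> corner_dist i u + 1"
proof (induction n arbitrary: u v)
  case (Suc n)
  from Suc.prems consider (1) a s t where "u = a # s" "v = a # t" "sier_edge n s t"
    | (2) a b where "a \<noteq> b" "u = a # replicate n b" "v = b # replicate n a"
    by auto
  then show ?case
  proof cases
    case 1
    then have "length s = n" "length t = n" "n > 0"
      using sier_edge_length by (blast, blast, cases n, auto)
    then show ?thesis using 1 Suc.IH[of s t] corner_dist_Cons[of s i a] corner_dist_Cons[of t i a]
      by fastforce
  next
    case 2
    then show ?thesis by (cases "n = 0") (auto simp: corner_dist_Cons corner_dist_replicate')
  qed
qed auto

text \<open>Links the two recursions. Towards a corner the route through the third copy never wins,
  since corner distances inside a copy are at most its side.\<close>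

lemma word_dist_corner:
  "length u = Suc n \<Longrightarrow> word_dist u (replicate (Suc n) j) = corner_dist j u"
proof (induction n arbitrary: u)
  case 0
  then show ?case by (cases u) auto
next
  case (Suc n)
  then obtain a w where u: "u = a # w" "length w = Suc n" by (cases u) auto
  have "corner_dist j w \<le> corner_dist (3 - a - j) w + 2 ^ n"
    using corner_dist_le[of w j] u by fastforce
  then show ?case using u Suc.IH[of w]
    by (auto simp: corner_dist_replicate corner_dist_Cons replicate.simps(2)[of "Suc n"]
        simp del: replicate.simps(2))
qed

lemma word_dist_sym: "length u = length v \<Longrightarrow> word_dist u v = word_dist v u"
proof (induction u v rule: word_dist.induct)
  case (1 a u b v)
  have "3 - a - b = 3 - b - (a::nat)" "(u = []) = (v = [])" using 1 by auto
  then show ?case using 1 by (auto simp: algebra_simps)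
qed auto

text \<open>Well-definedness on classes, in the second argument. Across a junction of copies
  \<open>i\<close> and \<open>j\<close> three cases arise, as \<open>u\<close> lies in copy
  \<open>i\<close>, in copy \<open>j\<close> or in the third one.\<close>

lemma word_dist_inner:
  assumes "inner_edge n v w" "length u = n" "\<forall>a\<in>set u. a < 3"
  shows "word_dist u w = word_dist u v"
  using assms
proof (induction n arbitrary: u v w)
  case (Suc n)
  obtain a u' where u: "u = a # u'" "length u' = n" "a < 3" using Suc.prems by (cases u) auto
  from Suc.prems consider (1) i s t where "i < 3" "v = i # s" "w = i # t" "inner_edge n s t"
    | (2) i j where "i < 3" "j < 3" "i \<noteq> j" "0 < n" "v = i # replicate n j" "w = j # replicate n i"
    by auto
  then show ?case
  proof cases
    case 1
    then have "corner_dist c t = corner_dist c s" for c using corner_dist_inner by blast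
    then show ?thesis using 1 u Suc by auto
  next
    case 2
    obtain m where m: "n = Suc m" using 2 by (cases n) auto
    have d: "word_dist u' (replicate n c) = corner_dist c u'" for c
      using word_dist_corner[of u' m c] u m by auto
    have le: "corner_dist c u' \<le> corner_dist c' u' + 2 ^ m + 2 ^ m" for c c'
      using corner_dist_le[of u' c] u m by fastforce
    have ne: "u' \<noteq> []" using u m by auto
    have r: "corner_dist c (replicate n c') = (if c = c' then 0 else 2 ^ m)" for c c'
      using corner_dist_replicate[of c m c'] m by simp
    have third: "3 - i - j \<noteq> i" "3 - i - j \<noteq> j" "3 - j - i \<noteq> i" "3 - j - i \<noteq> j" using 2 by arith+
    consider "a = i" | "a = j" | "a \<noteq> i" "a \<noteq> j" by blast
    then show ?thesis
    proof cases
      case 1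
      then show ?thesis using 2 u d ne r le[of j "3 - i - j"] m third by (auto simp: min_def)
    next
      case b: 2
      then show ?thesis using 2 u d ne r le[of i "3 - j - i"] m third by (auto simp: min_def)
    next
      case 3
      \<comment> \<open>From the third copy the two routes exchange their roles: the one through the
        common corner for \<open>v\<close> is the one along a side for \<open>w\<close>, and
        conversely.\<close>
      have "3 - a - i = j" "3 - a - j = i" using 2 3 u by arith+
      then show ?thesis using 2 3 u ne r m by (auto simp: min_def)
    qed
  qed
qed auto

text \<open>One edge changes the recursive distance by at most 1; this is the whole source of the
  lower bound on walks.\<close>

lemma word_dist_edge:
  assumes "sier_edge n v w" "length u = n" "\<forall>a\<in>set u. a < 3"
  shows "word_dist u w \<le> word_dist u v + 1"
  using assms
proof (induction n arbitrary: u v w)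
  case (Suc n)
  obtain a u' where u: "u = a # u'" "length u' = n" "a < 3" using Suc.prems by (cases u) auto
  from Suc.prems consider (1) i s t where "i < 3" "v = i # s" "w = i # t" "sier_edge n s t"
    | (2) i j where "i < 3" "j < 3" "i \<noteq> j" "v = i # replicate n j" "w = j # replicate n i"
    by auto
  then show ?case
  proof cases
    case 1
    have c: "corner_dist c t \<le> corner_dist c s + 1" for c using 1 corner_dist_edge by blast
    show ?thesis
    proof (cases "a = i")
      case True
      then show ?thesis using 1 u Suc by auto
    next
      case False
      then show ?thesis using 1 u c[of a] c[of "3 - a - i"] by (auto simp: min_def)
    qed
  next
    case 2
    show ?thesis
    proof (cases "n = 0")
      case True
      then show ?thesis using 2 u by auto
    next
      case False
      then have "inner_edge (Suc n) v w" using 2 by auto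
      then show ?thesis using word_dist_inner Suc.prems by fastforce
    qed
  qed
qed auto

lemma word_dist_contr_rel:
  assumes "(v, w) \<in> contr_rel n" "u \<in> sier_verts (Suc n)"
  shows "word_dist u w = word_dist u v"
  using assms(1) unfolding contr_rel_alt
proof (induction rule: rtrancl_induct)
  case (step y z)
  then show ?case using word_dist_inner[of "Suc n" y z u] assms(2) by (auto simp: sier_verts_def)
qed auto

lemma word_dist_refl: "word_dist u u = 0"
  by (induction u) auto

lemma word_dist_0_imp:
  assumes "length u = n" "length v = n" "\<forall>a\<in>set u. a < 3" "\<forall>a\<in>set v. a < 3" "word_dist u v = 0"
  shows "u = v \<or> inner_edge n u v"
  using assms
proof (induction n arbitrary: u v)
  case (Suc n)
  obtain a u' b v' where u: "u = a # u'" "v = b # v'" "length u' = n" "length v' = n"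
    using Suc.prems by (cases u; cases v) auto
  show ?case
  proof (cases "a = b")
    case True
    then show ?thesis using Suc u by auto
  next
    case False
    then have ne: "u' \<noteq> []" using Suc.prems u by auto
    then have "corner_dist b u' + corner_dist a v' = 0" using False Suc.prems u
      by (auto simp: min_def split: if_splits)
    then have "u' = replicate n b" "v' = replicate n a" using corner_dist_eq_0 u by auto
    then show ?thesis using u ne False Suc.prems by auto
  qed
qed auto

lemma word_dist_0_iff:
  assumes "u \<in> sier_verts (Suc n)" "v \<in> sier_verts (Suc n)"
  shows "word_dist u v = 0 \<longleftrightarrow> cls n u = cls n v"
proof
  assume "word_dist u v = 0"
  then have "(u, v) \<in> contr_rel n" using word_dist_0_imp[of u "Suc n" v] assms
    by (auto simp: sier_verts_def contr_rel_alt simp del: inner_edge.simps)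
  then show "cls n u = cls n v" by (rule cls_eq)
next
  assume "cls n u = cls n v"
  then have "(u, v) \<in> contr_rel n" using self_in_cls by blast
  then show "word_dist u v = 0" using word_dist_contr_rel[of u v n u] assms word_dist_refl by simp
qed

section \<open>Comparison with the graph distance\<close>

abbreviation ST_rel :: "nat \<Rightarrow> (nat list set \<times> nat list set) set" where
  "ST_rel n \<equiv> {(X, Y). X \<in> ST_verts n \<and> Y \<in> ST_verts n \<and> ST_edge n X Y}"

text \<open>Each step of a walk uses an edge between some representatives. The edge raises the
  distance by at most 1, and changing the representative within a class costs nothing.\<close>

lemma word_dist_le_walk:
  assumes "(X, Y) \<in> ST_rel n ^^ k" "X \<in> ST_verts n" "u \<in> X" "v \<in> Y"
  shows "word_dist u v \<le> k"
  using assms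
proof (induction k arbitrary: Y v)
  case 0
  then have "(u, v) \<in> contr_rel n" using ST_verts_cls[of X n u] by auto
  then show ?case using word_dist_contr_rel[of u v n u] ST_verts_cls[of X n u] 0 word_dist_refl by auto
next
  case (Suc k)
  then obtain Z where Z: "(X, Z) \<in> ST_rel n ^^ k" "(Z, Y) \<in> ST_rel n" by auto
  then obtain z y where zy: "z \<in> Z" "y \<in> Y" "sier_edge (Suc n) z y"
    by (auto simp: ST_edge_def simp del: sier_edge.simps)
  have u: "u \<in> sier_verts (Suc n)" using ST_verts_cls Suc.prems by blast
  have "word_dist u z \<le> k" using Suc Z zy by blast
  moreover have "word_dist u y \<le> word_dist u z + 1"
    using word_dist_edge[OF zy(3), of u] u by (auto simp: sier_verts_def)
  moreover have "(y, v) \<in> contr_rel n" using ST_verts_cls[of Y n y] Z Suc.prems zy by auto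
  then have "word_dist u v = word_dist u y" using word_dist_contr_rel u by blast
  ultimately show ?case by simp
qed

text \<open>Stated with "at most \<open>k\<close>", so that an edge inside a class may count as one
  step and lengths simply add along a route.\<close>

definition reach :: "nat \<Rightarrow> nat \<Rightarrow> nat list \<Rightarrow> nat list \<Rightarrow> bool" where
  "reach n k u v \<longleftrightarrow> (\<exists>j\<le>k. (cls n u, cls n v) \<in> ST_rel n ^^ j)"

lemma reach_refl: "reach n k u u"
  unfolding reach_def by (intro exI[of _ 0]) auto

lemma reach_trans: "reach n k u v \<Longrightarrow> reach n l v w \<Longrightarrow> reach n (k + l) u w"
  unfolding reach_def by (elim exE conjE, rule_tac x = "j + ja" in exI) (auto simp: relpow_add)

lemma reach_cls: "reach n k u v \<Longrightarrow> (v, w) \<in> contr_rel n \<Longrightarrow> reach n k u w"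
  unfolding reach_def using cls_eq[of v w n] by simp

lemma reach_edge:
  assumes "sier_edge (Suc n) u v" shows "reach n 1 u v"
proof (cases "cls n u = cls n v")
  case True
  then show ?thesis unfolding reach_def by (intro exI[of _ 0]) auto
next
  case False
  have "u \<in> sier_verts (Suc n)" "v \<in> sier_verts (Suc n)"
    using sier_edge_length[OF assms] sier_edge_letters[OF assms] by (auto simp: sier_verts_def)
  then have "(cls n u, cls n v) \<in> ST_rel n"
    using False assms self_in_cls cls_in_verts unfolding ST_edge_def by blast
  then show ?thesis unfolding reach_def by (intro exI[of _ 1]) auto
qed

lemma sier_edge_prefix: "\<forall>a\<in>set z. a < 3 \<Longrightarrow> sier_edge n u v \<Longrightarrow> sier_edge (length z + n) (z @ u) (z @ v)"
  by (induction z) auto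

lemma inner_edge_prefix: "\<forall>a\<in>set z. a < 3 \<Longrightarrow> inner_edge n u v \<Longrightarrow> inner_edge (length z + n) (z @ u) (z @ v)"
  by (induction z) auto

lemma reach_sym: "reach n k u v \<Longrightarrow> reach n k v u"
proof -
  have E: "(Y, X) \<in> ST_rel n" if "(X, Y) \<in> ST_rel n" for X Y
    using that sier_edge_sym unfolding ST_edge_def by blast
  have "(X, Y) \<in> ST_rel n ^^ j \<Longrightarrow> (Y, X) \<in> ST_rel n ^^ j" for X Y j
  proof (induction j arbitrary: Y)
    case (Suc j)
    then obtain Z where "(X, Z) \<in> ST_rel n ^^ j" "(Z, Y) \<in> ST_rel n" by auto
    then show ?case using Suc.IH E using relpow_Suc_I2[of Y Z "ST_rel n" X j] by blast
  qed simp
  then show "reach n k u v \<Longrightarrow> reach n k v u" unfolding reach_def by blast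
qed

text \<open>For \<open>m = 0\<close> the two words are letters of one triangle: adjacent, but not
  identified. This exceptional case is why the conclusion is a disjunction.\<close>

lemma reach_junction:
  assumes "length z + Suc m = Suc n" "\<forall>a\<in>set z. a < 3" "a < 3" "b < 3"
  shows "(z @ a # replicate m b, z @ b # replicate m a) \<in> contr_rel n \<or> m = 0"
proof (cases "a = b \<or> m = 0")
  case True
  then show ?thesis by (auto simp: contr_rel_def)
next
  case False
  then have "inner_edge (Suc m) (a # replicate m b) (b # replicate m a)" using assms by auto
  from inner_edge_prefix[OF assms(2) this] show ?thesis using assms(1)
    by (auto simp: contr_rel_alt simp del: inner_edge.simps)
qed

text \<open>The common prefix \<open>z\<close> allows the induction to descend into a copy while all
  walks stay in dimension \<open>n\<close>.\<close>

lemma reach_corner: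
  assumes "length z + m = Suc n" "\<forall>a\<in>set z. a < 3" "length u = m" "\<forall>a\<in>set u. a < 3" "i < 3" "0 < m"
  shows "reach n (corner_dist i u) (z @ u) (z @ replicate m i)"
  using assms
proof (induction m arbitrary: z u)
  case (Suc m)
  obtain a w where u: "u = a # w" "length w = m" "a < 3" "\<forall>x\<in>set w. x < 3" using Suc.prems by (cases u) auto
  show ?case
  proof (cases "m = 0")
    case True
    show ?thesis
    proof (cases "a = i")
      case True then show ?thesis using u \<open>m = 0\<close> reach_refl by simp
    next
      case False
      then have "sier_edge (Suc 0) [a] [i]" using u Suc.prems by auto
      from sier_edge_prefix[OF Suc.prems(2) this] have "reach n 1 (z @ [a]) (z @ [i])"
        using reach_edge Suc.prems \<open>m = 0\<close> by auto
      then show ?thesis using u \<open>m = 0\<close> False by auto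
    qed
  next
    case False
    then have m: "m > 0" by simp
    have IH: "reach n (corner_dist i w') (z @ b # w') (z @ b # replicate m i)"
      if "b < 3" "length w' = m" "\<forall>x\<in>set w'. x < 3" for b w'
      using Suc.IH[of "z @ [b]" w'] that Suc.prems m by auto
    show ?thesis
    proof (cases "a = i")
      case True
      then show ?thesis using IH[of a w] u m by (auto simp: corner_dist_Cons)
    next
      case False
      have 1: "reach n (corner_dist i w) (z @ a # w) (z @ a # replicate m i)" using IH u by blast
      have 2: "(z @ a # replicate m i, z @ i # replicate m a) \<in> contr_rel n"
        using reach_junction[of z m n a i] Suc.prems u m by auto
      have 3: "reach n (2 ^ (m - 1)) (z @ i # replicate m a) (z @ i # replicate m i)"
        using IH[of i "replicate m a"] u Suc.prems m False by (auto simp: corner_dist_replicate')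
      have "reach n (corner_dist i w + 2 ^ (m - 1)) (z @ a # w) (z @ i # replicate m i)"
        using reach_trans[OF reach_cls[OF 1 2] 3] .
      moreover have "corner_dist i u = corner_dist i w + 2 ^ (m - 1)"
        using u m False by (subst u(1), subst corner_dist_Cons) auto
      ultimately show ?thesis using u by simp
    qed
  qed
qed simp

lemma reach_word_dist:
  assumes "length z + m = Suc n" "\<forall>a\<in>set z. a < 3" "length u = m" "\<forall>a\<in>set u. a < 3"
    "length v = m" "\<forall>a\<in>set v. a < 3" "0 < m"
  shows "reach n (word_dist u v) (z @ u) (z @ v)"
  using assms
proof (induction m arbitrary: z u v)
  case (Suc m)
  obtain a s where u: "u = a # s" "length s = m" "a < 3" "\<forall>x\<in>set s. x < 3" using Suc.prems by (cases u) auto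
  obtain b t where v: "v = b # t" "length t = m" "b < 3" "\<forall>x\<in>set t. x < 3" using Suc.prems by (cases v) auto
  show ?case
  proof (cases "m = 0")
    case True
    then have "s = []" "t = []" using u v by auto
    moreover have "reach n (corner_dist b [a]) (z @ [a]) (z @ replicate (Suc 0) b)"
      using reach_corner[of z "Suc 0" n "[a]" b] Suc.prems(1,2) u v True by auto
    ultimately show ?thesis using u(1) v(1) by (cases "a = b") auto
  next
    case False
    then have m: "m > 0" by simp
    have C: "reach n (corner_dist i w) (z @ c # w) (z @ c # replicate m i)"
      if "c < 3" "i < 3" "length w = m" "\<forall>x\<in>set w. x < 3" for c i w
      using reach_corner[of "z @ [c]" m n w i] that Suc.prems m by auto
    have J: "(z @ c # replicate m d, z @ d # replicate m c) \<in> contr_rel n" if "c < 3" "d < 3" for c d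
      using reach_junction[of z m n c d] that Suc.prems m by auto
    have P: "reach n (corner_dist d w + corner_dist c w') (z @ c # w) (z @ d # w')"
      if "c < 3" "d < 3" "length w = m" "\<forall>x\<in>set w. x < 3" "length w' = m" "\<forall>x\<in>set w'. x < 3" for c d w w'
      using reach_trans[OF reach_cls[OF C[of c d w] J[of c d]] reach_sym[OF C[of d c w']]] that by blast
    show ?thesis
    proof (cases "a = b")
      case True
      then show ?thesis using Suc.IH[of "z @ [a]" s t] u v Suc.prems m by auto
    next
      case False
      define k where "k = 3 - a - b"
      have k: "k < 3" "k \<noteq> a" "k \<noteq> b" using False u(3) v(3) unfolding k_def by arith+
      have 1: "reach n (corner_dist b s + corner_dist a t) (z @ a # s) (z @ b # t)" using P u v by blast
      \<comment> \<open>The detour enters copy \<open>k\<close> at its corner \<open>a\<close> and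
        ends at its corner \<open>b\<close>, so crossing it costs one side.\<close>
      have 2: "reach n (corner_dist k s + corner_dist a (replicate m b)) (z @ a # s) (z @ k # replicate m b)"
        using P[of a k s "replicate m b"] k u v by auto
      have 3: "reach n (corner_dist k t) (z @ k # replicate m b) (z @ b # t)"
        using reach_sym[OF reach_cls[OF C[of b k t] J[of b k]]] k v by blast
      have "reach n (corner_dist k s + 2 ^ (m - 1) + corner_dist k t) (z @ a # s) (z @ b # t)"
        using reach_trans[OF 2 3] False m by (auto simp: corner_dist_replicate')
      then show ?thesis using 1 False u v m by (auto simp: min_def k_def)
    qed
  qed
qed simp

theorem ST_graph_dist:
  assumes "u \<in> sier_verts (Suc n)" "v \<in> sier_verts (Suc n)"
  shows "graph_dist (ST_verts n) (ST_edge n) (cls n u) (cls n v) = enat (word_dist u v)"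
proof (rule antisym)
  have "reach n (word_dist u v) u v"
    using reach_word_dist[of "[]" "Suc n" n u v] assms by (auto simp: sier_verts_def)
  then obtain j where j: "j \<le> word_dist u v" "(cls n u, cls n v) \<in> ST_rel n ^^ j"
    unfolding reach_def by blast
  have "graph_dist (ST_verts n) (ST_edge n) (cls n u) (cls n v) \<le> enat j"
    unfolding graph_dist_def using j(2) by (intro INF_lower) simp
  then show "graph_dist (ST_verts n) (ST_edge n) (cls n u) (cls n v) \<le> enat (word_dist u v)"
    using j(1) by (meson enat_ord_simps(1) order_trans)
  show "enat (word_dist u v) \<le> graph_dist (ST_verts n) (ST_edge n) (cls n u) (cls n v)"
    unfolding graph_dist_def
  proof (rule INF_greatest)
    fix k assume "k \<in> {k. (cls n u, cls n v) \<in> ST_rel n ^^ k}"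
    then have "word_dist u v \<le> k"
      using word_dist_le_walk[of "cls n u" "cls n v" k n u v] cls_in_verts[OF assms(1)] self_in_cls by blast
    then show "enat (word_dist u v) \<le> enat k" by simp
  qed
qed

section \<open>Certificates for one copy of dimension 2\<close>

text \<open>
  Tags T1, T2, T3 stand for the colours 1, 2, 3, and TU for all other colours. A mask belongs to a vertex:
  which of the later vertices may repeat its tag, for each of the three tags, and its weight when tagged TU.
  A side describes a shared corner: its tag, whether colour 2 occurs at distance 1 from it,
  and whether colour 3 occurs at distance 1 or 2 from it (NF: it does not).
  The three nested levels of Nd are indexed by the positions of the colours 7, 6, 5, with index 0 for an
  absent colour; X marks impossible positions. En g B L lists the states up to domination; g is a lower bound
  for the weight, and nothing is claimed for weights above B. Wd records only a lower bound.
  The rows are functions on unit so that the simplifier does not unfold them before they are needed.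
\<close>

datatype tag = T1 | T2 | T3 | TU
datatype mask = Mask "bool list" "bool list" "bool list" nat
datatype near = N1 | N2 | NF
datatype side = Side tag near near
datatype wt = W3 | W4 | W5 | W6 | W7 | W8 | W9 | W10 | W11 | W12
datatype state = St wt side side
datatype tree = X | Wd wt | En wt wt "state list" | Nd wt wt "unit \<Rightarrow> tree list"
datatype pt = NoP | Pt nat nat

text \<open>
  Numbers are written in unary, which makes comparisons cheap when the checks are evaluated by rewriting.
\<close>

abbreviation (input) w1 :: nat where "w1 \<equiv> Suc 0"
abbreviation (input) w2 :: nat where "w2 \<equiv> Suc w1"
abbreviation (input) w3 :: nat where "w3 \<equiv> Suc w2"
abbreviation (input) w4 :: nat where "w4 \<equiv> Suc w3"
abbreviation (input) w5 :: nat where "w5 \<equiv> Suc w4"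
abbreviation (input) w6 :: nat where "w6 \<equiv> Suc w5"
abbreviation (input) w7 :: nat where "w7 \<equiv> Suc w6"
abbreviation (input) w8 :: nat where "w8 \<equiv> Suc w7"
abbreviation (input) w9 :: nat where "w9 \<equiv> Suc w8"
abbreviation (input) w10 :: nat where "w10 \<equiv> Suc w9"
abbreviation (input) w11 :: nat where "w11 \<equiv> Suc w10"
abbreviation (input) w12 :: nat where "w12 \<equiv> Suc w11"
abbreviation (input) w13 :: nat where "w13 \<equiv> Suc w12"
abbreviation (input) w14 :: nat where "w14 \<equiv> Suc w13"
abbreviation (input) w15 :: nat where "w15 \<equiv> Suc w14"
abbreviation (input) w16 :: nat where "w16 \<equiv> Suc w15"
abbreviation (input) w17 :: nat where "w17 \<equiv> Suc w16"
abbreviation (input) w18 :: nat where "w18 \<equiv> Suc w17"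
abbreviation (input) w19 :: nat where "w19 \<equiv> Suc w18"
abbreviation (input) w20 :: nat where "w20 \<equiv> Suc w19"

section \<open>Exhaustive search over tag assignments, and what it must show\<close>

fun val :: "wt \<Rightarrow> nat" where
  "val W3 = w3" | "val W4 = w4" | "val W5 = w5" | "val W6 = w6" | "val W7 = w7" | "val W8 = w8"
| "val W9 = w9" | "val W10 = w10" | "val W11 = w11" | "val W12 = w12"

fun restrict :: "bool list \<Rightarrow> bool list \<Rightarrow> bool list" where
  "restrict (True # m) (a # as) = a # restrict m as"
| "restrict (False # m) (a # as) = False # restrict m as"
| "restrict [] as = []" | "restrict m [] = []"

text \<open>The lists \<open>a1\<close>, \<open>a2\<close>, \<open>a3\<close> say for each remaining
  vertex whether the tags T1, T2, T3 are still admissible; \<open>b\<close> is the weight that may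
  still be spent on TU, \<open>w\<close> the weight already spent, \<open>acc\<close> the tags so
  far in reverse. All branches are conjoined and \<open>K\<close> judges complete assignments, so
  the value is a universal statement about them.\<close>

primrec dfs :: "(tag list \<Rightarrow> nat \<Rightarrow> bool) \<Rightarrow> mask list \<Rightarrow> bool list \<Rightarrow> bool list \<Rightarrow> bool list \<Rightarrow> nat \<Rightarrow> nat \<Rightarrow> tag list \<Rightarrow> bool" where
  "dfs K [] a1 a2 a3 b w acc = K acc w"
| "dfs K (mk # ms) a1 a2 a3 b w acc = (case mk of Mask m1 m2 m3 j \<Rightarrow>
    (hd a1 \<longrightarrow> dfs K ms (restrict m1 (tl a1)) (tl a2) (tl a3) b w (T1 # acc)) \<and>
    (hd a2 \<longrightarrow> dfs K ms (tl a1) (restrict m2 (tl a2)) (tl a3) b w (T2 # acc)) \<and>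
    (hd a3 \<longrightarrow> dfs K ms (tl a1) (tl a2) (restrict m3 (tl a3)) b w (T3 # acc)) \<and>
    (j \<le> b \<longrightarrow> dfs K ms (tl a1) (tl a2) (tl a3) (b - j) (w + j) (TU # acc)))"

text \<open>\<open>dfs1\<close> to \<open>dfs4\<close> are guards for evaluation by rewriting: their
  equations fire only after the Boolean or the unary budget has become explicit, so no branch is
  expanded before it is known to be entered. Constants ending in \<open>_if\<close> serve the same
  purpose.\<close>

definition "dfs1 x K m ms a1 a2 a3 b w acc \<longleftrightarrow> (x \<longrightarrow> dfs K ms (restrict m a1) a2 a3 b w (T1 # acc))"
definition "dfs2 x K m ms a1 a2 a3 b w acc \<longleftrightarrow> (x \<longrightarrow> dfs K ms a1 (restrict m a2) a3 b w (T2 # acc))"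
definition "dfs3 x K m ms a1 a2 a3 b w acc \<longleftrightarrow> (x \<longrightarrow> dfs K ms a1 a2 (restrict m a3) b w (T3 # acc))"
definition "dfs4 j K ms a1 a2 a3 b w acc \<longleftrightarrow> (j \<le> b \<longrightarrow> dfs K ms a1 a2 a3 (b - j) (w + j) (TU # acc))"

lemma dfs_eqs:
  "dfs K [] a1 a2 a3 b w acc = K acc w"
  "dfs K (Mask m1 m2 m3 j # ms) (x1 # a1) (x2 # a2) (x3 # a3) b w acc =
    (dfs1 x1 K m1 ms a1 a2 a3 b w acc \<and> dfs2 x2 K m2 ms a1 a2 a3 b w acc \<and>
     dfs3 x3 K m3 ms a1 a2 a3 b w acc \<and> dfs4 j K ms a1 a2 a3 b w acc)"
  "dfs1 True K m ms a1 a2 a3 b w acc = dfs K ms (restrict m a1) a2 a3 b w (T1 # acc)"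
  "dfs2 True K m ms a1 a2 a3 b w acc = dfs K ms a1 (restrict m a2) a3 b w (T2 # acc)"
  "dfs3 True K m ms a1 a2 a3 b w acc = dfs K ms a1 a2 (restrict m a3) b w (T3 # acc)"
  "dfs1 False K m ms a1 a2 a3 b w acc = True"
  "dfs2 False K m ms a1 a2 a3 b w acc = True"
  "dfs3 False K m ms a1 a2 a3 b w acc = True"
  "dfs4 w1 K ms a1 a2 a3 (Suc b) w acc = dfs K ms a1 a2 a3 b (Suc w) (TU # acc)"
  "dfs4 w1 K ms a1 a2 a3 0 w acc = True"
  "dfs4 w2 K ms a1 a2 a3 (Suc (Suc b)) w acc = dfs K ms a1 a2 a3 b (Suc (Suc w)) (TU # acc)"
  "dfs4 w2 K ms a1 a2 a3 w1 w acc = True"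
  "dfs4 w2 K ms a1 a2 a3 0 w acc = True"
  "restrict (True # m) (a # as) = a # restrict m as" "restrict (False # m) (a # as) = False # restrict m as" "restrict [] [] = []"
  by (simp_all add: dfs1_def dfs2_def dfs3_def dfs4_def)

text \<open>Smaller means closer to the corner, hence more restrictive for the neighbouring copy. A
  larger side is therefore at least as easy to join.\<close>

fun near_le :: "near \<Rightarrow> near \<Rightarrow> bool" where
  "near_le x NF = True" | "near_le N1 N2 = True" | "near_le N2 N2 = True" | "near_le N1 N1 = True"
| "near_le N2 N1 = False" | "near_le NF N1 = False" | "near_le NF N2 = False"

fun side_le :: "side \<Rightarrow> side \<Rightarrow> bool" where
  "side_le (Side t x y) (Side t' x' y') = (t = t' \<and> near_le x x' \<and> near_le y y')"

primrec dominated :: "nat \<Rightarrow> side \<Rightarrow> side \<Rightarrow> state list \<Rightarrow> bool" where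
  "dominated w a b [] = False"
| "dominated w a b (s # L) = ((case s of St v a' b' \<Rightarrow> val v \<le> w \<and> side_le a a' \<and> side_le b b') \<or> dominated w a b L)"

fun cover0 :: "side \<Rightarrow> side \<Rightarrow> nat \<Rightarrow> tree \<Rightarrow> bool" where
  "cover0 a b w (En g B L) = (w \<le> val B \<longrightarrow> dominated w a b L)"
| "cover0 a b w (Wd g) = (val g \<le> w)"
| "cover0 a b w X = True"
| "cover0 a b w _ = False"

fun walk :: "(nat \<Rightarrow> tree \<Rightarrow> bool) \<Rightarrow> nat \<Rightarrow> tag list \<Rightarrow> nat list \<Rightarrow> tree list \<Rightarrow> bool" where
  "walk K w [] [] [] = True"
| "walk K w (t # ts) (c # cs) (r # rs) = ((t = TU \<longrightarrow> K (w - c) r) \<and> walk K w ts cs rs)"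
| "walk K w _ _ _ = False"

text \<open>One level of the table: one of the colours 7, 6, 5 is placed on each vertex tagged TU in
  turn, and the cost of that vertex is taken off the weight. TU is thus provisional; after three
  levels the weight is that of colour 4 and the colours from 8 on. The extra TU of cost 0 at the
  head of the lists stands for an absent colour.\<close>

fun coverN :: "(nat \<Rightarrow> tree \<Rightarrow> bool) \<Rightarrow> tag list \<Rightarrow> nat list \<Rightarrow> nat \<Rightarrow> tree \<Rightarrow> bool" where
  "coverN K ts cs w (Nd m M C) = (w \<le> val M \<longrightarrow> walk K w ts cs (C ()))"
| "coverN K ts cs w X = True"
| "coverN K ts cs w _ = False"

definition "cover0_if x a b w L \<longleftrightarrow> (x \<longrightarrow> dominated w a b L)"
definition "coverN_if x K ts cs w C \<longleftrightarrow> (x \<longrightarrow> walk K w ts cs (C ()))"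

lemma cover_eqs:
  "side_le (Side T1 x y) (Side T1 x' y') = (near_le x x' \<and> near_le y y')"
  "side_le (Side T2 x y) (Side T2 x' y') = (near_le x x' \<and> near_le y y')"
  "side_le (Side T3 x y) (Side T3 x' y') = (near_le x x' \<and> near_le y y')"
  "side_le (Side TU x y) (Side TU x' y') = (near_le x x' \<and> near_le y y')"
  "side_le (Side T1 x y) (Side T2 x' y') = False" "side_le (Side T1 x y) (Side T3 x' y') = False"
  "side_le (Side T1 x y) (Side TU x' y') = False" "side_le (Side T2 x y) (Side T1 x' y') = False"
  "side_le (Side T2 x y) (Side T3 x' y') = False" "side_le (Side T2 x y) (Side TU x' y') = False"
  "side_le (Side T3 x y) (Side T1 x' y') = False" "side_le (Side T3 x y) (Side T2 x' y') = False"
  "side_le (Side T3 x y) (Side TU x' y') = False" "side_le (Side TU x y) (Side T1 x' y') = False"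
  "side_le (Side TU x y) (Side T2 x' y') = False" "side_le (Side TU x y) (Side T3 x' y') = False"
  "dominated w a b [] = False"
  "dominated w a b (St v a' b' # L) = ((val v \<le> w \<and> side_le a a' \<and> side_le b b') \<or> dominated w a b L)"
  "cover0 a b w (En g B L) = cover0_if (w \<le> val B) a b w L" "cover0 a b w (Wd g) = (val g \<le> w)"
  "cover0 a b w X = True" "coverN K ts cs w X = True"
  "cover0_if False a b w L = True" "cover0_if True a b w L = dominated w a b L"
  "cover0 a b w X = True" "coverN K ts cs w X = True"
  "coverN K ts cs w (Nd m M C) = coverN_if (w \<le> val M) K ts cs w C"
  "coverN_if False K ts cs w C = True" "coverN_if True K ts cs w C = walk K w ts cs (C ())"
  "walk K w [] [] [] = True"
  "walk K w (T1 # ts) (c # cs) (r # rs) = walk K w ts cs rs"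
  "walk K w (T2 # ts) (c # cs) (r # rs) = walk K w ts cs rs"
  "walk K w (T3 # ts) (c # cs) (r # rs) = walk K w ts cs rs"
  "walk K w (TU # ts) (c # cs) (r # rs) = (K (w - c) r \<and> walk K w ts cs rs)"
  by (auto simp: cover0_if_def coverN_if_def)

lemma nat_eqs: "(Suc m \<le> Suc n) = (m \<le> n)" "(0 \<le> (n::nat)) = True" "(Suc m \<le> 0) = False"
  "Suc m - Suc n = m - n" "(m::nat) - 0 = m" "0 - (n::nat) = 0"
  by auto

section \<open>The data of one copy of dimension 2\<close>

definition near2 :: "tag \<Rightarrow> tag \<Rightarrow> near" where
  "near2 a b = (if a = T2 \<or> b = T2 then N1 else NF)"
definition near3 :: "tag \<Rightarrow> tag \<Rightarrow> tag \<Rightarrow> tag \<Rightarrow> tag \<Rightarrow> near" where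
  "near3 a b c d e = (if a = T3 \<or> b = T3 then N1 else if c = T3 \<or> d = T3 \<or> e = T3 then N2 else NF)"
definition "is3 t d = (if t = T3 then N2 else d)"

lemma near_eqs:
  "near2 T2 b = N1" "near2 T1 T2 = N1" "near2 T3 T2 = N1" "near2 TU T2 = N1"
  "near2 T1 T1 = NF" "near2 T1 T3 = NF" "near2 T1 TU = NF" "near2 T3 T1 = NF" "near2 T3 T3 = NF" "near2 T3 TU = NF"
  "near2 TU T1 = NF" "near2 TU T3 = NF" "near2 TU TU = NF"
  "near3 T3 b c d e = N1"
  "near3 T1 T3 c d e = N1" "near3 T2 T3 c d e = N1" "near3 TU T3 c d e = N1"
  "near3 T1 T1 c d e = is3 c (is3 d (is3 e NF))" "near3 T1 T2 c d e = is3 c (is3 d (is3 e NF))"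
  "near3 T1 TU c d e = is3 c (is3 d (is3 e NF))" "near3 T2 T1 c d e = is3 c (is3 d (is3 e NF))"
  "near3 T2 T2 c d e = is3 c (is3 d (is3 e NF))" "near3 T2 TU c d e = is3 c (is3 d (is3 e NF))"
  "near3 TU T1 c d e = is3 c (is3 d (is3 e NF))" "near3 TU T2 c d e = is3 c (is3 d (is3 e NF))"
  "near3 TU TU c d e = is3 c (is3 d (is3 e NF))"
  "is3 T3 x = N2" "is3 T1 x = x" "is3 T2 x = x" "is3 TU x = x"
  by (auto simp: near2_def near3_def is3_def)

text \<open>One representative for each of the 15 vertices. Letter 0 names the outer corner, 1 the
  corner shared with the next copy, 2 the one shared with the previous copy. The masks run through
  this list backwards, so that the tags accumulated by \<open>dfs\<close> come out in this
  order.\<close>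

definition local_words :: "nat list list" where "local_words = [[0,0,0], [1,1,1], [1,0,1], [2,2,2], [1,1,2], [2,1,2], [1,2,2], [1,0,2], [2,0,1], [2,0,2], [0,2,2], [0,1,1], [0,0,1], [0,1,2], [0,0,2]]"
definition costs :: "nat list" where "costs = [0,w2,w1,w2,w1,w2,w2,w2,w2,w2,w2,w2,w2,w2,w2,w2]"
text \<open>A position is recorded by its distances to corners 1 and 2, which is all that the other
  copies can see of it. Indices are shifted by one against \<open>local_words\<close>, with index 0
  for an absent colour.\<close>

definition points :: "pt list" where "points = [NoP,Pt w4 w4,Pt 0 w4,Pt w1 w4,Pt w4 0,Pt w1 w3,Pt w3 w1,Pt w2 w2,Pt w2 w3,Pt w3 w2,Pt w4 w1,Pt w4 w2,Pt w2 w4,Pt w3 w4,Pt w3 w3,Pt w4 w3]"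
fun leaf :: "tree \<Rightarrow> tag list \<Rightarrow> nat \<Rightarrow> bool" where
  "leaf t [c0,c1,c2,c3,c4,c5,c6,c7,c8,c9,c10,c11,c12,c13,c14] w = coverN (coverN (coverN (cover0
     (Side c1 (near2 c2 c4) (near3 c2 c4 c6 c7 c11))
     (Side c3 (near2 c5 c9) (near3 c5 c9 c6 c8 c10))) (TU # [c0,c1,c2,c3,c4,c5,c6,c7,c8,c9,c10,c11,c12,c13,c14]) costs) (TU # [c0,c1,c2,c3,c4,c5,c6,c7,c8,c9,c10,c11,c12,c13,c14]) costs) (TU # [c0,c1,c2,c3,c4,c5,c6,c7,c8,c9,c10,c11,c12,c13,c14]) costs w t"
| "leaf t _ w = False"

definition local_masks where "local_masks = [Mask [False,False,True,False,True,True,True,True,True,True,True,True,True,False] [False,False,False,False,False,False,True,True,True,True,True,True,True,False] [False,False,False,False,False,False,False,False,False,True,False,False,True,False] w2,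
 Mask [False,False,False,True,True,True,True,True,True,True,True,True,True] [False,False,False,False,False,False,True,True,True,True,False,True,False] [False,False,False,False,False,False,False,False,False,False,False,False,False] w2,
 Mask [False,True,True,True,True,True,True,True,True,True,True,False] [False,False,True,True,False,True,True,True,True,False,True,False] [False,False,False,False,False,False,True,False,True,False,False,False] w2,
 Mask [True,True,True,False,True,True,True,True,False,True,True] [False,True,True,False,False,True,False,True,False,False,False] [False,False,False,False,False,False,False,True,False,False,False] w2,
 Mask [False,False,True,True,True,True,True,True,True,True] [False,False,True,False,False,True,False,True,True,False] [False,False,False,False,False,False,False,False,True,False] w2,
 Mask [False,True,True,False,True,False,True,True,True] [False,True,False,False,True,False,True,True,True] [False,False,False,False,False,False,True,True,False] w2,
 Mask [True,False,False,True,True,True,True,True] [False,False,False,False,False,True,True,True] [False,False,False,False,False,False,False,False] w2,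
 Mask [False,True,False,True,False,True,True] [False,False,False,True,False,False,True] [False,False,False,False,False,False,False] w2,
 Mask [False,False,True,True,True,True] [False,False,False,False,False,True] [False,False,False,False,False,True] w2,
 Mask [True,False,True,True,True] [False,False,True,True,True] [False,False,False,False,True] w2,
 Mask [True,False,False,True] [True,False,False,True] [False,False,False,True] w2,
 Mask [True,True,True] [True,True,True] [True,True,True] w1,
 Mask [False,True] [False,True] [False,False] w2,
 Mask [True] [True] [True] w1,
 Mask [] [] [] w2]"
definition "trues = [True,True,True,True,True,True,True,True,True,True,True,True,True,True,True]"

section \<open>Joining three copies\<close>

fun cmp :: "side \<Rightarrow> side \<Rightarrow> bool" where
  "cmp (Side t x y) (Side t' x' y') =
    (t = t' \<and> \<not> (x = N1 \<and> x' = N1) \<and> (y = NF \<or> y' = NF \<or> y = N2 \<and> y' = N2))"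
text \<open>The value 14 removes impossible positions from every triple of total weight at most 14,
  since all other entries weigh at least 3.\<close>

fun low :: "tree \<Rightarrow> nat" where
  "low X = w14" | "low (Wd g) = val g" | "low (En g B L) = val g" | "low (Nd m M C) = val m"
text \<open>The weight from which on an entry lists no states.\<close>

fun cap :: "tree \<Rightarrow> nat" where
  "cap X = 0" | "cap (Wd g) = val g" | "cap (En g B L) = Suc (val B)" | "cap (Nd m M C) = Suc (val M)"
fun states_of :: "tree \<Rightarrow> state list" where "states_of (En g B L) = L" | "states_of t = []"
fun kids :: "tree \<Rightarrow> tree list" where "kids (Nd m M C) = C ()" | "kids t = []"

text \<open>The three state loops look for states around the cycle of copies. Here \<open>b\<close>
  is the weight left; in the outer loops \<open>g1\<close> and \<open>g2\<close> are lower bounds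
  for copies whose state is not yet chosen.\<close>

primrec third_state :: "nat \<Rightarrow> side \<Rightarrow> side \<Rightarrow> state list \<Rightarrow> bool" where
  "third_state b a1 b0 [] = True"
| "third_state b a1 b0 (s # L) = ((case s of St w a2 b2 \<Rightarrow> \<not> (val w \<le> b \<and> cmp a1 b2 \<and> cmp a2 b0)) \<and> third_state b a1 b0 L)"
definition "second_state_if x b a1 b0 L \<longleftrightarrow> (x \<longrightarrow> third_state b a1 b0 L)"
primrec second_state :: "nat \<Rightarrow> nat \<Rightarrow> side \<Rightarrow> side \<Rightarrow> state list \<Rightarrow> state list \<Rightarrow> bool" where
  "second_state b g2 a0 b0 L2 [] = True"
| "second_state b g2 a0 b0 L2 (s # L) = ((case s of St w a1 b1 \<Rightarrow> second_state_if (cmp a0 b1 \<and> val w \<le> b - g2) (b - val w) a1 b0 L2) \<and> second_state b g2 a0 b0 L2 L)"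
definition "first_state_if x b g2 a0 b0 L2 L1 \<longleftrightarrow> (x \<longrightarrow> second_state b g2 a0 b0 L2 L1)"
primrec first_state :: "nat \<Rightarrow> nat \<Rightarrow> state list \<Rightarrow> state list \<Rightarrow> state list \<Rightarrow> bool" where
  "first_state g1 g2 L1 L2 [] = True"
| "first_state g1 g2 L1 L2 (s # L) = ((case s of St w a0 b0 \<Rightarrow> first_state_if (val w \<le> w14 - g1 - g2) (w14 - val w) g2 a0 b0 L2 L1) \<and> first_state g1 g2 L1 L2 L)"
text \<open>The three conditions on \<open>cap\<close> dispose of weights about which an entry lists
  nothing: such a weight in one copy already exceeds 14 together with the least weights of the other
  two. Below these weights the listed states are complete up to domination.\<close>

definition join_leaf :: "tree \<Rightarrow> tree \<Rightarrow> tree \<Rightarrow> bool" where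
  "join_leaf t0 t1 t2 = (\<not> cap t0 \<le> w14 - low t1 - low t2 \<and> \<not> cap t1 \<le> w14 - low t0 - low t2 \<and>
     \<not> cap t2 \<le> w14 - low t0 - low t1 \<and> first_state (low t1) (low t2) (states_of t1) (states_of t2) (states_of t0))"

definition "third_child_if x K t0 t1 t2 \<longleftrightarrow> (x \<longrightarrow> K t0 t1 t2)" for K :: "tree \<Rightarrow> tree \<Rightarrow> tree \<Rightarrow> bool"
fun third_child :: "(tree \<Rightarrow> tree \<Rightarrow> tree \<Rightarrow> bool) \<Rightarrow> tree \<Rightarrow> tree \<Rightarrow> nat \<Rightarrow> bool list \<Rightarrow> bool list \<Rightarrow> tree list \<Rightarrow> bool" where
  "third_child K t0 t1 b (x # xs) (y # ys) (t2 # C) = (third_child_if (x \<and> y \<and> low t2 \<le> b) K t0 t1 t2 \<and> third_child K t0 t1 b xs ys C)"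
| "third_child K t0 t1 b _ _ _ = True"
definition "second_child_if x K t0 t1 b C2 row col \<longleftrightarrow> (x \<longrightarrow> third_child K t0 t1 b row col C2)"
fun second_child :: "(tree \<Rightarrow> tree \<Rightarrow> tree \<Rightarrow> bool) \<Rightarrow> tree \<Rightarrow> nat \<Rightarrow> nat \<Rightarrow> tree list \<Rightarrow> bool list \<Rightarrow> bool list \<Rightarrow> bool list list \<Rightarrow> tree list \<Rightarrow> bool" where
  "second_child K t0 b m2 C2 col (x # xs) (row # rows) (t1 # C) =
     (second_child_if (x \<and> low t1 \<le> b - m2) K t0 t1 (b - low t1) C2 row col \<and> second_child K t0 b m2 C2 col xs rows C)"
| "second_child K t0 b m2 C2 col _ _ _ = True"
definition "first_child_if x K R t0 b m2 C1 C2 row col \<longleftrightarrow> (x \<longrightarrow> second_child K t0 b m2 C2 col row R C1)"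
fun first_child :: "(tree \<Rightarrow> tree \<Rightarrow> tree \<Rightarrow> bool) \<Rightarrow> bool list list \<Rightarrow> nat \<Rightarrow> nat \<Rightarrow> tree list \<Rightarrow> tree list \<Rightarrow> bool list list \<Rightarrow> bool list list \<Rightarrow> tree list \<Rightarrow> bool" where
  "first_child K R m1 m2 C1 C2 (row # rows) (col # cols) (t0 # C) =
     (first_child_if (low t0 \<le> w14 - m1 - m2) K R t0 (w14 - low t0) m2 C1 C2 row col \<and> first_child K R m1 m2 C1 C2 rows cols C)"
| "first_child K R m1 m2 C1 C2 _ _ _ = True"
text \<open>Row \<open>i\<close> of \<open>R\<close> tells which positions in the next copy agree
  with position \<open>i\<close> in a copy. Row \<open>i\<close> of \<open>S\<close> tells which
  positions in the third copy agree with position \<open>i\<close> in the first, closing the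
  cycle.\<close>

definition join_level where
  "join_level K R S t0 t1 t2 = first_child K R (low t1) (low t2) (kids t1) (kids t2) R S (kids t0)"

text \<open>Corner 1 of the first copy is corner 2 of the next, so the coordinate 0 must occur on
  both sides or on neither. The other two inequalities are the routes through this corner and
  through the third copy, whose side is 4.\<close>

fun far :: "nat \<Rightarrow> pt \<Rightarrow> pt \<Rightarrow> bool" where
  "far c NoP NoP = True"
| "far c NoP (Pt a b) = (b \<noteq> 0)"
| "far c (Pt a b) NoP = (a \<noteq> 0)"
| "far c (Pt a b) (Pt a' b') = (if a = 0 \<or> b' = 0 then a = 0 \<and> b' = 0 else c < a + b' \<and> c < b + (w4 + a'))"
text \<open>Breaks the rotational symmetry: a copy without the colour may only be followed by one
  without it. It is used for colour 7 between the first and second and between the second and third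
  copy; the closing pair keeps \<open>far\<close>.\<close>

fun far1 :: "nat \<Rightarrow> pt \<Rightarrow> pt \<Rightarrow> bool" where
  "far1 c NoP q = (q = NoP)" | "far1 c (Pt a b) q = far c (Pt a b) q"

lemma far_eqs:
  "far c NoP NoP = True" "far c NoP (Pt a 0) = False" "far c NoP (Pt a (Suc b)) = True"
  "far c (Pt 0 b) NoP = False" "far c (Pt (Suc a) b) NoP = True"
  "far c (Pt 0 b) (Pt a' 0) = True" "far c (Pt (Suc a) b) (Pt a' 0) = False" "far c (Pt 0 b) (Pt a' (Suc b')) = False"
  "far c (Pt (Suc a) b) (Pt a' (Suc b')) = (Suc c \<le> Suc a + Suc b' \<and> Suc c \<le> b + (w4 + a'))"
  "far1 c NoP NoP = True" "far1 c NoP (Pt a b) = False" "far1 c (Pt a b) q = far c (Pt a b) q"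
  "(0::nat) + b = b" "Suc a + b = Suc (a + b)"
  by auto

lemma join_eqs:
  "third_state b a1 b0 [] = True"
  "third_state b a1 b0 (St w a2 b2 # L) = (\<not> (val w \<le> b \<and> cmp a1 b2 \<and> cmp a2 b0) \<and> third_state b a1 b0 L)"
  "second_state b g2 a0 b0 L2 [] = True"
  "second_state b g2 a0 b0 L2 (St w a1 b1 # L) = (second_state_if (cmp a0 b1 \<and> val w \<le> b - g2) (b - val w) a1 b0 L2 \<and> second_state b g2 a0 b0 L2 L)"
  "first_state g1 g2 L1 L2 [] = True"
  "first_state g1 g2 L1 L2 (St w a0 b0 # L) = (first_state_if (val w \<le> w14 - g1 - g2) (w14 - val w) g2 a0 b0 L2 L1 \<and> first_state g1 g2 L1 L2 L)"
  "second_state_if True b a1 b0 L = third_state b a1 b0 L" "second_state_if False b a1 b0 L = True"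
  "first_state_if True b g2 a0 b0 L2 L1 = second_state b g2 a0 b0 L2 L1" "first_state_if False b g2 a0 b0 L2 L1 = True"
  "third_child_if True K t0 t1 t2 = K t0 t1 t2" "third_child_if False K t0 t1 t2 = True"
  "second_child_if True K t0 t1 b C2 row col = third_child K t0 t1 b row col C2" "second_child_if False K t0 t1 b C2 row col = True"
  "first_child_if True K R t0 b m2 C1 C2 row col = second_child K t0 b m2 C2 col row R C1" "first_child_if False K R t0 b m2 C1 C2 row col = True"
  "third_child K t0 t1 b (x # xs) (y # ys) (t2 # C) = (third_child_if (x \<and> y \<and> low t2 \<le> b) K t0 t1 t2 \<and> third_child K t0 t1 b xs ys C)"
  "third_child K t0 t1 b xs ys [] = True"
  "second_child K t0 b m2 C2 col (x # xs) (row # rows) (t1 # C) =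
     (second_child_if (x \<and> low t1 \<le> b - m2) K t0 t1 (b - low t1) C2 row col \<and> second_child K t0 b m2 C2 col xs rows C)"
  "second_child K t0 b m2 C2 col xs rows [] = True"
  "first_child K R m1 m2 C1 C2 (row # rows) (col # cols) (t0 # C) =
     (first_child_if (low t0 \<le> w14 - m1 - m2) K R t0 (w14 - low t0) m2 C1 C2 row col \<and> first_child K R m1 m2 C1 C2 rows cols C)"
  "first_child K R m1 m2 C1 C2 rows cols [] = True"
  by (auto simp: second_state_if_def first_state_if_def third_child_if_def second_child_if_def first_child_if_def)

text \<open>The comparisons enter as variables \<open>c2\<close>, \<open>c3\<close> and are later
  instantiated by constants of the same names. Evaluation then meets these constants, decided by a
  table of equations, instead of Boolean formulas.\<close>

lemma cmp_eqs:
  "cmp (Side T1 x y) (Side T1 x' y') = (c2 x x' \<and> c3 y y')" "cmp (Side T2 x y) (Side T2 x' y') = (c2 x x' \<and> c3 y y')"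
  "cmp (Side T3 x y) (Side T3 x' y') = (c2 x x' \<and> c3 y y')" "cmp (Side TU x y) (Side TU x' y') = (c2 x x' \<and> c3 y y')"
  "cmp (Side T1 x y) (Side T2 x' y') = False" "cmp (Side T1 x y) (Side T3 x' y') = False"
  "cmp (Side T1 x y) (Side TU x' y') = False" "cmp (Side T2 x y) (Side T1 x' y') = False"
  "cmp (Side T2 x y) (Side T3 x' y') = False" "cmp (Side T2 x y) (Side TU x' y') = False"
  "cmp (Side T3 x y) (Side T1 x' y') = False" "cmp (Side T3 x y) (Side T2 x' y') = False"
  "cmp (Side T3 x y) (Side TU x' y') = False" "cmp (Side TU x y) (Side T1 x' y') = False"
  "cmp (Side TU x y) (Side T2 x' y') = False" "cmp (Side TU x y) (Side T3 x' y') = False"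
  if "c2 = (\<lambda>x x'. \<not> (x = N1 \<and> x' = N1))" "c3 = (\<lambda>y y'. y = NF \<or> y' = NF \<or> y = N2 \<and> y' = N2)"
  using that by auto
definition "c2 x x' = (\<not> (x = N1 \<and> x' = N1))"
definition "c3 y y' = (y = NF \<or> y' = NF \<or> y = N2 \<and> y' = N2)"
lemma c2_c3_eqs: "c2 NF x = True" "c2 N2 x = True" "c2 N1 N1 = False" "c2 N1 N2 = True" "c2 N1 NF = True"
  "c3 NF y = True" "c3 N1 NF = True" "c3 N2 NF = True" "c3 N2 N2 = True" "c3 N1 N1 = False" "c3 N1 N2 = False" "c3 N2 N1 = False"
  by (auto simp: c2_def c3_def)
lemmas cmp_eqs2 = cmp_eqs[of c2 c3, OF ext[OF ext[OF c2_def]] ext[OF ext[OF c3_def]]]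

primrec far_row where "far_row F p [] = []" | "far_row F p (q # qs) = F p q # far_row F p qs" for F :: "pt \<Rightarrow> pt \<Rightarrow> bool"
primrec far_rows where "far_rows F qs [] = []" | "far_rows F qs (p # ps) = far_row F p qs # far_rows F qs ps"
primrec far_col where "far_col F p [] = []" | "far_col F p (q # qs) = F q p # far_col F p qs" for F :: "pt \<Rightarrow> pt \<Rightarrow> bool"
primrec far_cols where "far_cols F qs [] = []" | "far_cols F qs (p # ps) = far_col F p qs # far_cols F qs ps"

text \<open>The inequality between \<open>g\<close> and \<open>B\<close> lets \<open>g\<close>
  remain a lower bound for the weights above \<open>B\<close>, about which no state is
  listed.\<close>

fun entry_wf :: "tree \<Rightarrow> bool" where
  "entry_wf (Wd g) = True"
| "entry_wf (En g B L) = (val g \<le> Suc (val B) \<and> list_all (\<lambda>s. case s of St w a b \<Rightarrow> val g \<le> val w) L)"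
| "entry_wf _ = False"

fun bor :: "bool list \<Rightarrow> bool list \<Rightarrow> bool list" where
  "bor (x # xs) (y # ys) = (x \<or> y) # bor xs ys" | "bor [] ys = []" | "bor xs [] = []"

lemma length_bor: "length (bor xs ys) = min (length xs) (length ys)"
  by (induction xs ys rule: bor.induct) auto

lemma nth_bor: "i < length xs \<Longrightarrow> i < length ys \<Longrightarrow> bor xs ys ! i = (xs ! i \<or> ys ! i)"
  by (induction xs ys arbitrary: i rule: bor.induct) (auto simp: nth_Cons split: nat.splits)

text \<open>The flags mark positions occupied by colours placed on earlier levels. The bound on
  \<open>cap\<close> drops by at least 2 from a node to its child because placing a colour takes off
  at most 2.\<close>

fun children_wf :: "(bool list \<Rightarrow> tree \<Rightarrow> bool) \<Rightarrow> bool list \<Rightarrow> nat \<Rightarrow> nat \<Rightarrow> bool list \<Rightarrow> bool list list \<Rightarrow> tree list \<Rightarrow> bool" where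
  "children_wf K fl m M [] [] [] = True"
| "children_wf K fl m M (x # xs) (r # rs) (e # C) =
     ((x \<or> K (bor fl r) e \<and> Suc (Suc (cap e)) \<le> M \<and> m \<le> low e) \<and> children_wf K fl m M xs rs C)"
| "children_wf K fl m M _ _ _ = False"

fun node_wf :: "bool list list \<Rightarrow> (bool list \<Rightarrow> tree \<Rightarrow> bool) \<Rightarrow> bool list \<Rightarrow> tree \<Rightarrow> bool" where
  "node_wf I K fl (Nd m M C) = children_wf K fl (val m) (Suc (val M)) fl I (C ())"
| "node_wf I K fl _ = False"

section \<open>Soundness of the search and of the joining checks\<close>

fun ok_tags :: "mask list \<Rightarrow> tag list \<Rightarrow> bool" where
  "ok_tags [] [] = True"
| "ok_tags (Mask m1 m2 m3 j # ms) (t # ts) =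
    (list_all2 (\<lambda>x s. t = T1 \<and> s = T1 \<longrightarrow> x) m1 ts \<and>
     list_all2 (\<lambda>x s. t = T2 \<and> s = T2 \<longrightarrow> x) m2 ts \<and>
     list_all2 (\<lambda>x s. t = T3 \<and> s = T3 \<longrightarrow> x) m3 ts \<and> ok_tags ms ts)"
| "ok_tags _ _ = False"

fun tag_weight :: "mask list \<Rightarrow> tag list \<Rightarrow> nat" where
  "tag_weight (Mask m1 m2 m3 j # ms) (t # ts) = (if t = TU then j else 0) + tag_weight ms ts"
| "tag_weight _ _ = 0"

lemma restrict_sound:
  "list_all2 (\<lambda>x s. t = c \<and> s = c \<longrightarrow> x) m ts \<Longrightarrow> list_all2 (\<lambda>x s. s = c \<longrightarrow> x) a ts \<Longrightarrow> t = c \<Longrightarrow>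
   list_all2 (\<lambda>x s. s = c \<longrightarrow> x) (restrict m a) ts"
proof (induction m a arbitrary: ts rule: restrict.induct)
  case (1 m a as) then show ?case by (cases ts) auto
next
  case (2 m a as) then show ?case by (cases ts) auto
qed auto

text \<open>Induction with the invariant that the three lists permit every tag that
  \<open>ts\<close> still uses. Restricting a list by the mask of the current vertex keeps this,
  since \<open>ok_tags\<close> says that the mask allows every later repetition of its tag.\<close>

lemma dfs_sound:
  assumes "dfs K ms a1 a2 a3 b w acc" "ok_tags ms ts"
    "list_all2 (\<lambda>x s. s = T1 \<longrightarrow> x) a1 ts" "list_all2 (\<lambda>x s. s = T2 \<longrightarrow> x) a2 ts"
    "list_all2 (\<lambda>x s. s = T3 \<longrightarrow> x) a3 ts" "tag_weight ms ts \<le> b"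
  shows "K (rev ts @ acc) (w + tag_weight ms ts)"
  using assms
proof (induction ms arbitrary: a1 a2 a3 b w acc ts)
  case Nil
  then show ?case by (cases ts) auto
next
  case (Cons mk ms)
  obtain m1 m2 m3 j where mk: "mk = Mask m1 m2 m3 j" by (cases mk)
  obtain t ts' where ts: "ts = t # ts'" using Cons.prems(2) mk by (cases ts) auto
  obtain x1 a1' x2 a2' x3 a3' where a: "a1 = x1 # a1'" "a2 = x2 # a2'" "a3 = x3 # a3'"
    using Cons.prems(3-5) ts by (auto simp: list_all2_Cons2)
  note prems = Cons.prems[unfolded mk ts a]
  show ?case
  proof (cases t)
    case T1
    have "dfs K ms (restrict m1 a1') a2' a3' b w (T1 # acc)" using prems T1 by simp
    from Cons.IH[OF this, of ts'] prems T1 show ?thesis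
      using restrict_sound[of T1 T1 m1 ts' a1'] by (simp add: mk ts)
  next
    case T2
    have "dfs K ms a1' (restrict m2 a2') a3' b w (T2 # acc)" using prems T2 by simp
    from Cons.IH[OF this, of ts'] prems T2 show ?thesis
      using restrict_sound[of T2 T2 m2 ts' a2'] by (simp add: mk ts)
  next
    case T3
    have "dfs K ms a1' a2' (restrict m3 a3') b w (T3 # acc)" using prems T3 by simp
    from Cons.IH[OF this, of ts'] prems T3 show ?thesis
      using restrict_sound[of T3 T3 m3 ts' a3'] by (simp add: mk ts)
  next
    case TU
    have "dfs K ms a1' a2' a3' (b - j) (w + j) (TU # acc)" using prems TU by simp
    from Cons.IH[OF this, of ts'] prems TU show ?thesis
      by (simp add: mk ts ac_simps)
  qed
qed

definition tag_of :: "nat \<Rightarrow> tag" where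
  "tag_of c = (if c = 1 then T1 else if c = 2 then T2 else if c = 3 then T3 else TU)"

lemma tag_of_iff: "tag_of c = T1 \<longleftrightarrow> c = 1" "tag_of c = T2 \<longleftrightarrow> c = 2" "tag_of c = T3 \<longleftrightarrow> c = 3"
  "tag_of c = TU \<longleftrightarrow> c \<notin> {1, 2, 3}"
  by (auto simp: tag_of_def)

definition cost :: "nat list \<Rightarrow> nat" where
  "cost v = (if v = [1, 1, 1] \<or> v = [2, 2, 2] then 1 else 2)"

fun masks :: "nat list list \<Rightarrow> mask list" where
  "masks [] = []"
| "masks (v # vs) = Mask (map (\<lambda>u. 1 < word_dist v u) vs) (map (\<lambda>u. 2 < word_dist v u) vs)
     (map (\<lambda>u. 3 < word_dist v u) vs) (cost v) # masks vs"

lemma ok_tags_masks: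
  assumes "distinct vs" "\<And>u v. u \<in> set vs \<Longrightarrow> v \<in> set vs \<Longrightarrow> u \<noteq> v \<Longrightarrow> f u = f v \<Longrightarrow> f u < word_dist u v"
  shows "ok_tags (masks vs) (map (\<lambda>v. tag_of (f v)) vs)"
  using assms
proof (induction vs)
  case (Cons v vs)
  have "f v < word_dist v u" if "u \<in> set vs" "f u = f v" for u using Cons.prems(1) Cons.prems(2)[of v u] that by auto
  then show ?case using Cons by (auto simp: list_all2_map1 list_all2_map2 list_all2_same tag_of_iff)
qed simp

lemma tag_weight_masks:
  "tag_weight (masks vs) (map (\<lambda>v. tag_of (f v)) vs) = (\<Sum>v\<leftarrow>vs. if tag_of (f v) = TU then cost v else 0)"
  by (induction vs) auto

fun child :: "tree \<Rightarrow> nat \<Rightarrow> tree" where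
  "child (Nd m M C) i = C () ! i" | "child t i = X"

lemma walk_sound: "walk K w ts cs rs \<Longrightarrow> i < length ts \<Longrightarrow> ts ! i = TU \<Longrightarrow> K (w - cs ! i) (rs ! i)"
proof (induction K w ts cs rs arbitrary: i rule: walk.induct)
  case (2 K w t ts c cs r rs)
  then show ?case by (cases i) auto
qed auto

lemma children_wf_sound:
  "children_wf K fl m M xs rs C \<Longrightarrow> i < length xs \<Longrightarrow> \<not> xs ! i \<Longrightarrow>
   K (bor fl (rs ! i)) (C ! i) \<and> Suc (Suc (cap (C ! i))) \<le> M \<and> m \<le> low (C ! i)"
proof (induction K fl m M xs rs C arbitrary: i rule: children_wf.induct)
  case (2 K fl m M x xs r rs e C)
  then show ?case by (cases i) auto
qed auto

lemma children_wf_length: "children_wf K fl m M xs rs C \<Longrightarrow> length C = length xs"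
  by (induction K fl m M xs rs C rule: children_wf.induct) auto

lemma node_wf_child:
  assumes "node_wf I K fl t" "i < length fl" "\<not> fl ! i"
  shows "K (bor fl (I ! i)) (child t i)" "cap (child t i) + 2 \<le> cap t" "low t \<le> low (child t i)"
  using assms by (cases t; auto dest!: children_wf_sound)+

text \<open>The disjunction is the invariant on the way down the table. If the weight is beyond what
  the node describes, it stays beyond what the child describes after subtracting a cost of at most
  2.\<close>

lemma coverN_sound:
  assumes "coverN K ts cs w t \<or> cap t \<le> w" "node_wf I K' fl t" "length fl = length ts"
    "i < length ts" "\<not> fl ! i" "ts ! i = TU" "cs ! i \<le> 2"
  shows "K (w - cs ! i) (child t i) \<or> cap (child t i) \<le> w - cs ! i"
proof (cases "cap t \<le> w")
  case True
  then have "cap (child t i) + 2 \<le> w" using node_wf_child(2)[OF assms(2)] assms by (metis order_trans)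
  then show ?thesis using assms(7) by (intro disjI2) linarith
next
  case False
  obtain m M C where t: "t = Nd m M C" using assms(2) by (cases t) auto
  then have "walk K w ts cs (C ())" using assms False by auto
  then show ?thesis using walk_sound assms t by auto
qed

lemma third_child_sound: "third_child K t0 t1 b xs ys C \<Longrightarrow> k < length xs \<Longrightarrow> k < length ys \<Longrightarrow> k < length C \<Longrightarrow>
   xs ! k \<Longrightarrow> ys ! k \<Longrightarrow> low (C ! k) \<le> b \<Longrightarrow> K t0 t1 (C ! k)"
proof (induction K t0 t1 b xs ys C arbitrary: k rule: third_child.induct)
  case (1 K t0 t1 b x xs y ys t2 C)
  then show ?case by (cases k) (auto simp: third_child_if_def)
qed auto

lemma second_child_sound: "second_child K t0 b m2 C2 col xs rows C \<Longrightarrow> j < length xs \<Longrightarrow> j < length rows \<Longrightarrow> j < length C \<Longrightarrow>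
   xs ! j \<Longrightarrow> low (C ! j) \<le> b - m2 \<Longrightarrow> third_child K t0 (C ! j) (b - low (C ! j)) (rows ! j) col C2"
proof (induction K t0 b m2 C2 col xs rows C arbitrary: j rule: second_child.induct)
  case (1 K t0 b m2 C2 col x xs row rows t1 C)
  then show ?case by (cases j) (auto simp: second_child_if_def)
qed auto

lemma first_child_sound: "first_child K R m1 m2 C1 C2 rows cols C \<Longrightarrow> i < length rows \<Longrightarrow> i < length cols \<Longrightarrow> i < length C \<Longrightarrow>
   low (C ! i) \<le> 14 - m1 - m2 \<Longrightarrow> second_child K (C ! i) (14 - low (C ! i)) m2 C2 (cols ! i) (rows ! i) R C1"
proof (induction K R m1 m2 C1 C2 rows cols C arbitrary: i rule: first_child.induct)
  case (1 K R m1 m2 C1 C2 row rows col cols t0 C)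
  then show ?case by (cases i) (auto simp: first_child_if_def eval_nat_numeral)
qed auto

lemma far_row_conv: "far_row F p qs = map (F p) qs" by (induction qs) auto
lemma far_rows_conv: "far_rows F qs ps = map (\<lambda>p. map (F p) qs) ps" by (induction ps) (auto simp: far_row_conv)
lemma far_col_conv: "far_col F p qs = map (\<lambda>q. F q p) qs" by (induction qs) auto
lemma far_cols_conv: "far_cols F qs ps = map (\<lambda>p. map (\<lambda>q. F q p) qs) ps" by (induction ps) (auto simp: far_col_conv)

lemma join_level_sound:
  assumes "join_level K (far_rows F ps ps) (far_cols G ps ps) t0 t1 t2"
    "node_wf I K0 fl0 t0" "node_wf I K1 fl1 t1" "node_wf I K2 fl2 t2"
    "length fl0 = length ps" "length fl1 = length ps" "length fl2 = length ps"
    "i < length ps" "j < length ps" "k < length ps" "\<not> fl0 ! i" "\<not> fl1 ! j" "\<not> fl2 ! k"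
    "F (ps ! i) (ps ! j)" "F (ps ! j) (ps ! k)" "G (ps ! k) (ps ! i)"
    "low (child t0 i) + low (child t1 j) + low (child t2 k) \<le> 14"
  shows "K (child t0 i) (child t1 j) (child t2 k)"
proof -
  obtain m0 M0 C0 where t0: "t0 = Nd m0 M0 C0" using assms(2) by (cases t0) auto
  obtain m1 M1 C1 where t1: "t1 = Nd m1 M1 C1" using assms(3) by (cases t1) auto
  obtain m2 M2 C2 where t2: "t2 = Nd m2 M2 C2" using assms(4) by (cases t2) auto
  have len: "length (C0 ()) = length ps" "length (C1 ()) = length ps" "length (C2 ()) = length ps"
    using assms(2-7) t0 t1 t2 children_wf_length by fastforce+
  have low: "low t0 \<le> low (child t0 i)" "low t1 \<le> low (child t1 j)" "low t2 \<le> low (child t2 k)"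
    using node_wf_child(3)[OF assms(2)] node_wf_child(3)[OF assms(3)] node_wf_child(3)[OF assms(4)] assms by auto
  have "second_child K (child t0 i) (14 - low (child t0 i)) (low t2) (C2 ()) (far_cols G ps ps ! i) (far_rows F ps ps ! i)
      (far_rows F ps ps) (C1 ())"
    using first_child_sound[of K "far_rows F ps ps" "low t1" "low t2" "C1 ()" "C2 ()" "far_rows F ps ps" "far_cols G ps ps" "C0 ()" i]
      assms low len unfolding join_level_def by (simp add: t0 t1 t2 far_rows_conv far_cols_conv)
  from second_child_sound[OF this, of j]
  have "third_child K (child t0 i) (child t1 j) (14 - low (child t0 i) - low (child t1 j)) (far_rows F ps ps ! j)
      (far_cols G ps ps ! i) (C2 ())"
    using assms low len by (simp add: t1 far_rows_conv far_cols_conv)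
  from third_child_sound[OF this, of k] show ?thesis
    using assms low len by (simp add: t2 far_rows_conv far_cols_conv)
qed

text \<open>This is what makes it enough to list states up to domination: passing to larger sides
  preserves compatibility.\<close>

lemma cmp_mono: "cmp a b \<Longrightarrow> side_le a a' \<Longrightarrow> side_le b b' \<Longrightarrow> cmp a' b'"
proof -
  have 1: "near_le x y \<longleftrightarrow> y = NF \<or> y = N2 \<and> x \<noteq> NF \<or> x = N1 \<and> y = N1" for x y
    by (cases x; cases y) auto
  show "cmp a b \<Longrightarrow> side_le a a' \<Longrightarrow> side_le b b' \<Longrightarrow> cmp a' b'"
    by (cases a; cases b; cases a'; cases b') (auto simp: 1)
qed

text \<open>\<open>NoP\<close> is not the same as itself, because several colours may be absent at
  once; index 0 is never marked as occupied.\<close>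

fun same :: "pt \<Rightarrow> pt \<Rightarrow> bool" where
  "same (Pt a b) (Pt a' b') = (a = a' \<and> b = b')" | "same _ _ = False"

lemma same_iff: "same p q \<longleftrightarrow> p = q \<and> p \<noteq> NoP" by (cases p; cases q) auto

definition side1 :: "(nat list \<Rightarrow> nat) \<Rightarrow> side" where
  "side1 f = Side (tag_of (f [1,1,1])) (near2 (tag_of (f [1,0,1])) (tag_of (f [1,1,2]))) (near3 (tag_of (f [1,0,1])) (tag_of (f [1,1,2])) (tag_of (f [1,2,2])) (tag_of (f [1,0,2])) (tag_of (f [0,1,1])))"
definition side2 :: "(nat list \<Rightarrow> nat) \<Rightarrow> side" where
  "side2 f = Side (tag_of (f [2,2,2])) (near2 (tag_of (f [2,1,2])) (tag_of (f [2,0,2]))) (near3 (tag_of (f [2,1,2])) (tag_of (f [2,0,2])) (tag_of (f [1,2,2])) (tag_of (f [2,0,1])) (tag_of (f [0,2,2])))"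

lemma leaf_conv:
  fixes f :: "nat list \<Rightarrow> nat"
  defines "ts \<equiv> TU # map (\<lambda>v. tag_of (f v)) local_words"
  shows "leaf t (map (\<lambda>v. tag_of (f v)) local_words) w =
    coverN (coverN (coverN (cover0 (side1 f) (side2 f)) ts costs) ts costs) ts costs w t"
  unfolding ts_def by (simp only: local_words_def list.map leaf.simps side1_def side2_def)

lemma word_dist_le_4: "length u = 3 \<Longrightarrow> length v = 3 \<Longrightarrow> word_dist u v \<le> 4"
proof -
  have "length u = Suc n \<Longrightarrow> length v = Suc n \<Longrightarrow> word_dist u v \<le> 2 ^ n" for n and u v :: "nat list"
  proof (induction n arbitrary: u v)
    case 0
    then show ?case by (cases u; cases v) auto
  next
    case (Suc n)
    obtain a s b t where uv: "u = a # s" "v = b # t" "length s = Suc n" "length t = Suc n"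
      using Suc.prems by (cases u; cases v) auto
    have "corner_dist b s \<le> 2 ^ n" "corner_dist a t \<le> 2 ^ n"
      using corner_dist_le[of s b] corner_dist_le[of t a] uv by fastforce+
    then show ?case using Suc.IH[of s t] uv by (auto simp: min_def)
  qed
  from this[of u 2 v] show "length u = 3 \<Longrightarrow> length v = 3 \<Longrightarrow> word_dist u v \<le> 4" by simp
qed

lemma masks_local: "local_masks = masks (rev local_words)"
  by (simp add: local_masks_def local_words_def cost_def)

lemma length_local: "length local_words = 15" by (simp add: local_words_def)
lemma distinct_local: "distinct local_words" by (simp add: local_words_def)
lemma length_in_local: "v \<in> set local_words \<Longrightarrow> length v = 3" by (auto simp: local_words_def)

lemma costs_conv: "costs = 0 # map cost local_words"
  by (simp add: costs_def local_words_def cost_def)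
lemma points_conv: "points = NoP # map (\<lambda>v. Pt (corner_dist 1 v) (corner_dist 2 v)) local_words"
  by (simp add: points_def local_words_def)
lemma distinct_points: "distinct points" by (simp add: points_def)
lemma length_points: "length points = 16" by (simp add: points_conv length_local)

lemma points_Suc: "k < 15 \<Longrightarrow> points ! Suc k = Pt (corner_dist 1 (local_words ! k)) (corner_dist 2 (local_words ! k))"
  by (simp add: points_conv length_local)
lemma costs_Suc: "k < 15 \<Longrightarrow> costs ! Suc k = cost (local_words ! k)"
  by (simp add: costs_conv length_local)
lemma costs_0: "costs ! 0 = 0" "points ! 0 = NoP" by (simp_all add: costs_conv points_conv)
lemma costs_le: "i < 16 \<Longrightarrow> costs ! i \<le> 2"
  using costs_Suc[of "i - 1"] costs_0 by (cases i) (auto simp: cost_def)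

section \<open>Colourings of one copy and of adjacent copies\<close>

definition local_ok :: "(nat list \<Rightarrow> nat) \<Rightarrow> bool" where
  "local_ok f \<longleftrightarrow> (\<forall>u\<in>set local_words. f u \<in> {1..11} \<and>
     (\<forall>v\<in>set local_words. u \<noteq> v \<longrightarrow> f u = f v \<longrightarrow> f u < word_dist u v))"

definition cross :: "nat list \<Rightarrow> nat list \<Rightarrow> nat" where
  "cross u v = min (corner_dist 1 u + corner_dist 2 v) (corner_dist 2 u + 4 + corner_dist 1 v)"

definition cross_ok :: "(nat list \<Rightarrow> nat) \<Rightarrow> (nat list \<Rightarrow> nat) \<Rightarrow> bool" where
  "cross_ok f g \<longleftrightarrow> f [1,1,1] = g [2,2,2] \<and>
     (\<forall>u\<in>set local_words. \<forall>v\<in>set local_words. f u = g v \<longrightarrow> cross u v = 0 \<or> f u < cross u v)"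

text \<open>An index into \<open>points\<close> and \<open>costs\<close>, hence the successor and
  the default 0. For colours from 4 on the choice is unambiguous, by
  \<open>local_unique\<close>.\<close>

definition pin :: "(nat list \<Rightarrow> nat) \<Rightarrow> nat \<Rightarrow> nat" where
  "pin f c = (if \<exists>k<15. f (local_words ! k) = c then Suc (SOME k. k < 15 \<and> f (local_words ! k) = c) else 0)"

lemma pin_Suc: "pin f c = Suc k \<Longrightarrow> k < 15 \<and> f (local_words ! k) = c"
  unfolding pin_def using someI_ex[of "\<lambda>k. k < 15 \<and> f (local_words ! k) = c"] by (auto split: if_splits)

lemma pin_0: "pin f c = 0 \<Longrightarrow> v \<in> set local_words \<Longrightarrow> f v \<noteq> c"
  unfolding pin_def by (auto split: if_splits simp: in_set_conv_nth length_local)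

lemma pin_less: "pin f c < 16"
  using pin_Suc[of f c] by (cases "pin f c") auto

text \<open>Dimension 2 has diameter at most 4, so a colour from 4 on cannot repeat in a
  copy.\<close>

lemma local_unique:
  assumes "local_ok f" "4 \<le> f u" "f u = f v" "u \<in> set local_words" "v \<in> set local_words"
  shows "u = v"
proof (rule ccontr)
  assume "u \<noteq> v"
  then have "f u < word_dist u v" using assms by (auto simp: local_ok_def)
  then show False using word_dist_le_4[of u v] length_in_local assms by fastforce
qed

text \<open>The delicate case is the common corner. If it is the position in one copy, it carries
  colour \<open>c\<close> in the other copy too, and uniqueness makes it the position there. Away
  from it, \<open>far\<close> just restates the bound on \<open>cross\<close>.\<close>

lemma pin_far:
  assumes "local_ok f" "local_ok g" "cross_ok f g" "4 \<le> c"
  shows "far c (points ! pin f c) (points ! pin g c)"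
proof -
  have A: "corner_dist i v = 0 \<Longrightarrow> v \<in> set local_words \<Longrightarrow> v = [i, i, i]" for i v
    using corner_dist_eq_0[of i v] length_in_local[of v] by (simp add: numeral_3_eq_3)
  have C: "corner_dist 1 [1,1,1] = 0" "corner_dist 2 [2,2,2] = 0" by simp_all
  have in1: "[1,1,1] \<in> set local_words" "[2,2,2] \<in> set local_words" by (simp_all add: local_words_def)
  have J: "f [1,1,1] = g [2,2,2]" using assms by (simp add: cross_ok_def)
  show ?thesis
  proof (cases "pin f c")
    case f0: 0
    show ?thesis
    proof (cases "pin g c")
      case 0
      then show ?thesis using f0 costs_0 by simp
    next
      case (Suc k)
      then have k: "k < 15" "g (local_words ! k) = c" using pin_Suc by auto
      have "corner_dist 2 (local_words ! k) \<noteq> 0"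
      proof
        assume "corner_dist 2 (local_words ! k) = 0"
        then have "local_words ! k = [2,2,2]" using A k length_local by simp
        then show False using k J pin_0[OF f0 in1(1)] by simp
      qed
      then show ?thesis using f0 Suc k costs_0 points_Suc by simp
    qed
  next
    case fS: (Suc j)
    then have j: "j < 15" "f (local_words ! j) = c" using pin_Suc by auto
    show ?thesis
    proof (cases "pin g c")
      case g0: 0
      have "corner_dist 1 (local_words ! j) \<noteq> 0"
      proof
        assume "corner_dist 1 (local_words ! j) = 0"
        then have "local_words ! j = [1,1,1]" using A j length_local by simp
        then show False using j J pin_0[OF g0 in1(2)] by simp
      qed
      then show ?thesis using g0 fS j costs_0 points_Suc by simp
    next
      case (Suc k)
      then have k: "k < 15" "g (local_words ! k) = c" using pin_Suc by auto
      define u v where uv: "u = local_words ! j" "v = local_words ! k"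
      have mem: "u \<in> set local_words" "v \<in> set local_words" using j k uv length_local by auto
      have fg: "f u = c" "g v = c" using j k uv by auto
      have X: "cross u v = 0 \<or> c < cross u v" using assms(3) mem fg unfolding cross_ok_def by metis
      have "v = [2,2,2]" if "u = [1,1,1]"
        using local_unique[OF assms(2), of v "[2,2,2]"] J that fg assms(4) mem in1 by auto
      moreover have "u = [1,1,1]" if "v = [2,2,2]"
        using local_unique[OF assms(1), of u "[1,1,1]"] J that fg assms(4) mem in1 by auto
      ultimately have "corner_dist 1 u = 0 \<longleftrightarrow> corner_dist 2 v = 0" using A mem C by metis
      then show ?thesis using X fS Suc j k uv points_Suc by (auto simp: cross_def min_def split: if_splits)
    qed
  qed
qed

definition rest_weight :: "(nat list \<Rightarrow> nat) \<Rightarrow> nat" where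
  "rest_weight f = (\<Sum>c\<in>{4,8,9,10,11}. costs ! pin f c)"

lemma pin_sum:
  assumes "local_ok f" "4 \<le> c"
  shows "(\<Sum>v\<in>set local_words. if f v = c then cost v else 0) = costs ! pin f c"
proof (cases "pin f c")
  case 0
  then show ?thesis using pin_0[OF 0] costs_0 by (auto intro!: sum.neutral)
next
  case (Suc k)
  then have k: "k < 15" "f (local_words ! k) = c" using pin_Suc by auto
  then have "(f v = c) = (v = local_words ! k)" if "v \<in> set local_words" for v
    using local_unique[OF assms(1), of v "local_words ! k"] assms(2) that length_local by auto
  then have "(\<Sum>v\<in>set local_words. if f v = c then cost v else 0) =
      (\<Sum>v\<in>set local_words. if v = local_words ! k then cost v else 0)"
    by (intro sum.cong) auto
  then show ?thesis using k Suc costs_Suc length_local by (simp add: sum.delta)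
qed

text \<open>The vertices tagged TU are those with a colour from 4 on. Each such colour occurs at
  most once, so a sum over vertices becomes a sum over colours.\<close>

lemma tag_weight_local:
  assumes "local_ok f"
  shows "tag_weight local_masks (map (\<lambda>v. tag_of (f v)) (rev local_words)) =
    rest_weight f + costs ! pin f 7 + costs ! pin f 6 + costs ! pin f 5"
proof -
  have "tag_weight local_masks (map (\<lambda>v. tag_of (f v)) (rev local_words)) =
      (\<Sum>v\<in>set local_words. if tag_of (f v) = TU then cost v else 0)"
    unfolding masks_local tag_weight_masks using distinct_local
    by (simp add: sum_list_distinct_conv_sum_set)
  also have "\<dots> = (\<Sum>v\<in>set local_words. \<Sum>c\<in>{4..11}. if f v = c then cost v else 0)"
    using assms by (intro sum.cong) (auto simp: tag_of_iff local_ok_def)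
  also have "\<dots> = (\<Sum>c\<in>{4..11}. \<Sum>v\<in>set local_words. if f v = c then cost v else 0)"
    by (rule sum.swap)
  also have "\<dots> = (\<Sum>c\<in>{4..11}. costs ! pin f c)"
    using pin_sum[OF assms] by (intro sum.cong) auto
  also have "{4..11::nat} = {4,5,6,7,8,9,10,11}" by auto
  finally show ?thesis by (simp add: rest_weight_def)
qed

text \<open>A colour from 8 on that is present in two copies sits at their common corner: otherwise
  the route through this corner, of length at most 4 + 4, would be too short. That corner costs 1 on
  each side and is not in the third copy, so the colour costs at most 2 in all. Colour 4 is only
  bounded by 2 in each copy.\<close>

lemma rest_weight_sum:
  assumes "local_ok f0" "local_ok f1" "local_ok f2" "cross_ok f0 f1" "cross_ok f1 f2" "cross_ok f2 f0"
  shows "rest_weight f0 + rest_weight f1 + rest_weight f2 \<le> 14"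
proof -
  have S: "costs ! i + costs ! j + costs ! k \<le> 2"
    if "i < 16" "j < 16" "k < 16" "far c (points ! i) (points ! j)" "far c (points ! j) (points ! k)" "far c (points ! k) (points ! i)"
      "8 \<le> c" for c i j k
  proof -
    have N: "costs ! i = 0" if "points ! i = NoP" "i < 16" for i
      using that costs_0 points_Suc[of "i - 1"] by (cases i) auto
    have Q: "a \<le> 4 \<and> b \<le> 4 \<and> \<not> (a = 0 \<and> b = 0) \<and> costs ! i \<le> 2 \<and> (a = 0 \<or> b = 0 \<longrightarrow> costs ! i = 1)"
      if p: "points ! i = Pt a b" "i < 16" for i a b
    proof -
      obtain l where l: "i = Suc l" "l < 15" using p costs_0 by (cases i) auto
      define v where "v = local_words ! l"
      have v: "v \<in> set local_words" using l length_local v_def by auto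
      have ab: "a = corner_dist 1 v" "b = corner_dist 2 v" "costs ! i = cost v"
        using p l points_Suc costs_Suc v_def by auto
      show ?thesis using v unfolding ab by (auto simp: local_words_def cost_def)
    qed
    \<comment> \<open>\<open>A l\<close> says that position \<open>l\<close> is corner 1,
      \<open>B l\<close> that it is corner 2; no position is both.\<close>
    define A B where "A l \<longleftrightarrow> (\<exists>b. points ! l = Pt 0 b)" and "B l \<longleftrightarrow> (\<exists>a. points ! l = Pt a 0)" for l
    have F: "A l \<and> B m" if h: "far c (points ! l) (points ! m)" "points ! l \<noteq> NoP" "points ! m \<noteq> NoP" "l < 16" "m < 16" for l m
    proof -
      obtain a b where l: "points ! l = Pt a b" using h by (cases "points ! l") auto
      obtain a' b' where m: "points ! m = Pt a' b'" using h by (cases "points ! m") auto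
      have ab: "a \<le> 4" "b' \<le> 4" using Q[OF l h(4)] Q[OF m h(5)] by blast+
      have "far c (Pt a b) (Pt a' b')" using h(1) unfolding l m .
      then have "(a = 0 \<and> b' = 0) \<or> c < a + b'" unfolding far.simps by meson
      then have "a = 0 \<and> b' = 0" using ab \<open>8 \<le> c\<close> by linarith
      then show ?thesis using l m unfolding A_def B_def by simp
    qed
    have C: "(A l \<or> B l \<longrightarrow> costs ! l = 1) \<and> \<not> (A l \<and> B l) \<and> costs ! l \<le> 2" if "l < 16" for l
    proof (cases "points ! l")
      case NoP
      then show ?thesis using N[OF _ that] unfolding A_def B_def by simp
    next
      case (Pt a b)
      then show ?thesis using Q[OF Pt that] unfolding A_def B_def by auto
    qed
    have F': "points ! i \<noteq> NoP \<Longrightarrow> points ! j \<noteq> NoP \<Longrightarrow> A i \<and> B j"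
      "points ! j \<noteq> NoP \<Longrightarrow> points ! k \<noteq> NoP \<Longrightarrow> A j \<and> B k"
      "points ! k \<noteq> NoP \<Longrightarrow> points ! i \<noteq> NoP \<Longrightarrow> A k \<and> B i"
      using F that by blast+
    have N': "points ! i = NoP \<Longrightarrow> costs ! i = 0" "points ! j = NoP \<Longrightarrow> costs ! j = 0" "points ! k = NoP \<Longrightarrow> costs ! k = 0"
      using N that by blast+
    show ?thesis
      using F' N' C[OF that(1)] C[OF that(2)] C[OF that(3)]
      by (cases "points ! i = NoP"; cases "points ! j = NoP"; cases "points ! k = NoP"; auto)
  qed
  have "costs ! pin f0 c + costs ! pin f1 c + costs ! pin f2 c \<le> 2" if "8 \<le> c" for c
    by (rule S[OF pin_less pin_less pin_less pin_far pin_far pin_far that]) (use assms that in linarith)+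
  from this[of 8] this[of 9] this[of 10] this[of 11] show ?thesis
    using costs_le[OF pin_less[of f0 4]] costs_le[OF pin_less[of f1 4]] costs_le[OF pin_less[of f2 4]]
    by (simp add: rest_weight_def)
qed

text \<open>All conflicts come from the route through the common corner. Colour 2 at distance 1 on
  both sides is 2 apart; colour 3 is 2 or 3 apart unless both occurrences are at distance 2, when 4
  is enough. Colour 1 needs only a distance of 2, which vertices of two copies off the corner have
  anyway.\<close>

lemma cmp_sides:
  assumes "cross_ok f g"
  shows "cmp (side1 f) (side2 g)"
proof -
  have J: "f [1,1,1] = g [2,2,2]" using assms by (simp add: cross_ok_def)
  have X: "cross u v = 0 \<or> c < cross u v" if "f u = c" "g v = c" "u \<in> set local_words" "v \<in> set local_words" for u v c
    using assms that unfolding cross_ok_def by metis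
  \<comment> \<open>Positivity of \<open>corner_dist 1 u\<close> excludes the alternative that
    \<open>cross u v\<close> is 0, so any route of length at most \<open>c\<close> is a
    conflict.\<close>
  have D: "\<not> (f u = c \<and> g v = c)" if "u \<in> set local_words" "v \<in> set local_words"
    "0 < corner_dist 1 u" "corner_dist 1 u + corner_dist 2 v \<le> c" "c < 4" for u v c
    using X[of u c v] that by (auto simp: cross_def min_def split: if_splits)
  have DD: "\<not> (f [1,0,1] = 2 \<and> g [2,1,2] = 2)" "\<not> (f [1,0,1] = 2 \<and> g [2,0,2] = 2)"
    "\<not> (f [1,1,2] = 2 \<and> g [2,1,2] = 2)" "\<not> (f [1,1,2] = 2 \<and> g [2,0,2] = 2)"
    "\<not> (f [1,0,1] = 3 \<and> g [2,1,2] = 3)" "\<not> (f [1,0,1] = 3 \<and> g [2,0,2] = 3)"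
    "\<not> (f [1,1,2] = 3 \<and> g [2,1,2] = 3)" "\<not> (f [1,1,2] = 3 \<and> g [2,0,2] = 3)"
    "\<not> (f [1,0,1] = 3 \<and> g [1,2,2] = 3)" "\<not> (f [1,0,1] = 3 \<and> g [2,0,1] = 3)"
    "\<not> (f [1,0,1] = 3 \<and> g [0,2,2] = 3)" "\<not> (f [1,1,2] = 3 \<and> g [1,2,2] = 3)"
    "\<not> (f [1,1,2] = 3 \<and> g [2,0,1] = 3)" "\<not> (f [1,1,2] = 3 \<and> g [0,2,2] = 3)"
    "\<not> (f [1,2,2] = 3 \<and> g [2,1,2] = 3)" "\<not> (f [1,2,2] = 3 \<and> g [2,0,2] = 3)"
    "\<not> (f [1,0,2] = 3 \<and> g [2,1,2] = 3)" "\<not> (f [1,0,2] = 3 \<and> g [2,0,2] = 3)"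
    "\<not> (f [0,1,1] = 3 \<and> g [2,1,2] = 3)" "\<not> (f [0,1,1] = 3 \<and> g [2,0,2] = 3)"
    by (rule D; simp add: local_words_def)+
  show ?thesis unfolding side1_def side2_def cmp.simps J near2_def near3_def tag_of_iff
    using DD by (auto split: if_splits)
qed

lemma dominated_iff: "dominated w a b L \<longleftrightarrow>
    (\<exists>v a' b'. St v a' b' \<in> set L \<and> val v \<le> w \<and> side_le a a' \<and> side_le b b')"
  by (induction L) (auto split: state.splits)

lemma third_state_sound: "third_state b a1 b0 L \<Longrightarrow> St w a2 b2 \<in> set L \<Longrightarrow> val w \<le> b \<Longrightarrow> \<not> (cmp a1 b2 \<and> cmp a2 b0)"
  by (induction L) (auto split: state.splits)

lemma second_state_sound: "second_state b g2 a0 b0 L2 L \<Longrightarrow> St w a1 b1 \<in> set L \<Longrightarrow> val w \<le> b - g2 \<Longrightarrow> cmp a0 b1 \<Longrightarrow>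
    third_state (b - val w) a1 b0 L2"
  by (induction L) (auto split: state.splits simp: second_state_if_def)

lemma first_state_sound: "first_state g1 g2 L1 L2 L \<Longrightarrow> St w a0 b0 \<in> set L \<Longrightarrow> val w \<le> w14 - g1 - g2 \<Longrightarrow>
    second_state (w14 - val w) g2 a0 b0 L2 L1"
  by (induction L) (auto split: state.splits simp: first_state_if_def)

lemma low_le:
  assumes "entry_wf e" "cover0 a b w e \<or> cap e \<le> w"
  shows "low e \<le> w"
proof (cases e)
  case (En g B L)
  show ?thesis
  proof (cases "w \<le> val B")
    case True
    then obtain v a' b' where "St v a' b' \<in> set L" "val v \<le> w"
      using assms(2) En by (auto simp: dominated_iff)
    then show ?thesis using assms(1) En by (fastforce simp: list_all_iff)
  qed (use assms En in auto)
qed (use assms in auto)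

lemma join_leaf_sound:
  assumes "join_leaf e0 e1 e2" "entry_wf e0" "entry_wf e1" "entry_wf e2"
    "cover0 a0 b0 v0 e0 \<or> cap e0 \<le> v0" "cover0 a1 b1 v1 e1 \<or> cap e1 \<le> v1" "cover0 a2 b2 v2 e2 \<or> cap e2 \<le> v2"
    "v0 + v1 + v2 \<le> 14" "cmp a0 b1" "cmp a1 b2" "cmp a2 b0"
  shows False
proof -
  have low: "low e0 \<le> v0" "low e1 \<le> v1" "low e2 \<le> v2" using low_le assms by blast+
  have w14: "w14 = 14" by simp
  have cap: "\<not> cap e0 \<le> v0" "\<not> cap e1 \<le> v1" "\<not> cap e2 \<le> v2"
    using assms(1,8) low unfolding join_leaf_def w14 by linarith+
  have ex: "\<exists>w a' b'. St w a' b' \<in> set (states_of e) \<and> val w \<le> v \<and> side_le a a' \<and> side_le b b'"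
    if "cover0 a b v e \<or> cap e \<le> v" "\<not> cap e \<le> v" for a b v e
    using that by (cases e) (auto simp: dominated_iff)
  obtain w0 a0' b0' where s0: "St w0 a0' b0' \<in> set (states_of e0)" "val w0 \<le> v0" "side_le a0 a0'" "side_le b0 b0'"
    using ex[OF assms(5) cap(1)] by blast
  obtain w1 a1' b1' where s1: "St w1 a1' b1' \<in> set (states_of e1)" "val w1 \<le> v1" "side_le a1 a1'" "side_le b1 b1'"
    using ex[OF assms(6) cap(2)] by blast
  obtain w2 a2' b2' where s2: "St w2 a2' b2' \<in> set (states_of e2)" "val w2 \<le> v2" "side_le a2 a2'" "side_le b2 b2'"
    using ex[OF assms(7) cap(3)] by blast
  have "first_state (low e1) (low e2) (states_of e1) (states_of e2) (states_of e0)" using assms(1) by (simp add: join_leaf_def)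
  from first_state_sound[OF this s0(1)] have "second_state (14 - val w0) (low e2) a0' b0' (states_of e2) (states_of e1)"
    using low s0(2) assms(8) unfolding w14 by fastforce
  from second_state_sound[OF this s1(1)] have "third_state (14 - val w0 - val w1) a1' b0' (states_of e2)"
    using low s0 s1 assms(8) cmp_mono[OF assms(9) s0(3) s1(4)] by fastforce
  from third_state_sound[OF this s2(1)] show False
    using s0 s1 s2 assms(8) cmp_mono[OF assms(10) s1(3) s2(4)] cmp_mono[OF assms(11) s2(3) s0(4)] by fastforce
qed

definition idrows :: "bool list list" where "idrows = far_rows same points points"
definition falses :: "bool list" where "falses = [False,False,False,False,False,False,False,False,False,False,False,False,False,False,False,False]"

lemma idrows_nth: "i < 16 \<Longrightarrow> j < 16 \<Longrightarrow> idrows ! i ! j = same (points ! i) (points ! j)"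
  by (simp add: idrows_def far_rows_conv length_points)

lemma length_idrows: "i < 16 \<Longrightarrow> length (idrows ! i) = 16"
  by (simp add: idrows_def far_rows_conv length_points)

lemma same_pin:
  assumes "c \<noteq> d"
  shows "\<not> same (points ! pin f c) (points ! pin f d)"
proof
  assume s: "same (points ! pin f c) (points ! pin f d)"
  then have eq: "pin f c = pin f d"
    using distinct_points length_points pin_less nth_eq_iff_index_eq unfolding same_iff by metis
  show False
  proof (cases "pin f c")
    case 0
    then show False using s costs_0 by (simp add: same_iff)
  next
    case (Suc k)
    then show False using eq assms pin_Suc by metis
  qed
qed

lemma ts_pin: "4 \<le> c \<Longrightarrow> (TU # map (\<lambda>v. tag_of (f v)) local_words) ! pin f c = TU"
proof (cases "pin f c")
  case (Suc k)
  assume "4 \<le> c"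
  then show ?thesis using pin_Suc[OF Suc] Suc by (simp add: length_local tag_of_iff)
qed simp

section \<open>Contradiction from a verified table\<close>

definition flags :: "(nat list \<Rightarrow> nat) \<Rightarrow> bool list" where
  "flags f = bor falses (idrows ! pin f 7)"
definition flags2 :: "(nat list \<Rightarrow> nat) \<Rightarrow> bool list" where
  "flags2 f = bor (flags f) (idrows ! pin f 6)"

lemma flags_pin:
  "length falses = 16" "length (flags f) = 16" "length (flags2 f) = 16"
  "\<not> falses ! pin f c" "\<not> flags f ! pin f 6" "\<not> flags2 f ! pin f 5"
proof -
  show l: "length falses = 16" by (simp add: falses_def)
  have fs: "falses = replicate 16 False" by (simp add: falses_def eval_nat_numeral)
  show n: "\<not> falses ! pin f c" for c using pin_less[of f c] by (simp add: fs)
  show l1: "length (flags f) = 16" by (simp add: flags_def length_bor l length_idrows pin_less)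
  show "length (flags2 f) = 16" by (simp add: flags2_def length_bor l1 length_idrows pin_less)
  show 1: "\<not> flags f ! pin f 6"
    by (simp add: flags_def nth_bor l length_idrows pin_less n idrows_nth same_pin)
  have "\<not> flags f ! pin f 5"
    by (simp add: flags_def nth_bor l length_idrows pin_less n idrows_nth same_pin)
  then show "\<not> flags2 f ! pin f 5"
    by (simp add: flags2_def nth_bor l1 length_idrows pin_less idrows_nth same_pin)
qed

lemma dfs_local:
  assumes "local_ok f" "dfs K local_masks trues trues trues b 0 []"
    "tag_weight local_masks (map (\<lambda>v. tag_of (f v)) (rev local_words)) \<le> b"
  shows "K (map (\<lambda>v. tag_of (f v)) local_words) (tag_weight local_masks (map (\<lambda>v. tag_of (f v)) (rev local_words)))"
proof -
  let ?ts = "map (\<lambda>v. tag_of (f v)) (rev local_words)"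
  have "length trues = 15" "\<forall>i<15. trues ! i"
    unfolding trues_def by (simp_all add: eval_nat_numeral less_Suc_eq)
  then have "list_all2 (\<lambda>x s. s = c \<longrightarrow> x) trues ?ts" for c
    by (simp add: list_all2_conv_all_nth length_local)
  moreover have "ok_tags local_masks ?ts"
    unfolding masks_local using assms distinct_local
    by (intro ok_tags_masks) (auto simp: local_ok_def)
  ultimately have "K (rev ?ts @ []) (0 + tag_weight local_masks ?ts)"
    using dfs_sound[OF assms(2), of ?ts] assms(3) by simp
  then show ?thesis by (simp add: rev_map)
qed

text \<open>Collects the facts to be established by evaluation, so that the argument sees an
  abstract \<open>T\<close> and the large concrete table is never unfolded in it.\<close>

locale table =
  fixes T :: tree
  assumes covered: "dfs (leaf T) local_masks trues trues trues w12 0 []"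
    and wf: "node_wf idrows (node_wf idrows (node_wf idrows (\<lambda>_. entry_wf))) falses T"
    and cap_le: "cap T \<le> 13"
    and joined: "join_level (join_level (join_level join_leaf (far_rows (far w5) points points) (far_cols (far w5) points points))
        (far_rows (far w6) points points) (far_cols (far w6) points points))
        (far_rows (far1 w7) points points) (far_cols (far w7) points points) T T T"
begin

abbreviation "ent1 f \<equiv> child T (pin f 7)"
abbreviation "ent2 f \<equiv> child (ent1 f) (pin f 6)"
abbreviation "ent3 f \<equiv> child (ent2 f) (pin f 5)"

lemma wf1: "node_wf idrows (node_wf idrows (\<lambda>_. entry_wf)) (flags f) (ent1 f)"
  unfolding flags_def using node_wf_child(1)[OF wf, of "pin f 7"] flags_pin pin_less by simp
lemma wf2: "node_wf idrows (\<lambda>_. entry_wf) (flags2 f) (ent2 f)"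
  unfolding flags2_def using node_wf_child(1)[OF wf1, of "pin f 6"] flags_pin pin_less by simp
lemma wf3: "entry_wf (ent3 f)"
  using node_wf_child(1)[OF wf2, of "pin f 5"] flags_pin pin_less by simp

lemma ent_low: "low (ent1 f) \<le> low (ent3 f)" "low (ent2 f) \<le> low (ent3 f)"
proof -
  have "low (ent1 f) \<le> low (ent2 f)" and 2: "low (ent2 f) \<le> low (ent3 f)"
    using node_wf_child(3)[OF wf1, of "pin f 6" f] node_wf_child(3)[OF wf2, of "pin f 5" f] flags_pin pin_less
    by simp_all
  then show "low (ent1 f) \<le> low (ent3 f)" by simp
  show "low (ent2 f) \<le> low (ent3 f)" by (rule 2)
qed

lemma cover_local:
  assumes "local_ok f"
  shows "cover0 (side1 f) (side2 f) (rest_weight f) (ent3 f) \<or> cap (ent3 f) \<le> rest_weight f"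
proof (cases "rest_weight f \<le> 6")
  case False
  have "cap (ent3 f) + 2 \<le> cap (ent2 f)" "cap (ent2 f) + 2 \<le> cap (ent1 f)" "cap (ent1 f) + 2 \<le> cap T"
    using node_wf_child(2)[OF wf, of "pin f 7"] node_wf_child(2)[OF wf1, of "pin f 6" f]
      node_wf_child(2)[OF wf2, of "pin f 5" f] flags_pin pin_less by simp_all
  \<comment> \<open>From 13 at the root three levels take off at least 2 each, leaving at most 7; so
    weights from 7 on are beyond \<open>cap\<close>.\<close>
  then show ?thesis using cap_le False by linarith
next
  case True
  define w where "w = rest_weight f + costs ! pin f 7 + costs ! pin f 6 + costs ! pin f 5"
  have c2: "costs ! pin f c \<le> 2" for c using costs_le pin_less by blast
  have w: "tag_weight local_masks (map (\<lambda>v. tag_of (f v)) (rev local_words)) = w"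
    using tag_weight_local[OF assms] by (simp add: w_def)
  \<comment> \<open>The budget 12 of the search: at most 6 for the rest and at most 2 for each of
    the colours 7, 6, 5.\<close>
  have "w \<le> w12" using True c2[of 7] c2[of 6] c2[of 5] by (simp add: w_def)
  then have "leaf T (map (\<lambda>v. tag_of (f v)) local_words) w"
    using dfs_local[OF assms covered] unfolding w by blast
  then have 0: "coverN (coverN (coverN (cover0 (side1 f) (side2 f)) (TU # map (\<lambda>v. tag_of (f v)) local_words) costs)
      (TU # map (\<lambda>v. tag_of (f v)) local_words) costs) (TU # map (\<lambda>v. tag_of (f v)) local_words) costs w T"
    by (simp only: leaf_conv)
  have L: "length (TU # map (\<lambda>v. tag_of (f v)) local_words) = 16" by (simp add: length_local)
  note S = coverN_sound[where ts = "TU # map (\<lambda>v. tag_of (f v)) local_words" and cs = costs]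
  note 1 = S[OF disjI1[OF 0] wf, of "pin f 7"]
  have 1: "coverN (coverN (cover0 (side1 f) (side2 f)) (TU # map (\<lambda>v. tag_of (f v)) local_words) costs)
      (TU # map (\<lambda>v. tag_of (f v)) local_words) costs (w - costs ! pin f 7) (ent1 f) \<or> cap (ent1 f) \<le> w - costs ! pin f 7"
    by (rule 1) (simp_all only: L flags_pin pin_less ts_pin c2, simp_all)
  note 2 = S[OF 1 wf1, of "pin f 6"]
  have 2: "coverN (cover0 (side1 f) (side2 f)) (TU # map (\<lambda>v. tag_of (f v)) local_words) costs
      (w - costs ! pin f 7 - costs ! pin f 6) (ent2 f) \<or> cap (ent2 f) \<le> w - costs ! pin f 7 - costs ! pin f 6"
    by (rule 2) (simp_all only: L flags_pin pin_less ts_pin c2, simp_all)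
  note 3 = S[OF 2 wf2, of "pin f 5"]
  have 3: "cover0 (side1 f) (side2 f) (w - costs ! pin f 7 - costs ! pin f 6 - costs ! pin f 5) (ent3 f)
      \<or> cap (ent3 f) \<le> w - costs ! pin f 7 - costs ! pin f 6 - costs ! pin f 5"
    by (rule 3) (simp_all only: L flags_pin pin_less ts_pin c2, simp_all)
  have "w - costs ! pin f 7 - costs ! pin f 6 - costs ! pin f 5 = rest_weight f" by (simp add: w_def)
  then show ?thesis using 3 by simp
qed

lemma no_triple_canonical:
  assumes "local_ok f0" "local_ok f1" "local_ok f2" "cross_ok f0 f1" "cross_ok f1 f2" "cross_ok f2 f0"
    "pin f0 7 = 0 \<longrightarrow> pin f1 7 = 0" "pin f1 7 = 0 \<longrightarrow> pin f2 7 = 0"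
  shows False
proof -
  have n: "w7 = 7" "w6 = 6" "w5 = 5" by simp_all
  note J = joined[unfolded n(1), unfolded n(2), unfolded n(3)]
  have F: "far c (points ! pin f0 c) (points ! pin f1 c)" "far c (points ! pin f1 c) (points ! pin f2 c)"
    "far c (points ! pin f2 c) (points ! pin f0 c)" if "4 \<le> c" for c
    using pin_far assms that by blast+
  have P0: "points ! i = NoP \<longleftrightarrow> i = 0" if "i < 16" for i
    using that costs_0 points_Suc[of "i - 1"] by (cases i) auto
  have F1: "far1 7 (points ! pin f 7) (points ! pin g 7)"
    if "far 7 (points ! pin f 7) (points ! pin g 7)" "pin f 7 = 0 \<longrightarrow> pin g 7 = 0" for f g
    using that P0[OF pin_less, of f 7] P0[OF pin_less, of g 7] by (cases "points ! pin f 7") auto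
  have lw: "low (ent3 f0) + low (ent3 f1) + low (ent3 f2) \<le> 14"
    using low_le[OF wf3 cover_local] assms(1-3) rest_weight_sum[OF assms(1-6)]
    by (meson add_mono order_trans)
  have lw2: "low (ent2 f0) + low (ent2 f1) + low (ent2 f2) \<le> 14"
    "low (ent1 f0) + low (ent1 f1) + low (ent1 f2) \<le> 14"
    using lw ent_low by (meson add_mono order_trans)+
  note len = flags_pin(1-3)
  have 1: "join_level (join_level join_leaf (far_rows (far 5) points points) (far_cols (far 5) points points))
        (far_rows (far 6) points points) (far_cols (far 6) points points) (ent1 f0) (ent1 f1) (ent1 f2)"
    by (rule join_level_sound[OF J wf wf wf]) (simp_all add: len flags_pin length_points pin_less F F1 assms lw2)
  have 2: "join_level join_leaf (far_rows (far 5) points points) (far_cols (far 5) points points) (ent2 f0) (ent2 f1) (ent2 f2)"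
    by (rule join_level_sound[OF 1 wf1 wf1 wf1]) (simp_all add: len flags_pin length_points pin_less F lw2)
  have 3: "join_leaf (ent3 f0) (ent3 f1) (ent3 f2)"
    by (rule join_level_sound[OF 2 wf2 wf2 wf2]) (simp_all add: len flags_pin length_points pin_less F lw)
  show False
    using join_leaf_sound[OF 3 wf3 wf3 wf3 cover_local cover_local cover_local
        rest_weight_sum cmp_sides cmp_sides cmp_sides] assms by blast
qed

text \<open>In a cycle of three copies some rotation puts those containing colour 7 in front of
  those without it, as the canonical version requires.\<close>

lemma no_triple:
  assumes "local_ok f0" "local_ok f1" "local_ok f2" "cross_ok f0 f1" "cross_ok f1 f2" "cross_ok f2 f0"
  shows False
proof -
  consider "(pin f0 7 = 0 \<longrightarrow> pin f1 7 = 0) \<and> (pin f1 7 = 0 \<longrightarrow> pin f2 7 = 0)"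
    | "(pin f1 7 = 0 \<longrightarrow> pin f2 7 = 0) \<and> (pin f2 7 = 0 \<longrightarrow> pin f0 7 = 0)"
    | "(pin f2 7 = 0 \<longrightarrow> pin f0 7 = 0) \<and> (pin f0 7 = 0 \<longrightarrow> pin f1 7 = 0)"
    by blast
  then show False
    using no_triple_canonical[of f0 f1 f2] no_triple_canonical[of f1 f2 f0] no_triple_canonical[of f2 f0 f1] assms
    by cases blast+
qed

end

section \<open>Rotations, and restriction to a copy of smaller dimension\<close>

lemma corner_dist_map: "inj_on r {..<3} \<Longrightarrow> \<forall>a\<in>set u. a < 3 \<Longrightarrow> c < 3 \<Longrightarrow>
    corner_dist (r c) (map r u) = corner_dist c u"
  by (induction c u rule: corner_dist.induct) (auto simp: inj_on_eq_iff)

abbreviation rot :: "nat \<Rightarrow> nat \<Rightarrow> nat" where "rot i a \<equiv> (i + a) mod 3"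

lemma rot_perm:
  assumes "i < 3"
  shows "inj_on (rot i) {..<3}" "rot i 0 + rot i 1 + rot i 2 = 3"
proof -
  have i: "i = 0 \<or> i = 1 \<or> i = 2" using assms by linarith
  then show "rot i 0 + rot i 1 + rot i 2 = 3" by auto
  show "inj_on (rot i) {..<3}"
  proof (rule inj_onI)
    fix a b assume ab: "a \<in> {..<3::nat}" "b \<in> {..<3::nat}" "rot i a = rot i b"
    have "a = 0 \<or> a = 1 \<or> a = 2" "b = 0 \<or> b = 1 \<or> b = 2" using ab(1,2) unfolding lessThan_iff by linarith+
    then show "a = b" using ab(3) i by (elim disjE) simp_all
  qed
qed

text \<open>\<open>word_dist\<close> finds the third letter by subtraction from 3. The condition on
  the sum says that \<open>r\<close> commutes with this.\<close>

lemma word_dist_map: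
  assumes "inj_on r {..<3}" "r 0 + r 1 + r 2 = 3" "\<forall>a\<in>set u. a < 3" "\<forall>a\<in>set v. a < 3"
  shows "word_dist (map r u) (map r v) = word_dist u v"
  using assms(3,4)
proof (induction u v rule: word_dist.induct)
  case (1 a u b v)
  have ab: "a < 3" "b < 3" using 1 by auto
  show ?case
  proof (cases "a = b")
    case True
    then show ?thesis using 1 by simp
  next
    case False
    have c: "3 - a - b < 3" using False ab by linarith
    have "a = 0 \<or> a = 1 \<or> a = 2" "b = 0 \<or> b = 1 \<or> b = 2" using ab by linarith+
    then have k: "3 - r a - r b = r (3 - a - b)"
      using False assms(2) by (elim disjE) simp_all
    have "r a \<noteq> r b" using False ab assms(1) by (simp add: inj_on_eq_iff)
    then show ?thesis
      using False 1 k corner_dist_map[OF assms(1), of u] corner_dist_map[OF assms(1), of v] ab c by simp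
  qed
qed auto

lemma word_dist_append: "word_dist (z @ u) (z @ v) = word_dist u v"
  by (induction z) auto

text \<open>A common prefix leaves \<open>word_dist\<close> unchanged, so the words behind
  \<open>k\<close> zeros form an isometric copy of dimension \<open>m\<close>, and a packing
  colouring restricts to it.\<close>

lemma packing_words:
  assumes "packing_coloring (ST_verts n) (ST_edge n) c f" "n = k + m"
  defines "g \<equiv> \<lambda>x. f (cls n (replicate k 0 @ x))"
  assumes "x \<in> sier_verts (Suc m)" "y \<in> sier_verts (Suc m)"
  shows "g x \<in> {1..c}" "word_dist x y = 0 \<Longrightarrow> g x = g y"
    "g x = g y \<Longrightarrow> word_dist x y = 0 \<or> g x < word_dist x y"
proof -
  have v: "replicate k 0 @ x \<in> sier_verts (Suc n)" "replicate k 0 @ y \<in> sier_verts (Suc n)"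
    using assms by (auto simp: sier_verts_def)
  then show "g x \<in> {1..c}" using assms(1) cls_in_verts unfolding packing_coloring_def g_def by blast
  show "word_dist x y = 0 \<Longrightarrow> g x = g y"
    using word_dist_0_iff[OF v] unfolding word_dist_append g_def by simp
  show "word_dist x y = 0 \<or> g x < word_dist x y" if "g x = g y"
  proof (cases "word_dist x y = 0")
    case False
    then have "cls n (replicate k 0 @ x) \<noteq> cls n (replicate k 0 @ y)"
      using word_dist_0_iff[OF v] unfolding word_dist_append by simp
    moreover have "enat (f X) < graph_dist (ST_verts n) (ST_edge n) X Y"
      if "X \<in> ST_verts n" "Y \<in> ST_verts n" "X \<noteq> Y" "f X = f Y" for X Y
      using assms(1) that unfolding packing_coloring_def by simp
    ultimately have "enat (g x) < enat (word_dist (replicate k 0 @ x) (replicate k 0 @ y))"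
      using that cls_in_verts[OF v(1)] cls_in_verts[OF v(2)] ST_graph_dist[OF v] unfolding g_def by metis
    then show ?thesis by (simp add: word_dist_append)
  qed simp
qed

lemma local_letters: "v \<in> set local_words \<Longrightarrow> \<forall>a\<in>set v. a < 3"
  by (auto simp: local_words_def)

lemma local_dist_pos: "u \<in> set local_words \<Longrightarrow> v \<in> set local_words \<Longrightarrow> u \<noteq> v \<Longrightarrow> word_dist u v \<noteq> 0"
  by (auto simp: local_words_def)

lemma (in table) no_coloring_ST3:
  assumes col: "\<And>x. x \<in> sier_verts 4 \<Longrightarrow> g x \<in> {1..11}"
    and eq: "\<And>x y. x \<in> sier_verts 4 \<Longrightarrow> y \<in> sier_verts 4 \<Longrightarrow> word_dist x y = 0 \<Longrightarrow> g x = g y"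
    and pack: "\<And>x y. x \<in> sier_verts 4 \<Longrightarrow> y \<in> sier_verts 4 \<Longrightarrow> g x = g y \<Longrightarrow>
      word_dist x y = 0 \<or> g x < word_dist x y"
  shows False
proof -
  \<comment> \<open>Copy \<open>i\<close> is read with its letters rotated by \<open>i\<close>. In
    each copy 0 then is the outer corner, 1 the corner towards the next copy and 2 the one towards
    the previous copy.\<close>
  define f where "f i v = g (i # map (rot i) v)" for i v
  have mem: "i # map (rot i) v \<in> sier_verts 4" if "i < 3" "v \<in> set local_words" for i v
    using that length_in_local by (auto simp: sier_verts_def)
  have loc: "local_ok (f i)" if "i < 3" for i
    unfolding local_ok_def
  proof (intro ballI conjI impI)
    fix u v assume uv: "u \<in> set local_words"
    show "f i u \<in> {1..11}" using col mem that uv unfolding f_def by blast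
    assume v: "v \<in> set local_words" "u \<noteq> v" "f i u = f i v"
    have "word_dist (i # map (rot i) u) (i # map (rot i) v) = word_dist u v"
      using word_dist_map[OF rot_perm[OF that]] local_letters uv v by simp
    then show "f i u < word_dist u v"
      using pack[OF mem[OF that uv] mem[OF that v(1)]] v local_dist_pos[OF uv v(1,2)] unfolding f_def by simp
  qed
  have crs: "cross_ok (f i) (f j)" if i: "i < 3" and j: "j = (i + 1) mod 3" for i j
  proof -
    have j3: "j < 3" using j by simp
    have "i = 0 \<or> i = 1 \<or> i = 2" using i by linarith
    then have r: "rot i 1 = j" "rot j 2 = i" "rot i 2 = 3 - i - j" "rot j 1 = 3 - i - j" "i \<noteq> j"
      unfolding j by auto
    have D: "word_dist (i # map (rot i) u) (j # map (rot j) v) = cross u v"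
      if "u \<in> set local_words" "v \<in> set local_words" for u v
    proof -
      have c: "corner_dist (rot i c) (map (rot i) u) = corner_dist c u" "corner_dist (rot j c) (map (rot j) v) = corner_dist c v"
        if "c < 3" for c
        using corner_dist_map[OF rot_perm(1)[OF i]] corner_dist_map[OF rot_perm(1)[OF j3]]
          local_letters \<open>u \<in> _\<close> \<open>v \<in> _\<close> that by blast+
      have "corner_dist j (map (rot i) u) = corner_dist 1 u" "corner_dist i (map (rot j) v) = corner_dist 2 v"
        "corner_dist (3 - i - j) (map (rot i) u) = corner_dist 2 u"
        "corner_dist (3 - i - j) (map (rot j) v) = corner_dist 1 v"
        using c[of 1] c[of 2] unfolding r by simp_all
      then show ?thesis using r(5) length_in_local[OF that(1)] by (auto simp: cross_def)
    qed
    have in1: "[1,1,1] \<in> set local_words" "[2,2,2] \<in> set local_words" by (simp_all add: local_words_def)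
    show ?thesis unfolding cross_ok_def
    proof (intro conjI ballI impI)
      have "cross [1,1,1] [2,2,2] = 0" by (simp add: cross_def)
      then show "f i [1,1,1] = f j [2,2,2]"
        using eq[OF mem[OF i in1(1)] mem[OF j3 in1(2)]] D[OF in1] unfolding f_def by simp
      fix u v assume uv: "u \<in> set local_words" "v \<in> set local_words" "f i u = f j v"
      show "cross u v = 0 \<or> f i u < cross u v"
        using pack[OF mem[OF i uv(1)] mem[OF j3 uv(2)]] uv(3) D[OF uv(1,2)] unfolding f_def by simp
    qed
  qed
  show False
    by (rule no_triple[of "f 0" "f 1" "f 2"]) (simp_all add: loc crs)
qed

section \<open>Colourings given by trees\<close>

text \<open>A tree has a place for every word, while a vertex may have two words. Colour 0 is a
  placeholder: the vertex is coloured at its other word.\<close>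

datatype ctree = Tri nat nat nat | Br ctree ctree ctree
text \<open>The result for one colour in a subtree: \<open>Bad\<close> for a detected conflict,
  \<open>Non\<close> for absence, \<open>Near\<close> for distances to the corners 0, 1, 2.\<close>

datatype reply = Bad | Non | Near nat nat nat

fun ccol :: "ctree \<Rightarrow> nat list \<Rightarrow> nat" where
  "ccol (Tri a b c) w = (if hd w = 0 then a else if hd w = 1 then b else c)"
| "ccol (Br s t u) w = ccol (if hd w = 0 then s else if hd w = 1 then t else u) (tl w)"

fun umin :: "nat \<Rightarrow> nat \<Rightarrow> nat" where
  "umin 0 b = 0" | "umin (Suc a) 0 = 0" | "umin (Suc a) (Suc b) = Suc (umin a b)"

fun near_of :: "bool \<Rightarrow> nat \<Rightarrow> nat \<Rightarrow> nat \<Rightarrow> reply" where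
  "near_of True x y z = Near x y z" | "near_of False x y z = Non"

fun merge :: "reply \<Rightarrow> reply \<Rightarrow> reply" where
  "merge Non q = q" | "merge (Near x y z) Non = Near x y z"
| "merge (Near x y z) (Near x' y' z') = Near (umin x x') (umin y y') (umin z z')"
| "merge Bad q = Bad" | "merge (Near x y z) Bad = Bad"

fun shift :: "nat \<Rightarrow> nat \<Rightarrow> nat \<Rightarrow> reply \<Rightarrow> reply" where
  "shift a b c (Near x y z) = Near (a + x) (b + y) (c + z)" | "shift a b c Non = Non" | "shift a b c Bad = Bad"

fun proj :: "nat \<Rightarrow> reply \<Rightarrow> nat" where
  "proj i (Near x y z) = (if i = 0 then x else if i = 1 then y else z)" | "proj i r = 0"

text \<open>Copies \<open>i\<close> and \<open>j\<close> meet at corner \<open>j\<close> of the one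
  and corner \<open>i\<close> of the other; \<open>k\<close> is the third copy, with side
  \<open>s\<close>. On either route the contributions of the two endpoints are independent, so the
  least corner distances decide for all pairs.\<close>

definition apart :: "nat \<Rightarrow> nat \<Rightarrow> nat \<Rightarrow> nat \<Rightarrow> nat \<Rightarrow> reply \<Rightarrow> reply \<Rightarrow> bool" where
  "apart i j k c s p q \<longleftrightarrow> p = Non \<or> q = Non \<or>
     Suc c \<le> proj j p + proj i q \<and> Suc c \<le> s + (proj k p + proj k q)"

lemma apart_eqs:
  "apart i j k c s Non q = True" "apart i j k c s (Near x y z) Non = True"
  "apart i j k c s (Near x y z) (Near x' y' z') =
    (Suc c \<le> proj j (Near x y z) + proj i (Near x' y' z') \<and>
     Suc c \<le> s + (proj k (Near x y z) + proj k (Near x' y' z')))"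
  "proj 0 (Near x y z) = x" "proj w1 (Near x y z) = y" "proj w2 (Near x y z) = z"
  by (auto simp: apart_def)

fun select :: "bool \<Rightarrow> reply \<Rightarrow> reply" where "select True r = r" | "select False r = Bad"

fun glue :: "nat \<Rightarrow> nat \<Rightarrow> reply \<Rightarrow> reply \<Rightarrow> reply \<Rightarrow> reply" where
  "glue c s p q r = select (apart 0 w1 w2 c s p q \<and> apart 0 w2 w1 c s p r \<and> apart w1 w2 0 c s q r)
     (merge (shift 0 s s p) (merge (shift s 0 s q) (shift s s 0 r)))"

text \<open>A triangle is treated as three copies consisting of the empty word, at distance 0 from
  every corner. A repetition of \<open>c\<close> inside it is rejected because 0 + 0 is below
  \<open>Suc c\<close>.\<close>

fun scan :: "nat \<Rightarrow> nat list \<Rightarrow> ctree \<Rightarrow> reply" where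
  "scan c ss (Tri x y z) = glue c 1 (near_of (x = c) 0 0 0) (near_of (y = c) 0 0 0) (near_of (z = c) 0 0 0)"
| "scan c (s # ss) (Br t u v) = glue c s (scan c ss t) (scan c ss u) (scan c ss v)"
| "scan c [] (Br t u v) = Bad"

text \<open>The flags tell which corners may hold the placeholder. A corner shared by copies
  \<open>i < j\<close> must be coloured in copy \<open>i\<close> and may be 0 in copy
  \<open>j\<close>.\<close>

fun full :: "bool \<Rightarrow> bool \<Rightarrow> bool \<Rightarrow> ctree \<Rightarrow> bool" where
  "full p q r (Tri x y z) = ((p \<or> x \<noteq> 0) \<and> (q \<or> y \<noteq> 0) \<and> (r \<or> z \<noteq> 0))"
| "full p q r (Br s t u) = (full p False False s \<and> full True q False t \<and> full True True r u)"

fun bounded :: "nat \<Rightarrow> ctree \<Rightarrow> bool" where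
  "bounded b (Tri x y z) = (x \<le> b \<and> y \<le> b \<and> z \<le> b)"
| "bounded b (Br s t u) = (bounded b s \<and> bounded b t \<and> bounded b u)"

fun shape :: "nat \<Rightarrow> ctree \<Rightarrow> bool" where
  "shape 0 (Tri x y z) = True" | "shape (Suc n) (Br s t u) = (shape n s \<and> shape n t \<and> shape n u)"
| "shape _ _ = False"

fun shifts :: "nat \<Rightarrow> nat list" where
  "shifts 0 = []" | "shifts (Suc n) = 2 ^ n # shifts n"

fun good :: "reply \<Rightarrow> bool" where "good Bad = False" | "good Non = True" | "good (Near x y z) = True"
abbreviation words :: "nat \<Rightarrow> nat list set" where "words n \<equiv> sier_verts (Suc n)"

text \<open>Only lower bounds for the corner distances are recorded, since a packing condition asks
  only that distances be large.\<close>

definition covers :: "reply \<Rightarrow> nat list set \<Rightarrow> bool" where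
  "covers r W \<longleftrightarrow> (W \<noteq> {} \<longrightarrow> r \<noteq> Non) \<and> (\<forall>w\<in>W. \<forall>i<3. proj i r \<le> corner_dist i w)"

text \<open>The condition for gluing a piece to copies of itself: a junction is seen from its two
  sides as two different corners, so no distance has to be added to one towards the same
  corner.\<close>

fun sep :: "nat \<Rightarrow> reply \<Rightarrow> bool" where
  "sep c Bad = False" | "sep c Non = True"
| "sep c (Near x y z) = (Suc c \<le> x + y \<and> Suc c \<le> x + z \<and> Suc c \<le> y + z)"

section \<open>Soundness of the scan\<close>

lemma umin_min: "umin a b = min a b"
  by (induction a b rule: umin.induct) auto

lemma good_merge: "good (merge p q) \<longleftrightarrow> good p \<and> good q"
  by (cases p; cases q) auto

lemma covers_merge:
  assumes "covers p P" "covers q Q" "good p" "good q"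
  shows "covers (merge p q) (P \<union> Q)"
proof (cases "p = Non \<or> q = Non")
  case True
  then show ?thesis using assms by (cases p; cases q) (auto simp: covers_def)
next
  case False
  then obtain x y z x' y' z' where pq: "p = Near x y z" "q = Near x' y' z'"
    using assms by (cases p; cases q) auto
  have "proj i (merge p q) \<le> proj i p \<and> proj i (merge p q) \<le> proj i q" for i
    by (simp add: pq umin_min)
  then have "\<forall>w\<in>P \<union> Q. \<forall>i<3. proj i (merge p q) \<le> corner_dist i w"
    using assms(1,2) unfolding covers_def by (meson UnE order_trans)
  then show ?thesis by (simp add: covers_def pq)
qed

lemma good_select: "good (select b r) \<Longrightarrow> b \<and> good r"
  by (cases b) auto

lemma word_dist_same: "word_dist (a # u) (a # v) = word_dist u v"
  by simp

lemma good_shift: "good (shift x y z p) \<longleftrightarrow> good p"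
  by (cases p) auto

lemma covers_shift:
  assumes "covers p W" "\<And>w i. w \<in> W \<Longrightarrow> i < 3 \<Longrightarrow> corner_dist i (a # w) = proj i (Near x y z) + corner_dist i w" "good p"
  shows "covers (shift x y z p) ((#) a ` W)"
proof (cases p)
  case Non
  then show ?thesis using assms(1) by (auto simp: covers_def)
next
  case (Near x' y' z')
  have "proj i (shift x y z p) \<le> corner_dist i (a # w)" if "w \<in> W" "i < 3" for w i
  proof -
    have "proj i (shift x y z p) = proj i (Near x y z) + proj i p" by (simp add: Near)
    then show ?thesis using assms(1) assms(2)[OF that] that by (simp add: covers_def)
  qed
  then show ?thesis by (simp add: covers_def Near del: proj.simps)
qed (use assms in auto)

lemma apart_sound:
  assumes "apart i j k c s p q" "covers p P" "covers q Q" "u \<in> P" "v \<in> Q" "i < 3" "j < 3" "k < 3"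
  shows "c < corner_dist j u + corner_dist i v" "c < corner_dist k u + s + corner_dist k v"
proof -
  have "p \<noteq> Non" "q \<noteq> Non" using assms by (auto simp: covers_def)
  then have "Suc c \<le> proj j p + proj i q" "Suc c \<le> s + (proj k p + proj k q)"
    using assms(1) by (auto simp: apart_def)
  moreover have "proj j p \<le> corner_dist j u" "proj k p \<le> corner_dist k u"
    "proj i q \<le> corner_dist i v" "proj k q \<le> corner_dist k v"
    using assms by (auto simp: covers_def)
  ultimately show "c < corner_dist j u + corner_dist i v" "c < corner_dist k u + s + corner_dist k v"
    by linarith+
qed

lemma glue_good:
  assumes "good (glue c s p q r)"
  shows "apart 0 1 2 c s p q" "apart 0 2 1 c s p r" "apart 1 2 0 c s q r" "good p" "good q" "good r"
    "glue c s p q r = merge (shift 0 s s p) (merge (shift s 0 s q) (shift s s 0 r))"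
proof -
  have eq: "glue c s p q r = select (apart 0 1 2 c s p q \<and> apart 0 2 1 c s p r \<and> apart 1 2 0 c s q r)
     (merge (shift 0 s s p) (merge (shift s 0 s q) (shift s s 0 r)))" (is "_ = select ?b ?m")
    by (simp add: numeral_2_eq_2)
  have b: ?b and m: "good ?m" using assms good_select unfolding eq by blast+
  show "apart 0 1 2 c s p q" "apart 0 2 1 c s p r" "apart 1 2 0 c s q r" using b by blast+
  show "good p" "good q" "good r" using m unfolding good_merge good_shift by blast+
  have "select True r' = r'" for r' by simp
  then show "glue c s p q r = ?m" using b eq by metis
qed

lemma glue_covers:
  assumes g: "good (glue c s p q r)" and "covers p P" "covers q Q" "covers r R"
    and len: "\<And>w a i. w \<in> P \<union> Q \<union> R \<Longrightarrow> corner_dist i (a # w) = (if a = i then 0 else s) + corner_dist i w"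
  shows "covers (glue c s p q r) ((#) 0 ` P \<union> ((#) 1 ` Q \<union> (#) 2 ` R))"
  unfolding glue_good(7)[OF g]
  by (intro covers_merge covers_shift) (auto simp: assms glue_good(4-6)[OF g] len good_merge good_shift)

lemma words_Suc: "words (Suc n) = (#) 0 ` words n \<union> ((#) 1 ` words n \<union> (#) 2 ` words n)"
proof (rule set_eqI)
  fix w
  have "a < 3 \<longleftrightarrow> a = 0 \<or> a = 1 \<or> a = 2" for a :: nat by linarith
  then show "w \<in> words (Suc n) \<longleftrightarrow> w \<in> (#) 0 ` words n \<union> ((#) 1 ` words n \<union> (#) 2 ` words n)"
    by (cases w) (auto simp: sier_verts_def)
qed

lemma words_0: "words 0 = {[0], [1], [2]}"
proof (rule set_eqI)
  fix w
  have "w \<in> words 0 \<longleftrightarrow> (\<exists>a<3. w = [a])"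
    unfolding sier_verts_def by (cases w) auto
  also have "\<dots> \<longleftrightarrow> w \<in> {[0], [1], [2]}"
    unfolding numeral_3_eq_3 by (auto simp: less_Suc_eq numeral_2_eq_2)
  finally show "w \<in> words 0 \<longleftrightarrow> w \<in> {[0], [1], [2]}" .
qed

lemma scan_sound:
  assumes "shape n t" "good (scan c (shifts n) t)"
  shows "covers (scan c (shifts n) t) {w \<in> words n. ccol t w = c}"
    "\<And>u v. u \<in> words n \<Longrightarrow> v \<in> words n \<Longrightarrow> u \<noteq> v \<Longrightarrow> ccol t u = c \<Longrightarrow> ccol t v = c \<Longrightarrow> c < word_dist u v"
  using assms
proof (induction n arbitrary: t)
  case 0
  have main: "covers (scan c (shifts 0) t) {w \<in> words 0. ccol t w = c} \<and>
    (\<forall>u\<in>words 0. \<forall>v\<in>words 0. u \<noteq> v \<longrightarrow> ccol t u = c \<longrightarrow> ccol t v = c \<longrightarrow> c < word_dist u v)"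
    if sh: "shape 0 t" and g: "good (scan c (shifts 0) t)" for t
  proof -
    obtain x y z where t: "t = Tri x y z" using sh by (cases t) auto
    define P where "P b = (if b then {[]} else {} :: nat list set)" for b
    have cv: "covers (near_of b 0 0 0) (P b)" for b by (cases b) (auto simp: covers_def P_def)
    have g': "good (glue c 1 (near_of (x = c) 0 0 0) (near_of (y = c) 0 0 0) (near_of (z = c) 0 0 0))"
      using g unfolding t scan.simps .
    have len: "corner_dist i (a # w) = (if a = i then 0 else 1) + corner_dist i w"
      if "w \<in> P (x = c) \<union> P (y = c) \<union> P (z = c)" for w a i
      using that by (auto simp: P_def split: if_splits)
    have eq: "(#) 0 ` P (x = c) \<union> ((#) 1 ` P (y = c) \<union> (#) 2 ` P (z = c)) = {w \<in> words 0. ccol t w = c}"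
      unfolding words_0 t P_def by auto
    have cov: "covers (scan c (shifts 0) t) {w \<in> words 0. ccol t w = c}"
      using glue_covers[OF g' cv cv cv len] unfolding eq unfolding t scan.simps .
    note G = glue_good(1-3)[OF g']
    have "\<not> (x = c \<and> y = c)" "\<not> (x = c \<and> z = c)" "\<not> (y = c \<and> z = c)"
      using apart_sound(1)[OF G(1) cv cv, of "[]" "[]"] apart_sound(1)[OF G(2) cv cv, of "[]" "[]"]
        apart_sound(1)[OF G(3) cv cv, of "[]" "[]"] by (auto simp: P_def)
    then show ?thesis using cov unfolding words_0 t by auto
  qed
  { case 1 then show ?case using main by blast }
  { case 2 then show ?case using main by blast }
next
  case (Suc n)
  have main: "covers (scan c (shifts (Suc n)) t) {w \<in> words (Suc n). ccol t w = c} \<and>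
    (\<forall>u\<in>words (Suc n). \<forall>v\<in>words (Suc n). u \<noteq> v \<longrightarrow> ccol t u = c \<longrightarrow> ccol t v = c \<longrightarrow> c < word_dist u v)"
    if sh: "shape (Suc n) t" and g: "good (scan c (shifts (Suc n)) t)" for t
  proof -
    obtain t0 t1 t2 where t: "t = Br t0 t1 t2" "shape n t0" "shape n t1" "shape n t2"
      using sh by (cases t) auto
    define W where "W t = {w \<in> words n. ccol t w = c}" for t
    have g': "good (glue c (2 ^ n) (scan c (shifts n) t0) (scan c (shifts n) t1) (scan c (shifts n) t2))"
      using g by (simp add: t del: glue.simps)
    note G = glue_good[OF g']
    note gs = G(4-6)
    note cv = Suc.IH(1)[OF t(2) gs(1), folded W_def] Suc.IH(1)[OF t(3) gs(2), folded W_def]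
      Suc.IH(1)[OF t(4) gs(3), folded W_def]
    have len: "length w = Suc n" if "w \<in> W t" for w t using that by (simp add: W_def sier_verts_def)
    have cd: "corner_dist i (a # w) = (if a = i then 0 else 2 ^ n) + corner_dist i w"
      if "w \<in> W t0 \<union> W t1 \<union> W t2" for w a i
    proof -
      have "length w = Suc n" using that len by blast
      then show ?thesis using corner_dist_Cons[of w i a] by (cases w) simp_all
    qed
    have eq: "{w \<in> words (Suc n). ccol t w = c} = (#) 0 ` W t0 \<union> ((#) 1 ` W t1 \<union> (#) 2 ` W t2)"
      unfolding words_Suc W_def t by auto
    have cov: "covers (scan c (shifts (Suc n)) t) {w \<in> words (Suc n). ccol t w = c}"
      unfolding eq using glue_covers[OF g' cv cd] by (simp add: t del: glue.simps)
    have X: "c < word_dist (i # u) (j # v) \<and> c < word_dist (j # v) (i # u)"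
      if "u \<in> W t" "v \<in> W t'" "apart i j k c (2 ^ n) p q" "covers p (W t)" "covers q (W t')"
        "i < 3" "j < 3" "k < 3" "i \<noteq> j" "k = 3 - i - j" for t t' i j k p q u v
    proof -
      have "c < corner_dist j u + corner_dist i v" "c < corner_dist k u + 2 ^ n + corner_dist k v"
        using apart_sound[OF that(3-5,1,2,6-8)] by blast+
      moreover have "length u = Suc n" "length v = Suc n" "u \<noteq> []" using len that by fastforce+
      ultimately have "c < word_dist (i # u) (j # v)" using that(9,10) by auto
      then show ?thesis using word_dist_sym[of "i # u" "j # v"] len that(1,2) by simp
    qed
    have S: "c < word_dist u v" if "u \<in> W t0 \<and> v \<in> W t0 \<or> u \<in> W t1 \<and> v \<in> W t1 \<or> u \<in> W t2 \<and> v \<in> W t2" "u \<noteq> v" for u v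
      using that Suc.IH(2)[OF _ _ _ _ _ t(2) gs(1), of u v] Suc.IH(2)[OF _ _ _ _ _ t(3) gs(2), of u v]
        Suc.IH(2)[OF _ _ _ _ _ t(4) gs(3), of u v] unfolding W_def by blast
    have X01: "c < word_dist (0 # u) (1 # v) \<and> c < word_dist (1 # v) (0 # u)" if "u \<in> W t0" "v \<in> W t1" for u v
      by (rule X[OF that G(1) cv(1,2)]) simp_all
    have X02: "c < word_dist (0 # u) (2 # v) \<and> c < word_dist (2 # v) (0 # u)" if "u \<in> W t0" "v \<in> W t2" for u v
      by (rule X[OF that G(2) cv(1,3)]) simp_all
    have X12: "c < word_dist (1 # u) (2 # v) \<and> c < word_dist (2 # v) (1 # u)" if "u \<in> W t1" "v \<in> W t2" for u v
      by (rule X[OF that G(3) cv(2,3)]) simp_all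
    have el: "(\<exists>u'\<in>W t0. u = 0 # u') \<or> (\<exists>u'\<in>W t1. u = 1 # u') \<or> (\<exists>u'\<in>W t2. u = 2 # u')"
      if "u \<in> words (Suc n)" "ccol t u = c" for u
      using that eq by blast
    have "c < word_dist u v" if h: "u \<in> words (Suc n)" "v \<in> words (Suc n)" "u \<noteq> v" "ccol t u = c" "ccol t v = c" for u v
      using el[OF h(1,4)] el[OF h(2,5)] \<open>u \<noteq> v\<close>
      by (elim disjE bexE) (metis S X01 X02 X12 word_dist_same)+
    then show ?thesis using cov by blast
  qed
  { case 1 then show ?case using main by blast }
  { case 2 then show ?case using main by blast }
qed

section \<open>Placeholders, and the passage from words to classes\<close>

declare sier_edge.simps(2)[simp del] inner_edge.simps(2)[simp del]

lemma bounded_ccol: "bounded b t \<Longrightarrow> ccol t w \<le> b"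
  by (induction t arbitrary: w) auto

lemma no_inner_corner: "\<not> inner_edge n (replicate n j) v"
  by (induction n arbitrary: v) (auto simp: replicate_eq_replicate inner_edge.simps(2))

definition allowed :: "bool \<Rightarrow> bool \<Rightarrow> bool \<Rightarrow> nat \<Rightarrow> bool" where
  "allowed p q r i = (if i = 0 then p else if i = 1 then q else r)"

text \<open>A placeholder is either at a permitted corner of the whole tree or has a coloured
  partner. The latter lies in the same child by induction, or across the junction with an earlier
  child.\<close>

lemma full_sound:
  assumes "shape n t" "full p q r t" "w \<in> words n" "ccol t w = 0"
  shows "(\<exists>i<3. allowed p q r i \<and> w = replicate (Suc n) i) \<or> (\<exists>w'. inner_edge (Suc n) w w' \<and> ccol t w' \<noteq> 0)"
  using assms
proof (induction n arbitrary: t p q r w)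
  case 0
  then obtain x y z where t: "t = Tri x y z" by (cases t) auto
  have "w = [0] \<or> w = [1] \<or> w = [2]" using 0 words_0 by auto
  then show ?case
  proof (elim disjE)
    assume "w = [0]" then show ?thesis using 0 t by (intro disjI1 exI[of _ 0]) (auto simp: allowed_def)
  next
    assume "w = [1]" then show ?thesis using 0 t by (intro disjI1 exI[of _ 1]) (auto simp: allowed_def)
  next
    assume "w = [2]" then show ?thesis using 0 t by (intro disjI1 exI[of _ 2]) (auto simp: allowed_def)
  qed
next
  case (Suc n)
  obtain t0 t1 t2 where t: "t = Br t0 t1 t2" using Suc.prems by (cases t) auto
  define ch where "ch j = (if j = 0 then t0 else if j = (1::nat) then t1 else t2)" for j
  \<comment> \<open>Corner \<open>i\<close> of child \<open>j\<close> may be 0 if an earlier child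
    \<open>i\<close> shares it, or if it is a permitted corner of the whole tree.\<close>
  define al where "al j i \<longleftrightarrow> i < j \<or> i = j \<and> allowed p q r j" for i j :: nat
  have col: "ccol t (j # u) = ccol (ch j) u" for j u by (simp add: t ch_def)
  have sh: "shape n (ch j)" for j using Suc.prems by (simp add: t ch_def)
  have fl: "full (al j 0) (al j 1) (al j 2) (ch j)" if "j < 3" for j
  proof -
    have "j = 0 \<or> j = 1 \<or> j = 2" using that by linarith
    then show ?thesis using Suc.prems by (auto simp: t ch_def al_def allowed_def)
  qed
  have IH: "(\<exists>i<3. al j i \<and> u = replicate (Suc n) i) \<or> (\<exists>u'. inner_edge (Suc n) u u' \<and> ccol (ch j) u' \<noteq> 0)"
    if "j < 3" "u \<in> words n" "ccol (ch j) u = 0" for j u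
  proof -
    have "allowed (al j 0) (al j 1) (al j 2) i = al j i" if "i < 3" for i
    proof -
      have "i = 0 \<or> i = 1 \<or> i = 2" using that by linarith
      then show ?thesis by (auto simp: allowed_def)
    qed
    then show ?thesis using Suc.IH[OF sh fl[OF that(1)] that(2,3)] by blast
  qed
  obtain j u where w: "w = j # u" "j < 3" "u \<in> words n"
    using Suc.prems(3) by (cases w) (auto simp: sier_verts_def)
  then consider (corner) i where "i < 3" "al j i" "u = replicate (Suc n) i"
    | (edge) u' where "inner_edge (Suc n) u u'" "ccol (ch j) u' \<noteq> 0"
    using IH[of j u] Suc.prems(4) col by auto
  then show ?case
  proof cases
    case edge
    have "inner_edge (Suc (Suc n)) w (j # u')"
      unfolding inner_edge.simps(2)[of "Suc n"] using edge w by blast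
    then show ?thesis using edge col by auto
  next
    case corner
    show ?thesis
    proof (cases "i = j")
      case True
      then show ?thesis using corner w by (intro disjI1 exI[of _ j]) (auto simp: al_def)
    next
      case False
      then have ij: "i < j" using corner by (simp add: al_def)
      have e: "inner_edge (Suc (Suc n)) w (i # replicate (Suc n) j)"
        unfolding inner_edge.simps(2)[of "Suc n"] using corner w ij by blast
      have "replicate (Suc n) j \<in> words n" using w by (auto simp: sier_verts_def)
      \<comment> \<open>The partner is corner \<open>j\<close> of child \<open>i\<close>, where
        \<open>i < j\<close> forbids a placeholder; and a corner has no non-clique edge inside its
        child to fall back on.\<close>
      then have "ccol (ch i) (replicate (Suc n) j) \<noteq> 0"
        using IH[of i "replicate (Suc n) j"] corner(1) no_inner_corner[of "Suc n" j] ij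
        by (auto simp: al_def simp del: inner_edge.simps)
      then show ?thesis using e col by auto
    qed
  qed
qed

text \<open>Every class contains a word with a nonzero value, and a chosen such word gives the class
  its colour. Distances of classes can be read off from any representatives.\<close>

lemma packing_from_words:
  assumes bd: "\<And>w. w \<in> words n \<Longrightarrow> G w \<le> K"
    and zero: "\<And>w. w \<in> words n \<Longrightarrow> G w = 0 \<Longrightarrow> \<exists>w'. inner_edge (Suc n) w w' \<and> G w' \<noteq> 0"
    and dist: "\<And>u v. u \<in> words n \<Longrightarrow> v \<in> words n \<Longrightarrow> G u = G v \<Longrightarrow> G u \<noteq> 0 \<Longrightarrow>
      word_dist u v = 0 \<or> G u < word_dist u v"
  shows "\<exists>f. packing_coloring (ST_verts n) (ST_edge n) K f"
proof -
  define rep where "rep X = (SOME w. w \<in> X \<and> G w \<noteq> 0)" for X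
  have rep: "rep X \<in> X" "G (rep X) \<noteq> 0" "X = cls n (rep X)" "rep X \<in> words n" if X: "X \<in> ST_verts n" for X
  proof -
    obtain u where u: "u \<in> X" using ST_verts_nonempty[OF X] by blast
    have "\<exists>w. w \<in> X \<and> G w \<noteq> 0"
    proof (cases "G u = 0")
      case True
      then obtain w' where w': "inner_edge (Suc n) u w'" "G w' \<noteq> 0" using zero ST_verts_cls[OF X u] by blast
      then have "(u, w') \<in> contr_rel n" unfolding contr_rel_alt by blast
      then show ?thesis using w' ST_verts_cls[OF X u] by blast
    qed (use u in blast)
    from someI_ex[OF this] show 1: "rep X \<in> X" "G (rep X) \<noteq> 0" unfolding rep_def by blast+
    show "X = cls n (rep X)" "rep X \<in> words n" using ST_verts_cls[OF X 1(1)] by blast+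
  qed
  have "packing_coloring (ST_verts n) (ST_edge n) K (\<lambda>X. G (rep X))"
    unfolding packing_coloring_def
  proof (intro conjI ballI impI)
    fix X assume X: "X \<in> ST_verts n"
    show "G (rep X) \<in> {1..K}" using rep(2,4)[OF X] bd[of "rep X"] by auto
    fix Y assume Y: "Y \<in> ST_verts n" "X \<noteq> Y \<and> G (rep X) = G (rep Y)"
    have "word_dist (rep X) (rep Y) \<noteq> 0"
      using word_dist_0_iff[OF rep(4)[OF X] rep(4)[OF Y(1)]] rep(3)[OF X] rep(3)[OF Y(1)] Y(2) by metis
    then have "G (rep X) < word_dist (rep X) (rep Y)"
      using dist[OF rep(4)[OF X] rep(4)[OF Y(1)]] Y(2) rep(2)[OF X] by simp
    then show "enat (G (rep X)) < graph_dist (ST_verts n) (ST_edge n) X Y"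
      using ST_graph_dist[OF rep(4)[OF X] rep(4)[OF Y(1)]] rep(3)[OF X] rep(3)[OF Y(1)] by (metis enat_ord_simps(2))
  qed
  then show ?thesis by blast
qed

primrec good_upto :: "nat \<Rightarrow> nat list \<Rightarrow> ctree \<Rightarrow> bool" where
  "good_upto 0 ss t = True"
| "good_upto (Suc c) ss t = (good (scan (Suc c) ss t) \<and> good_upto c ss t)"

primrec sep_upto :: "nat \<Rightarrow> nat list \<Rightarrow> ctree \<Rightarrow> bool" where
  "sep_upto 0 ss t = True"
| "sep_upto (Suc c) ss t = (sep (Suc c) (scan (Suc c) ss t) \<and> sep_upto c ss t)"

lemma good_uptoD: "good_upto K ss t \<Longrightarrow> 0 < c \<Longrightarrow> c \<le> K \<Longrightarrow> good (scan c ss t)"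
  by (induction K) (auto simp: le_Suc_eq)

lemma sep_uptoD: "sep_upto K ss t \<Longrightarrow> 0 < c \<Longrightarrow> c \<le> K \<Longrightarrow> sep c (scan c ss t)"
  by (induction K) (auto simp: le_Suc_eq)

lemma tree_packing:
  assumes "shape n t" "full False False False t" "bounded K t" "good_upto K (shifts n) t"
  shows "\<exists>f. packing_coloring (ST_verts n) (ST_edge n) K f"
proof (rule packing_from_words[where G = "ccol t"])
  fix w assume w: "w \<in> words n"
  show "ccol t w \<le> K" using bounded_ccol assms(3) by blast
  show "\<exists>w'. inner_edge (Suc n) w w' \<and> ccol t w' \<noteq> 0" if "ccol t w = 0"
    using full_sound[OF assms(1,2) w that] unfolding allowed_def by (metis (full_types))
  fix v assume v: "v \<in> words n" "ccol t w = ccol t v" "ccol t w \<noteq> 0"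
  then have "good (scan (ccol t w) (shifts n) t)"
    using good_uptoD[OF assms(4)] bounded_ccol[OF assms(3)] by simp
  then show "word_dist w v = 0 \<or> ccol t w < word_dist w v"
    using scan_sound(2)[OF assms(1) _ w v(1)] v word_dist_refl by metis
qed

section \<open>A periodic colouring with 20 colours\<close>

locale periodic_piece =
  fixes B :: ctree
  assumes shape: "shape 5 B" and filled: "full True True True B" and bnd: "bounded 19 B"
    and separated: "sep_upto 19 (shifts 5) B"
begin

text \<open>The last six letters are the position inside a piece of dimension 5. They are constant
  exactly at the corners of pieces, which \<open>B\<close> may leave open and which receive colour
  20.\<close>

definition per :: "nat list \<Rightarrow> nat" where
  "per w = (let u = drop (length w - 6) w in if u = replicate 6 (hd u) then 20 else ccol B u)"

lemma per_Cons: "6 \<le> length w \<Longrightarrow> per (a # w) = per w"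
proof -
  assume "6 \<le> length w"
  then have "length (a # w) - 6 = Suc (length w - 6)" by simp
  then show ?thesis unfolding per_def by (simp only: drop_Suc_Cons)
qed

lemma per_6: "length w = 6 \<Longrightarrow> per w = (if w = replicate 6 (hd w) then 20 else ccol B w)"
  by (simp add: per_def)

lemma per_le: "per w \<le> 20"
  using bounded_ccol[OF bnd] by (fastforce simp: per_def Let_def intro: order_trans)

lemma sep_good: "sep c r \<Longrightarrow> good r" by (cases r) auto

lemma per_zero:
  assumes "5 \<le> n" "w \<in> words n" "per w = 0"
  shows "\<exists>w'. inner_edge (Suc n) w w' \<and> per w' \<noteq> 0"
  using assms
proof (induction n arbitrary: w rule: dec_induct)
  case base
  have w: "length w = 6" using base by (simp add: sier_verts_def)
  then have nc: "w \<noteq> replicate 6 (hd w)" "ccol B w = 0" using base per_6 by (auto split: if_splits)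
  then have "w \<noteq> replicate (Suc 5) i" for i by auto
  then obtain w' where w': "inner_edge (Suc 5) w w'" "ccol B w' \<noteq> 0"
    using full_sound[OF shape filled base(1) nc(2)] by blast
  then have "length w' = 6" using sier_edge_length[OF inner_edge_sier[OF w'(1)]] by simp
  then show ?case using w' per_6[of w'] by (intro exI[of _ w']) auto
next
  case (step n)
  obtain a u where w: "w = a # u" "a < 3" "u \<in> words n" using step.prems(1) by (cases w) (auto simp: sier_verts_def)
  have l: "6 \<le> length u" using w step.hyps by (simp add: sier_verts_def)
  then obtain u' where u': "inner_edge (Suc n) u u'" "per u' \<noteq> 0" using step.IH[of u] w step.prems per_Cons by auto
  have "length u' = length u" using sier_edge_length[OF inner_edge_sier[OF u'(1)]] w by (simp add: sier_verts_def)
  then have "per (a # u') \<noteq> 0" using per_Cons u' l by simp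
  moreover have "inner_edge (Suc (Suc n)) w (a # u')"
    unfolding inner_edge.simps(2)[of "Suc n"] using w u' by blast
  ultimately show ?case by blast
qed

text \<open>The second conjunct strengthens the induction: gluing two copies adds the distances to
  two different corners. The sum 0 occurs when both words name the junction itself.\<close>

lemma per_dist:
  assumes "5 \<le> n" "u \<in> words n" "v \<in> words n" "per u = per v" "per u \<noteq> 0"
  shows "(word_dist u v = 0 \<or> per u < word_dist u v) \<and>
    (\<forall>i<3. \<forall>j<3. i \<noteq> j \<longrightarrow> corner_dist i u + corner_dist j v = 0 \<or> per u < corner_dist i u + corner_dist j v)"
  using assms
proof (induction n arbitrary: u v rule: dec_induct)
  case base
  have len: "length u = 6" "length v = 6" using base by (simp_all add: sier_verts_def)
  have le19: "ccol B w \<le> 19" for w using bounded_ccol[OF bnd] .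
  have cd: "corner_dist i (replicate 6 a) = (if i = a then 0 else 32)" for i a
    using corner_dist_replicate[of i 5 a] by simp
  show ?case
  proof (cases "u = replicate 6 (hd u)")
    case True
    then have "per v = 20" using base per_6 len by simp
    then have v: "v = replicate 6 (hd v)" using per_6[OF len(2)] le19[of v] by (auto split: if_splits)
    have p: "per u = 20" using True per_6 len by simp
    have 1: "corner_dist i u = (if i = hd u then 0 else 32)" for i by (subst True) (rule cd)
    have 2: "corner_dist i v = (if i = hd v then 0 else 32)" for i by (subst v) (rule cd)
    have "word_dist u v = corner_dist (hd v) u"
      using word_dist_corner[of u 5 "hd v"] len v by simp
    then show ?thesis using p 1 2 by simp
  next
    case False
    then have pu: "per u = ccol B u" using per_6 len by simp
    have pv: "per v = ccol B v" using per_6[OF len(2)] base(3) pu le19[of u] by (auto split: if_splits)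
    define c where "c = per u"
    have c: "ccol B u = c" "ccol B v = c" "0 < c" "c \<le> 19" using pu pv base le19[of u] by (auto simp: c_def)
    have s: "sep c (scan c (shifts 5) B)" using sep_uptoD[OF separated] c by blast
    note g = sep_good[OF s]
    have cov: "covers (scan c (shifts 5) B) {w \<in> words 5. ccol B w = c}" using scan_sound(1)[OF shape g] .
    have "c < corner_dist i u + corner_dist j v" if "i < 3" "j < 3" "i \<noteq> j" for i j
    proof -
      have m: "scan c (shifts 5) B \<noteq> Non" "proj i (scan c (shifts 5) B) \<le> corner_dist i u"
        "proj j (scan c (shifts 5) B) \<le> corner_dist j v"
        using cov base(1,2) c that unfolding covers_def by blast+
      have "i = 0 \<or> i = 1 \<or> i = 2" "j = 0 \<or> j = 1 \<or> j = 2" using that by linarith+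
      then have "Suc c \<le> proj i (scan c (shifts 5) B) + proj j (scan c (shifts 5) B)"
        using s m(1) that(3) by (cases "scan c (shifts 5) B") auto
      then show ?thesis using m by linarith
    qed
    moreover have "word_dist u v = 0 \<or> c < word_dist u v"
      using scan_sound(2)[OF shape g base(1,2)] c word_dist_refl by metis
    ultimately show ?thesis unfolding c_def by blast
  qed
next
  case (step n)
  obtain a u' where u: "u = a # u'" "a < 3" "u' \<in> words n" using step.prems(1) by (cases u) (auto simp: sier_verts_def)
  obtain b v' where v: "v = b # v'" "b < 3" "v' \<in> words n" using step.prems(2) by (cases v) (auto simp: sier_verts_def)
  have l: "length u' = Suc n" "length v' = Suc n" using u v by (simp_all add: sier_verts_def)
  have p: "per u = per u'" "per v = per v'" using per_Cons u v l step.hyps by simp_all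
  have IH: "word_dist u' v' = 0 \<or> per u < word_dist u' v'"
    "\<And>i j. i < 3 \<Longrightarrow> j < 3 \<Longrightarrow> i \<noteq> j \<Longrightarrow> corner_dist i u' + corner_dist j v' = 0 \<or> per u < corner_dist i u' + corner_dist j v'"
    using step.IH[OF u(3) v(3)] step.prems p by auto
  have "(2::nat) ^ 5 \<le> 2 ^ n" using step.hyps by (intro power_increasing) auto
  then have big: "per u < 2 ^ n" using per_le[of u] by simp
  have cu: "corner_dist i u = (if a = i then 0 else 2 ^ n) + corner_dist i u'" for i
    using corner_dist_Cons[of u' i a] l u by force
  have cv: "corner_dist i v = (if b = i then 0 else 2 ^ n) + corner_dist i v'" for i
    using corner_dist_Cons[of v' i b] l v by force
  have "word_dist u v = 0 \<or> per u < word_dist u v"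
  proof (cases "a = b")
    case True
    then show ?thesis using IH(1) u v by simp
  next
    case False
    have "word_dist u v = min (corner_dist b u' + corner_dist a v')
        (corner_dist (3 - a - b) u' + 2 ^ n + corner_dist (3 - a - b) v')"
      using False u v l by auto
    then show ?thesis using IH(2)[of b a] u v False big by (auto simp: min_def)
  qed
  moreover have "corner_dist i u + corner_dist j v = 0 \<or> per u < corner_dist i u + corner_dist j v"
    if "i < 3" "j < 3" "i \<noteq> j" for i j
    using IH(2)[OF that] big cu[of i] cv[of j] by (auto split: if_splits)
  ultimately show ?case by blast
qed

lemma periodic_packing: "5 \<le> n \<Longrightarrow> \<exists>f. packing_coloring (ST_verts n) (ST_edge n) 20 f"
  by (rule packing_from_words[where G = per]) (use per_le per_zero per_dist in blast)+

end

section \<open>The table, the colourings and their verification\<close>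

abbreviation (input) pa :: side where "pa \<equiv> Side T1 N1 N1"
abbreviation (input) pb :: side where "pb \<equiv> Side T1 N1 N2"
abbreviation (input) pc :: side where "pc \<equiv> Side T1 N1 NF"
abbreviation (input) pd :: side where "pd \<equiv> Side T1 NF N1"
abbreviation (input) pe :: side where "pe \<equiv> Side T1 NF N2"
abbreviation (input) pf :: side where "pf \<equiv> Side T1 NF NF"
abbreviation (input) pg :: side where "pg \<equiv> Side T2 NF N1"
abbreviation (input) ph :: side where "ph \<equiv> Side T2 NF N2"
abbreviation (input) pi :: side where "pi \<equiv> Side T2 NF NF"
abbreviation (input) pj :: side where "pj \<equiv> Side T3 N1 NF"
abbreviation (input) pk :: side where "pk \<equiv> Side T3 NF NF"
abbreviation (input) pl :: side where "pl \<equiv> Side TU N1 N1"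
abbreviation (input) pm :: side where "pm \<equiv> Side TU N1 N2"
abbreviation (input) pn :: side where "pn \<equiv> Side TU N1 NF"
abbreviation (input) po :: side where "po \<equiv> Side TU NF N1"
abbreviation (input) pp :: side where "pp \<equiv> Side TU NF N2"
abbreviation (input) pq :: side where "pq \<equiv> Side TU NF NF"
abbreviation (input) v3 :: tree where "v3 \<equiv> Wd W3"
abbreviation (input) v4 :: tree where "v4 \<equiv> Wd W4"
abbreviation (input) v5 :: tree where "v5 \<equiv> Wd W5"
abbreviation (input) v6 :: tree where "v6 \<equiv> Wd W6"
abbreviation (input) v7 :: tree where "v7 \<equiv> Wd W7"
type_synonym rows = "unit \<Rightarrow> tree list"
abbreviation (input) "a0 \<equiv> St W3 pa pq"
abbreviation (input) "a1 \<equiv> St W3 pc po"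
abbreviation (input) "a2 \<equiv> St W3 pg po"
abbreviation (input) "a3 \<equiv> St W3 po pc"
abbreviation (input) "a4 \<equiv> St W3 po pg"
abbreviation (input) "a5 \<equiv> St W3 pq pa"
abbreviation (input) "a6 \<equiv> St W4 pa pc"
abbreviation (input) "a7 \<equiv> St W4 pa pd"
abbreviation (input) "a8 \<equiv> St W4 pa pf"
abbreviation (input) "a9 \<equiv> St W4 pa pg"
abbreviation (input) "a10 \<equiv> St W4 pa pj"
abbreviation (input) "a11 \<equiv> St W4 pa pq"
abbreviation (input) "a12 \<equiv> St W4 pb pb"
abbreviation (input) "a13 \<equiv> St W4 pb pc"
abbreviation (input) "a14 \<equiv> St W4 pb ph"
abbreviation (input) "a15 \<equiv> St W4 pb pj"
abbreviation (input) "a16 \<equiv> St W4 pb pk"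
abbreviation (input) "a17 \<equiv> St W4 pc pa"
abbreviation (input) "a18 \<equiv> St W4 pc pb"
abbreviation (input) "a19 \<equiv> St W4 pc pc"
abbreviation (input) "a20 \<equiv> St W4 pc pd"
abbreviation (input) "a21 \<equiv> St W4 pc pg"
abbreviation (input) "a22 \<equiv> St W4 pc pj"
abbreviation (input) "a23 \<equiv> St W4 pc po"
abbreviation (input) "a24 \<equiv> St W4 pd pa"
abbreviation (input) "a25 \<equiv> St W4 pd pc"
abbreviation (input) "a26 \<equiv> St W4 pd pd"
abbreviation (input) "a27 \<equiv> St W4 pd pf"
abbreviation (input) "a28 \<equiv> St W4 pd pg"
abbreviation (input) "a29 \<equiv> St W4 pf pa"
abbreviation (input) "a30 \<equiv> St W4 pf pd"
abbreviation (input) "a31 \<equiv> St W4 pf pg"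
abbreviation (input) "a32 \<equiv> St W4 pg pa"
abbreviation (input) "a33 \<equiv> St W4 pg pc"
abbreviation (input) "a34 \<equiv> St W4 pg pd"
abbreviation (input) "a35 \<equiv> St W4 pg pf"
abbreviation (input) "a36 \<equiv> St W4 pg pg"
abbreviation (input) "a37 \<equiv> St W4 pg pk"
abbreviation (input) "a38 \<equiv> St W4 pg po"
abbreviation (input) "a39 \<equiv> St W4 pg pq"
abbreviation (input) "a40 \<equiv> St W4 ph pb"
abbreviation (input) "a41 \<equiv> St W4 pj pa"
abbreviation (input) "a42 \<equiv> St W4 pj pb"
abbreviation (input) "a43 \<equiv> St W4 pj pc"
abbreviation (input) "a44 \<equiv> St W4 pk pb"
abbreviation (input) "a45 \<equiv> St W4 pk pg"
abbreviation (input) "a46 \<equiv> St W4 po pc"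
abbreviation (input) "a47 \<equiv> St W4 po pg"
abbreviation (input) "a48 \<equiv> St W4 po po"
abbreviation (input) "a49 \<equiv> St W4 po pq"
abbreviation (input) "a50 \<equiv> St W4 pq pa"
abbreviation (input) "a51 \<equiv> St W4 pq pg"
abbreviation (input) "a52 \<equiv> St W4 pq po"
abbreviation (input) "a53 \<equiv> St W5 pa pn"
abbreviation (input) "a54 \<equiv> St W5 pa pq"
abbreviation (input) "a55 \<equiv> St W5 pc pm"
abbreviation (input) "a56 \<equiv> St W5 pc po"
abbreviation (input) "a57 \<equiv> St W5 pd po"
abbreviation (input) "a58 \<equiv> St W5 pd pq"
abbreviation (input) "a59 \<equiv> St W5 pf po"
abbreviation (input) "a60 \<equiv> St W5 pg pl"
abbreviation (input) "a61 \<equiv> St W5 pg pn"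
abbreviation (input) "a62 \<equiv> St W5 pg po"
abbreviation (input) "a63 \<equiv> St W5 pg pq"
abbreviation (input) "a64 \<equiv> St W5 pj po"
abbreviation (input) "a65 \<equiv> St W5 pl pg"
abbreviation (input) "a66 \<equiv> St W5 pm pc"
abbreviation (input) "a67 \<equiv> St W5 pn pa"
abbreviation (input) "a68 \<equiv> St W5 pn pg"
abbreviation (input) "a69 \<equiv> St W5 po pc"
abbreviation (input) "a70 \<equiv> St W5 po pd"
abbreviation (input) "a71 \<equiv> St W5 po pf"
abbreviation (input) "a72 \<equiv> St W5 po pg"
abbreviation (input) "a73 \<equiv> St W5 po pj"
abbreviation (input) "a74 \<equiv> St W5 po po"
abbreviation (input) "a75 \<equiv> St W5 po pq"
abbreviation (input) "a76 \<equiv> St W5 pq pa"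
abbreviation (input) "a77 \<equiv> St W5 pq pd"
abbreviation (input) "a78 \<equiv> St W5 pq pg"
abbreviation (input) "a79 \<equiv> St W5 pq po"
abbreviation (input) "a80 \<equiv> St W6 pa pc"
abbreviation (input) "a81 \<equiv> St W6 pa pd"
abbreviation (input) "a82 \<equiv> St W6 pa pf"
abbreviation (input) "a83 \<equiv> St W6 pa pg"
abbreviation (input) "a84 \<equiv> St W6 pa pi"
abbreviation (input) "a85 \<equiv> St W6 pa pj"
abbreviation (input) "a86 \<equiv> St W6 pb pb"
abbreviation (input) "a87 \<equiv> St W6 pb pc"
abbreviation (input) "a88 \<equiv> St W6 pb ph"
abbreviation (input) "a89 \<equiv> St W6 pb pj"
abbreviation (input) "a90 \<equiv> St W6 pb pk"
abbreviation (input) "a91 \<equiv> St W6 pc pa"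
abbreviation (input) "a92 \<equiv> St W6 pc pb"
abbreviation (input) "a93 \<equiv> St W6 pc pc"
abbreviation (input) "a94 \<equiv> St W6 pc pd"
abbreviation (input) "a95 \<equiv> St W6 pc pg"
abbreviation (input) "a96 \<equiv> St W6 pc pj"
abbreviation (input) "a97 \<equiv> St W6 pc pk"
abbreviation (input) "a98 \<equiv> St W6 pc po"
abbreviation (input) "a99 \<equiv> St W6 pd pa"
abbreviation (input) "a100 \<equiv> St W6 pd pc"
abbreviation (input) "a101 \<equiv> St W6 pd pd"
abbreviation (input) "a102 \<equiv> St W6 pd pf"
abbreviation (input) "a103 \<equiv> St W6 pd pg"
abbreviation (input) "a104 \<equiv> St W6 pf pa"
abbreviation (input) "a105 \<equiv> St W6 pf pd"
abbreviation (input) "a106 \<equiv> St W6 pf pg"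
abbreviation (input) "a107 \<equiv> St W6 pg pa"
abbreviation (input) "a108 \<equiv> St W6 pg pc"
abbreviation (input) "a109 \<equiv> St W6 pg pd"
abbreviation (input) "a110 \<equiv> St W6 pg pf"
abbreviation (input) "a111 \<equiv> St W6 pg pg"
abbreviation (input) "a112 \<equiv> St W6 pg pk"
abbreviation (input) "a113 \<equiv> St W6 pg po"
abbreviation (input) "a114 \<equiv> St W6 pg pq"
abbreviation (input) "a115 \<equiv> St W6 ph pb"
abbreviation (input) "a116 \<equiv> St W6 ph pj"
abbreviation (input) "a117 \<equiv> St W6 ph pk"
abbreviation (input) "a118 \<equiv> St W6 pi pa"
abbreviation (input) "a119 \<equiv> St W6 pj pa"
abbreviation (input) "a120 \<equiv> St W6 pj pb"
abbreviation (input) "a121 \<equiv> St W6 pj pc"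
abbreviation (input) "a122 \<equiv> St W6 pj ph"
abbreviation (input) "a123 \<equiv> St W6 pk pb"
abbreviation (input) "a124 \<equiv> St W6 pk pc"
abbreviation (input) "a125 \<equiv> St W6 pk pg"
abbreviation (input) "a126 \<equiv> St W6 pk ph"
abbreviation (input) "a127 \<equiv> St W6 pl pq"
abbreviation (input) "a128 \<equiv> St W6 pn po"
abbreviation (input) "a129 \<equiv> St W6 po pc"
abbreviation (input) "a130 \<equiv> St W6 po pg"
abbreviation (input) "a131 \<equiv> St W6 po pn"
abbreviation (input) "a132 \<equiv> St W6 po po"
abbreviation (input) "a133 \<equiv> St W6 po pq"
abbreviation (input) "a134 \<equiv> St W6 pq pg"
abbreviation (input) "a135 \<equiv> St W6 pq pl"
abbreviation (input) "a136 \<equiv> St W6 pq po"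
text \<open>In \<open>tabI_J\<close> colour 7 has index I and colour 6 index J; the list runs over
  the index of colour 5. The order of the levels is that of the three uses of \<open>coverN\<close>
  in \<open>leaf\<close>.\<close>

definition tab0_0 :: rows where "tab0_0 _ = [v7, v7, v7, v7, v7, v7, v7, v7, v7, v7, v7, v7, v7,
  v7, v7, v7]"
definition tab0_1 :: rows where "tab0_1 _ = [v7, X, v7, v6, v7, v7, v7, En W6 W6 [a83,a107], En W6
  W6 [a95,a108], En W6 W6 [a95,a108], v6, En W6 W6 [a95,a107], En W6 W6 [a83,a108], En W6 W6
  [a107], En W6 W6 [a83,a107], En W6 W6 [a83]]"
definition tab0_2 :: rows where "tab0_2 _ = [v7, v7, X, v6, v7, v6, v6, En W6 W6 [a130,St W6 pq
  pa], En W6 W6 [St W6 pn pa,St W6 pn pg], En W6 W6 [a129,a134], v7, En W6 W6 [St W6 pq pa,a134],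
  En W6 W6 [a129,a134], En W6 W6 [a130], En W6 W6 [a129,a130,St W6 pq pa], v7]"
definition tab0_3 :: rows where "tab0_3 _ = [v7, En W6 W6 [a95], v6, X, v7, v6, v6, En W5 W5
  [a76], v6, v6, v6, En W5 W5 [a76], v6, En W6 W6 [a95,a100,a108,a115,a123,a125], En W5 W6
  [a76,a88,a89,a93,a102,a105,a106,a110,a115,a118,a121,a123,a125,a135], En W6 W6
  [a88,a89,a93,a94,a95,a104,a120]]"
definition tab0_4 :: rows where "tab0_4 _ = [v7, v7, v7, v7, X, v6, v6, En W6 W6 [St W6 pa
  pq,a113], En W6 W6 [a98,a114], En W6 W6 [St W6 pa pn,St W6 pg pn], v6, En W6 W6 [a98,a114], En
  W6 W6 [St W6 pa pq,a114], v7, En W6 W6 [St W6 pa pq,a98,a113], En W6 W6 [a113]]"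
definition tab0_5 :: rows where "tab0_5 _ = [v7, v7, v6, v6, v6, X, v6, v6, En W5 W5 [a56], En W5
  W5 [a78], v6, En W5 W5 [a56,a78], En W5 W5 [a78], En W6 W6
  [a89,a93,a101,a103,a107,a116,a120,a126], En W5 W6 [a56,a88,a93,a97,a105,a106,a109,a124,a128], En
  W6 W6 [a90,a94,a101,a104,a109,a117,a136]]"
definition tab0_6 :: rows where "tab0_6 _ = [v7, v7, v6, v6, v6, v6, X, v6, En W5 W5 [a63], En W5
  W5 [a69], v6, En W5 W5 [a63], En W5 W5 [a63,a69], En W6 W6 [a82,a100,a101,a103,a123,a126,a133],
  En W5 W6 [a69,a93,a97,a102,a103,a110,a115,a124,a131], En W6 W6
  [a83,a89,a93,a101,a109,a117,a120,a122]]"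
definition tab0_7 :: rows where "tab0_7 _ = [v7, v6, v6, v5, v6, v6, v6, X, v5, v5, v5, v5, v5,
  v5, v5, v5]"
definition tab0_8 :: rows where "tab0_8 _ = [v7, En W6 W6 [a95,a108], v6, v6, v6, v5, v5, En W5 W5
  [a62,a67], X, En W5 W5 [a61,a68], v6, En W5 W5 [a56,a63,a67,a68], En W5 W5 [a63,a68], En W6 W6
  [a82,a89,a93,a95,a100,a108,a111,a115,a116,a120,a122,a133], En W5 W6
  [a56,a62,a67,a93,a94,a95,a97,a102,a110,a111,a112,a115,a118,a121,St W6 pj pg,a128,a132], En W5 W6
  [a62,a85,a93,a94,a95,a101,a108,a109,a111,a117,a120,a122,a136]]"
definition tab0_9 :: rows where "tab0_9 _ = [v7, En W6 W6 [a95,a108], v6, v6, v6, v5, v5, En W5 W5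
  [a53,a72], En W5 W5 [a61,a68], X, v6, En W5 W5 [a61,a78], En W5 W5 [a53,a61,a69,a78], En W5 W6
  [a72,a89,a93,a95,a100,a101,a103,a108,a111,a116,a119,a126,a133], En W5 W6
  [a53,a69,a72,a84,a88,a93,a96,a100,a105,a106,a108,a111,St W6 pg pj,a124,a125,a131,a132], En W6 W6
  [a88,a89,a93,a94,a95,a104,a108,a111,a116,a120,a122,a136]]"
definition tab0_10 :: rows where "tab0_10 _ = [v7, En W6 W6 [a108], v7, v6, v6, v6, v6, En W5 W5
  [a54], v6, v6, X, v6, En W5 W5 [a54], En W6 W6 [a82,a89,a93,a100,a108,a115,a120], En W5 W6
  [a54,a84,a88,a90,a93,a96,a102,a105,a106,a110,a112,a115,a120,a127], En W6 W6
  [a88,a90,a94,a95,a108,a112]]"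
definition tab0_11 :: rows where "tab0_11 _ = [v7, En W6 W6 [a95,a107], v6, v5, v6, v5, v5, En W5
  W5 [a76], En W5 W5 [a56,a63,a67,a68], En W5 W5 [a61,a78], v6, X, En W5 W5 [a63,a78], En W6 W6
  [a87,a89,a91,a95,a100,a101,a115,a116,a119,a133], En W5 W6
  [a56,a76,a80,a86,a94,a97,a104,a106,a115,a118,a119,a128,a135], En W6 W6
  [a87,a89,a95,a101,a104,a107,a117,a136]]"
definition tab0_12 :: rows where "tab0_12 _ = [v7, En W6 W6 [a83,a108], v6, v6, v6, v5, v5, En W5
  W5 [a54], En W5 W5 [a63,a68], En W5 W5 [a53,a61,a69,a78], v5, En W5 W5 [a63,a78], X, En W6 W6
  [a82,a83,a92,a101,a108,a120,a126,a133], En W5 W6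
  [a54,a69,a82,a84,a85,a86,a88,a91,a100,a110,a124,a127,a131], En W6 W6
  [a80,a85,a88,a92,a94,a101,a108,a120,a122,a136]]"
definition tab0_13 :: rows where "tab0_13 _ = [v7, En W6 W6 [a107], v6, v6, v7, v6, v6, En W5 W6
  [a72,a82,a87,a89,a92,a100,a103,a107,a111,a123,a125,a132], En W6 W6
  [a82,a89,a93,a95,a100,a108,a111,a115,a116,a120,a122,a133], En W5 W6
  [a72,a89,a93,a95,a100,a101,a103,a108,a111,a116,a119,a126,a133], v6, En W6 W6
  [a87,a89,a91,a95,a100,a101,a115,a116,a119,a133], En W6 W6
  [a82,a83,a92,a101,a108,a120,a126,a133], X, En W5 W6
  [a72,a82,a87,a92,a100,a101,a103,a107,a111,a123,a125,a132], En W6 W6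
  [a81,a83,a99,a107,a111,a132]]"
definition tab0_14 :: rows where "tab0_14 _ = [v7, En W6 W6 [a83,a107], v6, v5, v6, v5, v5, En W5
  W6
  [a54,a62,a72,a76,a82,a84,a90,a103,a104,a109,a111,a112,a118,a123,a125,a127,a128,a131,a132,a135],
  En W5 W6 [a56,a62,a67,a93,a94,a95,a97,a102,a110,a111,a112,a115,a118,a121,St W6 pj pg,a128,a132],
  En W5 W6 [a53,a69,a72,a84,a88,a93,a96,a100,a105,a106,a108,a111,St W6 pg pj,a124,a125,a131,a132],
  v5, En W5 W6 [a56,a76,a80,a86,a94,a97,a104,a106,a115,a118,a119,a128,a135], En W5 W6
  [a54,a69,a82,a84,a85,a86,a88,a91,a100,a110,a124,a127,a131], En W5 W6
  [a72,a82,a87,a92,a100,a101,a103,a107,a111,a123,a125,a132], X, En W5 W6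
  [a62,a83,a87,a90,a92,a94,a101,a104,a109,a111,a112,a132]]"
definition tab0_15 :: rows where "tab0_15 _ = [v7, En W6 W6 [a83], v7, v6, v6, v6, v6, En W5 W6
  [a62,a83,a87,a90,a92,a94,a104,a109,a111,a112,a120,a132], En W5 W6
  [a62,a85,a93,a94,a95,a101,a108,a109,a111,a117,a120,a122,a136], En W6 W6
  [a88,a89,a93,a94,a95,a104,a108,a111,a116,a120,a122,a136], v6, En W6 W6
  [a87,a89,a95,a101,a104,a107,a117,a136], En W6 W6 [a80,a85,a88,a92,a94,a101,a108,a120,a122,a136],
  En W6 W6 [a81,a83,a99,a107,a111,a132], En W5 W6
  [a62,a83,a87,a90,a92,a94,a101,a104,a109,a111,a112,a132], X]"
definition tab0 :: rows where "tab0 _ = [Nd W7 W8 tab0_0, Nd W6 W8 tab0_1, Nd W6 W8 tab0_2, Nd W5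
  W8 tab0_3, Nd W6 W8 tab0_4, Nd W5 W8 tab0_5, Nd W5 W8 tab0_6, Nd W5 W8 tab0_7, Nd W5 W8 tab0_8,
  Nd W5 W8 tab0_9, Nd W5 W8 tab0_10, Nd W5 W8 tab0_11, Nd W5 W8 tab0_12, Nd W5 W8 tab0_13, Nd W5
  W8 tab0_14, Nd W5 W8 tab0_15]"
definition tab1_0 :: rows where "tab1_0 _ = [v7, X, v7, v6, v7, v7, v7, En W6 W6 [a83,a107], En W6
  W6 [a95,a108], En W6 W6 [a95,a108], v6, En W6 W6 [a95,a107], En W6 W6 [a83,a108], En W6 W6
  [a107], En W6 W6 [a83,a107], En W6 W6 [a83]]"
definition tab1_2 :: rows where "tab1_2 _ = [v7, X, X, v6, v7, v6, v6, v6, v6, v6, v6, v6, v6, v6,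
  v6, v6]"
definition tab1_3 :: rows where "tab1_3 _ = [v6, X, v6, X, v6, v5, v6, v5, En W4 W4 [a21], En W4
  W4 [a21], v5, En W4 W4 [a21], v5, v6, v5, v6]"
definition tab1_4 :: rows where "tab1_4 _ = [v7, X, v7, v6, X, v6, v6, v6, v6, v6, v6, v6, v6, v6,
  v6, v6]"
definition tab1_5 :: rows where "tab1_5 _ = [v7, X, v6, v5, v6, X, v6, v5, v5, v5, v6, v5, v5, v6,
  v5, v5]"
definition tab1_6 :: rows where "tab1_6 _ = [v7, X, v6, v6, v6, v6, X, v5, v5, v5, v5, v5, v5, v5,
  v5, v6]"
definition tab1_7 :: rows where "tab1_7 _ = [v6, X, v6, v5, v6, v5, v5, X, v4, v4, v5, v4, v4, v4,
  v4, v4]"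
definition tab1_8 :: rows where "tab1_8 _ = [v6, X, v6, v4, v6, v5, v5, v4, X, v4, v4, v4, En W4
  W4 [a33], En W4 W4 [a32], En W4 W4 [a32], v5]"
definition tab1_9 :: rows where "tab1_9 _ = [v6, X, v6, v4, v6, v5, v5, v4, v4, X, v4, En W4 W4
  [a21], v4, v5, En W4 W4 [a9], En W4 W4 [a9]]"
definition tab1_10 :: rows where "tab1_10 _ = [v6, X, v6, v5, v6, v6, v5, v5, En W4 W4 [a33], En
  W4 W4 [a33], X, v5, En W4 W4 [a33], v6, v5, v6]"
definition tab1_11 :: rows where "tab1_11 _ = [v6, X, v6, v4, v6, v5, v5, En W4 W4 [a32], En W4 W4
  [a21,a32], En W4 W4 [a21], v5, X, v5, En W4 W4 [a32], En W4 W4 [a32], v6]"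
definition tab1_12 :: rows where "tab1_12 _ = [v6, X, v6, v5, v6, v5, v5, En W4 W4 [a9], En W4 W4
  [a33], En W4 W4 [a9,a33], v4, v5, X, v6, En W4 W4 [a9], En W4 W4 [a9]]"
definition tab1_13 :: rows where "tab1_13 _ = [En W6 W6 [a107], X, v6, v6, v6, v6, v5, En W4 W4
  [a32], En W4 W4 [a32], En W5 W5 [a72], v6, En W4 W6 [a32,a60,a70,St W6 pa pk,a87,St W6 pb
  pi,a89,a91,St W6 pc ph,a100,a101,St W6 pd pj,a109,a111,St W6 ph pc,a116,a118,St W6 pk pd,a133],
  v6, X, En W5 W5 [a70,a72], En W6 W6 [a81,a83,a99,a107,a111,a132]]"
definition tab1_14 :: rows where "tab1_14 _ = [v6, X, v6, v5, v6, v5, v5, v4, En W4 W4 [a32], En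
  W4 W4 [a9], v5, En W4 W4 [a32], En W4 W4 [a9], En W5 W5 [a70,a72], X, En W5 W5 [a57,a62]]"
definition tab1_15 :: rows where "tab1_15 _ = [En W6 W6 [a83], X, v6, v6, v6, v5, v6, En W4 W4
  [a9], En W5 W5 [a62], En W4 W4 [a9], v6, v6, En W4 W6 [a9,a57,a65,a80,a84,a92,a94,St W6 pc
  ph,a101,a103,St W6 pd pk,a111,St W6 ph pc,St W6 pi pb,a120,St W6 pj pd,a122,St W6 pk pa,a136],
  En W6 W6 [a81,a83,a99,a107,a111,a132], En W5 W5 [a57,a62], X]"
definition tab1 :: rows where "tab1 _ = [Nd W6 W8 tab1_0, X, Nd W6 W8 tab1_2, Nd W4 W7 tab1_3, Nd
  W6 W8 tab1_4, Nd W5 W8 tab1_5, Nd W5 W8 tab1_6, Nd W4 W7 tab1_7, Nd W4 W7 tab1_8, Nd W4 W7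
  tab1_9, Nd W4 W7 tab1_10, Nd W4 W7 tab1_11, Nd W4 W7 tab1_12, Nd W4 W8 tab1_13, Nd W4 W7
  tab1_14, Nd W4 W8 tab1_15]"
definition tab2_0 :: rows where "tab2_0 _ = [v7, v7, X, v6, v7, v6, v6, v6, En W6 W6 [St W6 pn
  pa,St W6 pn pg], En W6 W6 [a129,a134], v7, En W6 W6 [St W6 pq pa,a134], En W6 W6 [a129,a134], En
  W6 W6 [a130], En W6 W6 [a129,a130,St W6 pq pa], v7]"
definition tab2_1 :: rows where "tab2_1 _ = [v7, X, X, v6, v7, v6, v6, v6, v6, En W6 W6
  [a129,a134], v6, En W6 W6 [St W6 pq pd,a134], v6, En W6 W6 [St W6 po pd,a130], En W6 W6 [St W6
  po pf,a130,St W6 pq pd], En W6 W6 [St W6 pl pg]]"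
definition tab2_3 :: rows where "tab2_3 _ = [v6, v6, X, X, v6, v6, v6, v4, v6, v6, v6, En W4 W4
  [a50], v6, v6, En W4 W4 [a50], v6]"
definition tab2_4 :: rows where "tab2_4 _ = [v7, v7, X, v6, X, v6, v6, v6, v6, v6, v6, v6, v6, v6,
  v6, v6]"
definition tab2_5 :: rows where "tab2_5 _ = [v6, v6, X, v6, v6, X, v6, v6, v5, v4, v6, v4, En W4
  W4 [a51], v6, v5, v5]"
definition tab2_6 :: rows where "tab2_6 _ = [v6, v6, X, v6, v6, v6, X, v6, v5, En W4 W4 [a46], v6,
  v5, v4, v5, En W4 W4 [a46], v6]"
definition tab2_7 :: rows where "tab2_7 _ = [v6, v6, X, v4, v6, v6, v6, X, v4, v4, v5, v4, v5, v4,
  v4, v5]"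
definition tab2_8 :: rows where "tab2_8 _ = [v6, v6, X, v6, v6, v5, v5, v4, X, v4, v6, v4, En W4
  W4 [St W4 pn pg], v5, En W4 W4 [St W4 pn pa], v5]"
definition tab2_9 :: rows where "tab2_9 _ = [v6, v6, X, v6, v6, v4, v4, v4, v4, X, v6, En W4 W4
  [a51], v4, En W4 W4 [a47], En W4 W4 [a46,a47], v5]"
definition tab2_10 :: rows where "tab2_10 _ = [v7, v6, X, v6, v6, v6, v6, v5, v6, v6, X, v6, v5,
  v6, v5, v6]"
definition tab2_11 :: rows where "tab2_11 _ = [v6, v6, X, v4, v6, v4, v5, v4, En W4 W4 [St W4 pn
  pa,St W4 pn pg], En W4 W4 [a51], v6, X, En W4 W4 [a51], v5, En W4 W4 [a50], v5]"
definition tab2_12 :: rows where "tab2_12 _ = [v6, v6, X, v6, v6, v4, v4, v5, En W4 W4 [St W4 pn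
  pg], En W4 W4 [a46,a51], v5, En W4 W4 [a51], X, v5, En W4 W4 [a46], v5]"
definition tab2_13 :: rows where "tab2_13 _ = [v6, v6, X, v6, v6, v6, v5, En W4 W4 [a47], v5, En
  W4 W5 [a47,a75], v6, En W5 W5 [a75], v5, X, En W4 W5 [a47,a74], En W5 W5 [a74]]"
definition tab2_14 :: rows where "tab2_14 _ = [v6, v6, X, v4, v6, v5, v4, v4, En W4 W4 [St W4 pn
  pa], En W4 W4 [a46,a47], v5, En W4 W4 [a50], En W4 W4 [a46], En W4 W4 [a47], X, v5]"
definition tab2_15 :: rows where "tab2_15 _ = [v7, En W6 W6 [St W6 pl pg], X, v6, v6, v5, v6, v5,
  v5, v5, v6, v5, En W5 W5 [a79], En W5 W6 [a74,St W6 po pd,a130,St W6 pp pk], En W5 W5 [a74], X]"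
definition tab2 :: rows where "tab2 _ = [Nd W6 W8 tab2_0, Nd W6 W8 tab2_1, X, Nd W4 W7 tab2_3, Nd
  W6 W8 tab2_4, Nd W4 W7 tab2_5, Nd W4 W7 tab2_6, Nd W4 W7 tab2_7, Nd W4 W7 tab2_8, Nd W4 W7
  tab2_9, Nd W5 W8 tab2_10, Nd W4 W7 tab2_11, Nd W4 W7 tab2_12, Nd W4 W7 tab2_13, Nd W4 W7
  tab2_14, Nd W5 W8 tab2_15]"
definition tab3_0 :: rows where "tab3_0 _ = [v7, En W6 W6 [a95], v6, X, v7, v6, v6, En W5 W5
  [a76], v6, v6, v6, En W5 W5 [a76], v6, En W6 W6 [a95,a100,a108,a115,a123,a125], En W5 W6
  [a76,a88,a89,a93,a102,a105,a106,a110,a115,a118,a121,a123,a125,a135], En W6 W6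
  [a88,a89,a93,a94,a95,a104,a120]]"
definition tab3_1 :: rows where "tab3_1 _ = [En W6 W6 [a95], X, v6, X, v6, v5, v6, v5, En W4 W4
  [a21], En W4 W5 [a21,a58,a59,a68], v5, En W4 W5 [a21,a56,a68,a77], En W5 W5 [a58], En W6 W6 [St
  W6 pb pi,St W6 pc ph,a100,St W6 ph pc,St W6 pi pb,a122,St W6 pk pe,a125], En W5 W5
  [a58,a59,a77], v6]"
definition tab3_2 :: rows where "tab3_2 _ = [v6, v6, X, X, v6, v6, v6, v4, v6, v6, v6, En W4 W4
  [a50], v6, v6, En W4 W4 [a50], v6]"
definition tab3_4 :: rows where "tab3_4 _ = [v7, v6, v6, X, X, v6, v6, v5, v6, v6, v6, v5, v6, v6,
  v5, v6]"
definition tab3_5 :: rows where "tab3_5 _ = [v6, v5, v6, X, v6, X, v6, v4, v5, v4, v4, v4, v4, v5,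
  v4, v4]"
definition tab3_6 :: rows where "tab3_6 _ = [v6, v6, v6, X, v6, v6, X, v4, v4, v4, v4, v4, v4, En
  W4 W4 [a25,a44], En W4 W4 [a19,a27,a35,a40,a43,a44], En W4 W4 [a15,a19,a42]]"
definition tab3_7 :: rows where "tab3_7 _ = [v5, v5, v4, X, v5, v4, v4, X, v4, v4, v4, v3, v4, v4,
  v3, v4]"
definition tab3_8 :: rows where "tab3_8 _ = [v6, v4, v6, X, v6, v5, v4, v4, X, v4, v4, v4, v4, v4,
  v4, v4]"
definition tab3_9 :: rows where "tab3_9 _ = [v6, En W4 W4 [a21], v6, X, v6, v4, v4, v4, v4, X, v4,
  v4, v4, En W4 W4 [a21,a25,a33,a45], En W4 W4 [a14,a15,a19,a25,a30,a31,a33,a43,a45], En W4 W4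
  [a14,a15,a19,a20,a21,a29]]"
definition tab3_10 :: rows where "tab3_10 _ = [v6, v5, v6, X, v6, v4, v4, v4, En W4 W4
  [a20,a21,a27,a35,a40], v4, X, v4, En W4 W4 [a14,a21,a27,a30,a33], En W4 W4 [a25,a33,a40], En W4
  W4 [a14,a27,a30,a31,a35,a40], En W4 W4 [a14,a20,a21]]"
definition tab3_11 :: rows where "tab3_11 _ = [v5, En W4 W4 [a21], v4, X, v5, v4, v4, En W3 W3
  [a5], En W4 W4 [a12,a17,a21,a40,St W4 pi pa], v4, v4, X, En W4 W4 [a19,a27,a30,a31,a33,a43], En
  W4 W4 [a21,a25,a40], En W3 W4 [a5,a12,a29,a31,a40,St W4 pi pa,St W4 pq pl], En W4 W4
  [a13,a15,a21,a29]]"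
definition tab3_12 :: rows where "tab3_12 _ = [v6, v5, v6, X, v6, v4, v4, v4, v4, v4, v4, v4, X,
  v5, v4, v4]"
definition tab3_13 :: rows where "tab3_13 _ = [v6, v6, v6, X, v6, v5, v4, En W4 W4 [a25,a44,a45],
  En W4 W4 [a21,a25,a33,a40], En W4 W4 [a21,a25,a33,a45], v4, En W4 W4 [a21,a25,a40], En W5 W5
  [a58], X, En W4 W4 [a25,a44,a45], v5]"
definition tab3_14 :: rows where "tab3_14 _ = [En W5 W5 [a76], En W5 W5 [a58,a59,a77], v4, X, v5,
  v4, v4, v3, En W4 W4 [a19,a20,a21,a27,a35,a40,St W4 pi pa,a43], v4, v4, En W3 W3 [a5], En W4 W4
  [a12,a14,a17,a25], En W4 W5 [a25,a44,a45,a58,a59,St W5 pk pn,St W5 pk po,a69,St W5 pp pe,St W5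
  pq pb,a77,St W5 pq ph], X, En W4 W4 [a13,a15,a18,a29]]"
definition tab3_15 :: rows where "tab3_15 _ = [v6, v6, v6, X, v6, v4, v4, v4, En W4 W4
  [a19,a20,a21], v4, v4, v4, En W4 W5 [a14,a18,a20,a42,St W5 pb pp,St W5 pc pn,a58,a59,St W5 pj
  pm,St W5 pm ph,St W5 pn pb,a77], En W5 W5 [St W5 pk po], En W4 W5 [a13,a15,a18,a29,St W5 pb
  pn,a55,a58,St W5 pe pp,a59,St W5 ph pq,St W5 pi pm,St W5 pi po,St W5 pk po,a66,St W5 pn
  pb,a77,St W5 pq pj], X]"
definition tab3 :: rows where "tab3 _ = [Nd W5 W8 tab3_0, Nd W4 W8 tab3_1, Nd W4 W7 tab3_2, X, Nd
  W5 W8 tab3_4, Nd W4 W7 tab3_5, Nd W4 W7 tab3_6, Nd W3 W6 tab3_7, Nd W4 W7 tab3_8, Nd W4 W7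
  tab3_9, Nd W4 W7 tab3_10, Nd W3 W6 tab3_11, Nd W4 W7 tab3_12, Nd W4 W7 tab3_13, Nd W3 W7
  tab3_14, Nd W4 W7 tab3_15]"
definition tab4_0 :: rows where "tab4_0 _ = [v7, v7, v7, v7, X, v6, v6, v6, En W6 W6 [a98,a114],
  En W6 W6 [St W6 pa pn,St W6 pg pn], v6, En W6 W6 [a98,a114], En W6 W6 [St W6 pa pq,a114], v7, En
  W6 W6 [St W6 pa pq,a98,a113], En W6 W6 [a113]]"
definition tab4_1 :: rows where "tab4_1 _ = [v7, X, v7, v6, X, v6, v6, v6, En W6 W6 [a98,a114],
  v6, v6, v6, En W6 W6 [St W6 pd pq,a114], En W6 W6 [St W6 pg pl], En W6 W6 [St W6 pd pq,St W6 pf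
  po,a113], En W6 W6 [St W6 pd po,a113]]"
definition tab4_2 :: rows where "tab4_2 _ = [v7, v7, X, v6, X, v6, v6, v6, v6, v6, v6, v6, v6, v6,
  v6, v6]"
definition tab4_3 :: rows where "tab4_3 _ = [v7, v6, v6, X, X, v6, v6, v5, v6, v6, v6, v5, v6, v6,
  v5, v6]"
definition tab4_5 :: rows where "tab4_5 _ = [v6, v6, v6, v6, X, X, v6, v6, En W4 W4 [a23], v5, v6,
  v4, v5, v6, En W4 W4 [a23], v5]"
definition tab4_6 :: rows where "tab4_6 _ = [v6, v6, v6, v6, X, v6, X, v6, v4, v5, v6, En W4 W4
  [a39], v4, v5, v5, v6]"
definition tab4_7 :: rows where "tab4_7 _ = [v6, v6, v6, v5, X, v6, v6, X, v4, v4, v4, v5, v4, v5,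
  v4, v4]"
definition tab4_8 :: rows where "tab4_8 _ = [v6, v6, v6, v6, X, v4, v4, v4, X, v4, v6, v4, En W4
  W4 [a39], v5, En W4 W4 [a23,a38], En W4 W4 [a38]]"
definition tab4_9 :: rows where "tab4_9 _ = [v6, v6, v6, v6, X, v5, v5, v4, v4, X, v6, En W4 W4
  [St W4 pg pn], v4, v5, En W4 W4 [St W4 pa pn], v5]"
definition tab4_10 :: rows where "tab4_10 _ = [v6, v6, v6, v6, X, v6, v6, v4, v6, v6, X, v6, En W4
  W4 [a11], v6, En W4 W4 [a11], v6]"
definition tab4_11 :: rows where "tab4_11 _ = [v6, v6, v6, v5, X, v4, v4, v5, En W4 W4 [a23,a39],
  En W4 W4 [St W4 pg pn], v6, X, En W4 W4 [a39], v5, En W4 W4 [a23], v5]"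
definition tab4_12 :: rows where "tab4_12 _ = [v6, v6, v6, v6, X, v5, v4, v4, En W4 W4 [a39], En
  W4 W4 [St W4 pa pn,St W4 pg pn], v4, En W4 W4 [a39], X, v5, En W4 W4 [a11], v5]"
definition tab4_13 :: rows where "tab4_13 _ = [v7, En W6 W6 [St W6 pg pl], v6, v6, X, v6, v5, v5,
  v5, v5, v6, En W5 W5 [a75], v5, X, En W5 W5 [a74], En W5 W6 [a74,St W6 pd po,a113,St W6 pk pp]]"
definition tab4_14 :: rows where "tab4_14 _ = [v6, v6, v6, v5, X, v4, v5, v4, En W4 W4 [a23,a38],
  En W4 W4 [St W4 pa pn], v4, En W4 W4 [a23], En W4 W4 [a11], v5, X, En W4 W4 [a38]]"
definition tab4_15 :: rows where "tab4_15 _ = [v6, v6, v6, v6, X, v5, v6, En W4 W4 [a38], En W4 W5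
  [a38,a79], v5, v6, v5, En W5 W5 [a79], En W5 W5 [a74], En W4 W5 [a38,a74], X]"
definition tab4 :: rows where "tab4 _ = [Nd W6 W8 tab4_0, Nd W6 W8 tab4_1, Nd W6 W8 tab4_2, Nd W5
  W8 tab4_3, X, Nd W4 W7 tab4_5, Nd W4 W7 tab4_6, Nd W4 W7 tab4_7, Nd W4 W7 tab4_8, Nd W4 W7
  tab4_9, Nd W4 W7 tab4_10, Nd W4 W7 tab4_11, Nd W4 W7 tab4_12, Nd W5 W8 tab4_13, Nd W4 W7
  tab4_14, Nd W4 W7 tab4_15]"
definition tab5_0 :: rows where "tab5_0 _ = [v7, v7, v6, v6, v6, X, v6, v6, v5, v5, v6, v5, v5,
  v6, v5, v6]"
definition tab5_1 :: rows where "tab5_1 _ = [v7, X, v6, v5, v6, X, v6, v5, v5, v5, v6, v5, v5, v6,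
  v5, v5]"
definition tab5_2 :: rows where "tab5_2 _ = [v6, v6, X, v6, v6, X, v6, v6, v5, v4, v6, v4, v4, v6,
  v5, v5]"
definition tab5_3 :: rows where "tab5_3 _ = [v6, v5, v6, X, v6, X, v6, v4, v5, v4, v4, v4, v4, v5,
  v4, v4]"
definition tab5_4 :: rows where "tab5_4 _ = [v6, v6, v6, v6, X, X, v6, v6, v4, v5, v6, v4, v5, v6,
  v4, v5]"
definition tab5_6 :: rows where "tab5_6 _ = [v6, v6, v6, v6, v6, X, X, v6, v4, v4, v6, v4, v4, v4,
  v4, v4]"
definition tab5_7 :: rows where "tab5_7 _ = [v6, v5, v6, v4, v6, X, v6, X, v4, v4, v4, v4, v4, v4,
  v4, v4]"
definition tab5_8 :: rows where "tab5_8 _ = [v5, v5, v5, v5, v4, X, v4, v4, X, v4, v4, v3, v4, v4,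
  v3, v4]"
definition tab5_9 :: rows where "tab5_9 _ = [v5, v5, v4, v4, v5, X, v4, v4, v4, X, v4, v3, v3, v4,
  v4, v4]"
definition tab5_10 :: rows where "tab5_10 _ = [v6, v6, v6, v4, v6, X, v6, v4, v4, v4, X, v4, v4,
  v4, v4, v4]"
definition tab5_11 :: rows where "tab5_11 _ = [v5, v5, v4, v4, v4, X, v4, v4, v3, v3, v4, X, v3,
  v4, v3, v4]"
definition tab5_12 :: rows where "tab5_12 _ = [v5, v5, v4, v4, v5, X, v4, v4, v4, v3, v4, v3, X,
  v4, v4, v4]"
definition tab5_13 :: rows where "tab5_13 _ = [v6, v6, v6, v5, v6, X, v4, v4, v4, v4, v4, v4, v4,
  X, En W4 W4 [a13,a18,a26,a28,a32,a41], En W4 W4 [a24,a32]]"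
definition tab5_14 :: rows where "tab5_14 _ = [v5, v5, v5, v4, v4, X, v4, v4, En W3 W3 [a1], v4,
  v4, En W3 W3 [a1], v4, v4, X, v4]"
definition tab5_15 :: rows where "tab5_15 _ = [v6, v5, v5, v4, v5, X, v4, v4, v4, v4, v4, v4, v4,
  En W4 W4 [a24,a32], En W4 W4 [a16,a20,a26,a29,a34], X]"
definition tab5 :: rows where "tab5 _ = [Nd W5 W8 tab5_0, Nd W5 W8 tab5_1, Nd W4 W7 tab5_2, Nd W4
  W7 tab5_3, Nd W4 W7 tab5_4, X, Nd W4 W7 tab5_6, Nd W4 W7 tab5_7, Nd W3 W6 tab5_8, Nd W3 W6
  tab5_9, Nd W4 W7 tab5_10, Nd W3 W6 tab5_11, Nd W3 W6 tab5_12, Nd W4 W7 tab5_13, Nd W3 W6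
  tab5_14, Nd W4 W7 tab5_15]"
definition tab6_0 :: rows where "tab6_0 _ = [v7, v7, v6, v6, v6, v6, X, v6, v5, v5, v6, v5, v5,
  v6, v5, v6]"
definition tab6_1 :: rows where "tab6_1 _ = [v7, X, v6, v6, v6, v6, X, v5, v5, v5, v5, v5, v5, v5,
  v5, v6]"
definition tab6_2 :: rows where "tab6_2 _ = [v6, v6, X, v6, v6, v6, X, v6, v5, v4, v6, v5, v4, v5,
  v4, v6]"
definition tab6_3 :: rows where "tab6_3 _ = [v6, v6, v6, X, v6, v6, X, v4, v4, v4, v4, v4, v4, v4,
  v4, v4]"
definition tab6_4 :: rows where "tab6_4 _ = [v6, v6, v6, v6, X, v6, X, v6, v4, v5, v6, v4, v4, v5,
  v5, v6]"
definition tab6_5 :: rows where "tab6_5 _ = [v6, v6, v6, v6, v6, X, X, v6, v4, v4, v6, v4, v4, v4,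
  v4, v4]"
definition tab6_7 :: rows where "tab6_7 _ = [v6, v5, v6, v4, v6, v6, X, X, v4, v4, v4, v4, v4, v4,
  v4, v4]"
definition tab6_8 :: rows where "tab6_8 _ = [v5, v5, v5, v4, v4, v4, X, v4, X, v4, v4, v3, v3, v4,
  v4, v4]"
definition tab6_9 :: rows where "tab6_9 _ = [v5, v5, v4, v4, v5, v4, X, v4, v4, X, v5, v4, v3, v4,
  v3, v4]"
definition tab6_10 :: rows where "tab6_10 _ = [v6, v5, v6, v4, v6, v6, X, v4, v4, v5, X, v4, v4,
  v4, v4, v5]"
definition tab6_11 :: rows where "tab6_11 _ = [v5, v5, v5, v4, v4, v4, X, v4, v3, v4, v4, X, v3,
  v4, v4, v4]"
definition tab6_12 :: rows where "tab6_12 _ = [v5, v5, v4, v4, v4, v4, X, v4, v3, v3, v4, v3, X,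
  v4, v3, v4]"
definition tab6_13 :: rows where "tab6_13 _ = [v6, v5, v5, v4, v5, v4, X, v4, v4, v4, v4, v4, v4,
  X, En W4 W4 [a8,a25,a26,a28,a44], En W4 W4 [a7,a9]]"
definition tab6_14 :: rows where "tab6_14 _ = [v5, v5, v4, v4, v5, v4, X, v4, v4, En W3 W3 [a3],
  v4, v4, En W3 W3 [a3], v4, X, v4]"
definition tab6_15 :: rows where "tab6_15 _ = [v6, v6, v6, v4, v6, v4, X, v4, v4, v4, v5, v4, v4,
  En W4 W4 [a7,a9], En W4 W4 [a9,a10,a13,a18,a26,a34], X]"
definition tab6 :: rows where "tab6 _ = [Nd W5 W8 tab6_0, Nd W5 W8 tab6_1, Nd W4 W7 tab6_2, Nd W4
  W7 tab6_3, Nd W4 W7 tab6_4, Nd W4 W7 tab6_5, X, Nd W4 W7 tab6_7, Nd W3 W6 tab6_8, Nd W3 W6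
  tab6_9, Nd W4 W7 tab6_10, Nd W3 W6 tab6_11, Nd W3 W6 tab6_12, Nd W4 W7 tab6_13, Nd W3 W6
  tab6_14, Nd W4 W7 tab6_15]"
definition tab7_0 :: rows where "tab7_0 _ = [v7, v6, v6, v5, v6, v6, v6, X, v5, v5, v5, v5, v5,
  v5, v5, v5]"
definition tab7_1 :: rows where "tab7_1 _ = [v6, X, v6, v5, v6, v5, v5, X, En W4 W4 [a32], En W4
  W4 [a9], v5, En W4 W4 [a32], En W4 W4 [a9], En W4 W4 [a32], En W4 W4 [a9,a32], En W4 W4 [a9]]"
definition tab7_2 :: rows where "tab7_2 _ = [v6, v6, X, v4, v6, v6, v6, X, v4, v4, v5, v4, v5, v4,
  v4, v5]"
definition tab7_3 :: rows where "tab7_3 _ = [v5, v5, v4, X, v5, v4, v4, X, v4, v4, v4, v3, v4, v4,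
  v3, v4]"
definition tab7_4 :: rows where "tab7_4 _ = [v6, v6, v6, v5, X, v6, v6, X, v4, v4, v4, v5, v4, v5,
  v4, v4]"
definition tab7_5 :: rows where "tab7_5 _ = [v6, v5, v6, v4, v6, X, v6, X, v4, v4, v4, v4, v4, v4,
  v4, v4]"
definition tab7_6 :: rows where "tab7_6 _ = [v6, v5, v6, v4, v6, v6, X, X, v4, v4, v4, v4, v4, v4,
  v4, v4]"
definition tab7_8 :: rows where "tab7_8 _ = [v5, v4, v4, v4, v4, v4, v4, X, X, v4, v4, v3, v4, v4,
  v3, v3]"
definition tab7_9 :: rows where "tab7_9 _ = [v5, v4, v4, v4, v4, v4, v4, X, v4, X, v4, v4, v3, v3,
  v3, v4]"
definition tab7_10 :: rows where "tab7_10 _ = [v5, v5, v5, v4, v4, v4, v4, X, v4, v4, X, v4, v3,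
  v4, v3, v4]"
definition tab7_11 :: rows where "tab7_11 _ = [v5, v4, v4, v3, v5, v4, v4, X, v3, v4, v4, X, v4,
  v4, v3, v4]"
definition tab7_12 :: rows where "tab7_12 _ = [v5, v4, v5, v4, v4, v4, v4, X, v4, v3, v3, v4, X,
  v4, v3, v4]"
definition tab7_13 :: rows where "tab7_13 _ = [v5, En W4 W4 [a32], v4, v4, v5, v4, v4, X, v4, En
  W3 W3 [a4], v4, v4, v4, X, En W3 W4 [a4,a28,a32,a36,a44,a45,a48], En W4 W4 [a7,a9,a24,a32,a36]]"
definition tab7_14 :: rows where "tab7_14 _ = [v5, v4, v4, v3, v4, v4, v4, X, En W3 W3 [a2,St W3
  pn pa], En W3 W3 [St W3 pa pn,a4], v3, En W3 W3 [a5], En W3 W3 [a0], En W3 W3 [a4], X, En W3 W3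
  [a2]]"
definition tab7_15 :: rows where "tab7_15 _ = [v5, En W4 W4 [a9], v5, v4, v4, v4, v4, X, En W3 W3
  [a2], v4, v4, v4, v4, En W4 W4 [a7,a9,a24,a32,a36], En W3 W4 [a2,a9,a16,a34,a36,a37,a48], X]"
definition tab7 :: rows where "tab7 _ = [Nd W5 W8 tab7_0, Nd W4 W7 tab7_1, Nd W4 W7 tab7_2, Nd W3
  W6 tab7_3, Nd W4 W7 tab7_4, Nd W4 W7 tab7_5, Nd W4 W7 tab7_6, X, Nd W3 W6 tab7_8, Nd W3 W6
  tab7_9, Nd W3 W6 tab7_10, Nd W3 W6 tab7_11, Nd W3 W6 tab7_12, Nd W3 W6 tab7_13, Nd W3 W6
  tab7_14, Nd W3 W6 tab7_15]"
definition tab8_0 :: rows where "tab8_0 _ = [v7, v6, v6, v6, v6, v5, v5, v5, X, v5, v6, v5, v5,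
  v6, v5, v5]"
definition tab8_1 :: rows where "tab8_1 _ = [v6, X, v6, v4, v6, v5, v5, v4, X, En W4 W4 [a21,a33],
  v4, En W4 W4 [a21,a32], En W4 W4 [a33], En W4 W4 [a32], En W4 W4 [a32], v5]"
definition tab8_2 :: rows where "tab8_2 _ = [v6, v6, X, v6, v6, v5, v5, v4, X, v4, v6, v4, v4, v5,
  v4, v5]"
definition tab8_3 :: rows where "tab8_3 _ = [v6, v4, v6, X, v6, v5, v4, v4, X, v4, v4, v4, v4, v4,
  v4, v4]"
definition tab8_4 :: rows where "tab8_4 _ = [v6, v6, v6, v6, X, v4, v4, v4, X, v4, v6, v4, v4, v5,
  v4, v4]"
definition tab8_5 :: rows where "tab8_5 _ = [v5, v5, v5, v5, v4, X, v4, v4, X, v4, v4, v3, v4, v4,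
  v3, v4]"
definition tab8_6 :: rows where "tab8_6 _ = [v5, v5, v5, v4, v4, v4, X, v4, X, v4, v4, v3, v3, v4,
  v4, v4]"
definition tab8_7 :: rows where "tab8_7 _ = [v5, v4, v4, v4, v4, v4, v4, X, X, v4, v4, v3, v4, v4,
  v3, v3]"
definition tab8_9 :: rows where "tab8_9 _ = [v5, v4, v4, v4, v4, v4, v4, v4, X, X, v4, v3, v3, v4,
  v4, v4]"
definition tab8_10 :: rows where "tab8_10 _ = [v6, v4, v6, v4, v6, v4, v4, v4, X, v4, X, v4, v4,
  v4, v4, v4]"
definition tab8_11 :: rows where "tab8_11 _ = [v5, v4, v4, v4, v4, v3, v3, v3, X, v3, v4, X, v3,
  v4, v3, v4]"
definition tab8_12 :: rows where "tab8_12 _ = [v5, v4, v4, v4, v4, v4, v3, v4, X, v3, v4, v3, X,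
  v4, v4, v4]"
definition tab8_13 :: rows where "tab8_13 _ = [v6, En W4 W4 [a32], v5, v4, v5, v4, v4, v4, X, v4,
  v4, v4, v4, X, En W4 W4 [a8,a9,a18,a24,a32,a36,a42,St W4 pj pg,a48], En W4 W4
  [a7,a9,a24,a32,a36,a48]]"
definition tab8_14 :: rows where "tab8_14 _ = [v5, v4, v4, v4, v4, v3, v4, v3, X, v4, v4, En W3 W3
  [a1,St W3 pn pa], v4, v4, X, En W3 W3 [a2]]"
definition tab8_15 :: rows where "tab8_15 _ = [v5, v5, v5, v4, v4, v4, v4, En W3 W3 [a2], X, v4,
  v4, v4, v4, En W4 W4 [a7,a9,a24,a32,a36,a48], En W3 W4
  [a2,a6,a9,a10,a18,a20,a26,a34,a36,a37,a48], X]"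
definition tab8 :: rows where "tab8 _ = [Nd W5 W8 tab8_0, Nd W4 W7 tab8_1, Nd W4 W7 tab8_2, Nd W4
  W7 tab8_3, Nd W4 W7 tab8_4, Nd W3 W6 tab8_5, Nd W3 W6 tab8_6, Nd W3 W6 tab8_7, X, Nd W3 W6
  tab8_9, Nd W4 W7 tab8_10, Nd W3 W6 tab8_11, Nd W3 W6 tab8_12, Nd W4 W7 tab8_13, Nd W3 W6
  tab8_14, Nd W3 W6 tab8_15]"
definition tab9_0 :: rows where "tab9_0 _ = [v7, v6, v6, v6, v6, v5, v5, v5, v5, X, v6, v5, v5,
  v5, v5, v6]"
definition tab9_1 :: rows where "tab9_1 _ = [v6, X, v6, v4, v6, v5, v5, v4, En W4 W4 [a21,a33], X,
  v4, En W4 W4 [a21], En W4 W4 [a9,a33], v5, En W4 W4 [a9], En W4 W4 [a9]]"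
definition tab9_2 :: rows where "tab9_2 _ = [v6, v6, X, v6, v6, v4, v4, v4, v4, X, v6, v4, v4, v4,
  v4, v5]"
definition tab9_3 :: rows where "tab9_3 _ = [v6, v4, v6, X, v6, v4, v4, v4, v4, X, v4, v4, v4, v4,
  v4, v4]"
definition tab9_4 :: rows where "tab9_4 _ = [v6, v6, v6, v6, X, v5, v5, v4, v4, X, v6, v4, v4, v5,
  v4, v5]"
definition tab9_5 :: rows where "tab9_5 _ = [v5, v5, v4, v4, v5, X, v4, v4, v4, X, v4, v3, v3, v4,
  v4, v4]"
definition tab9_6 :: rows where "tab9_6 _ = [v5, v5, v4, v4, v5, v4, X, v4, v4, X, v5, v4, v3, v4,
  v3, v4]"
definition tab9_7 :: rows where "tab9_7 _ = [v5, v4, v4, v4, v4, v4, v4, X, v4, X, v4, v4, v3, v3,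
  v3, v4]"
definition tab9_8 :: rows where "tab9_8 _ = [v5, v4, v4, v4, v4, v4, v4, v4, X, X, v4, v3, v3, v4,
  v4, v4]"
definition tab9_10 :: rows where "tab9_10 _ = [v6, v4, v6, v4, v6, v4, v5, v4, v4, X, X, v4, v4,
  v4, v4, v4]"
definition tab9_11 :: rows where "tab9_11 _ = [v5, v4, v4, v4, v4, v3, v4, v4, v3, X, v4, X, v3,
  v4, v4, v4]"
definition tab9_12 :: rows where "tab9_12 _ = [v5, v4, v4, v4, v4, v3, v3, v3, v3, X, v4, v3, X,
  v4, v3, v4]"
definition tab9_13 :: rows where "tab9_13 _ = [v5, v5, v4, v4, v5, v4, v4, En W3 W3 [a4], v4, X,
  v4, v4, v4, X, En W3 W4 [a4,a13,a17,a25,a26,a28,a32,a36,a41,a45,a48], En W4 W4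
  [a7,a9,a24,a32,a36,a48]]"
definition tab9_14 :: rows where "tab9_14 _ = [v5, v4, v4, v4, v4, v4, v3, v3, v4, X, v4, v4, En
  W3 W3 [St W3 pa pn,a3], En W3 W3 [a4], X, v4]"
definition tab9_15 :: rows where "tab9_15 _ = [v6, En W4 W4 [a9], v5, v4, v5, v4, v4, v4, v4, X,
  v4, v4, v4, En W4 W4 [a7,a9,a24,a32,a36,a48], En W4 W4 [a7,a9,a13,a15,a29,a32,a36,St W4 pg
  pj,a48], X]"
definition tab9 :: rows where "tab9 _ = [Nd W5 W8 tab9_0, Nd W4 W7 tab9_1, Nd W4 W7 tab9_2, Nd W4
  W7 tab9_3, Nd W4 W7 tab9_4, Nd W3 W6 tab9_5, Nd W3 W6 tab9_6, Nd W3 W6 tab9_7, Nd W3 W6 tab9_8,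
  X, Nd W4 W7 tab9_10, Nd W3 W6 tab9_11, Nd W3 W6 tab9_12, Nd W3 W6 tab9_13, Nd W3 W6 tab9_14, Nd
  W4 W7 tab9_15]"
definition tab10_0 :: rows where "tab10_0 _ = [v7, En W6 W6 [a108], v7, v6, v6, v6, v6, En W5 W5
  [a54], v6, v6, X, v6, En W5 W5 [a54], En W6 W6 [a82,a89,a93,a100,a108,a115,a120], En W5 W6
  [a54,a84,a88,a90,a93,a96,a102,a105,a106,a110,a112,a115,a120,a127], En W6 W6
  [a88,a90,a94,a95,a108,a112]]"
definition tab10_1 :: rows where "tab10_1 _ = [En W6 W6 [a108], X, v6, v5, v6, v6, v5, v5, En W4
  W5 [a33,a61,a71,a77], En W4 W4 [a33], X, En W5 W5 [a77], En W4 W5 [a33,a58,a61,a69], v6, En W5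
  W5 [a58,a71,a77], En W6 W6 [St W6 pb pi,a94,St W6 pc ph,St W6 pe pk,a112,St W6 ph pc,a116,St W6
  pi pb]]"
definition tab10_2 :: rows where "tab10_2 _ = [v7, v6, X, v6, v6, v6, v6, v5, v6, v6, X, v6, v5,
  v6, v5, v6]"
definition tab10_3 :: rows where "tab10_3 _ = [v6, v5, v6, X, v6, v4, v4, v4, v4, En W4 W4
  [a14,a25,a30,a31,a33], X, En W4 W4 [a21,a27,a30,a33,a40], v4, En W4 W4 [a25,a33,a40], En W4 W4
  [a14,a27,a30,a31,a35,a40], En W4 W4 [a14,a20,a21]]"
definition tab10_4 :: rows where "tab10_4 _ = [v6, v6, v6, v6, X, v6, v6, v4, v6, v6, X, v6, En W4
  W4 [a11], v6, En W4 W4 [a11], v6]"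
definition tab10_5 :: rows where "tab10_5 _ = [v6, v6, v6, v4, v6, X, v6, v4, v4, v4, X, v4, v4,
  En W4 W4 [a15,a19,a42], En W4 W4 [a14,a16,a19,a22,a30,a31], En W4 W4 [a16,a20]]"
definition tab10_6 :: rows where "tab10_6 _ = [v6, v5, v6, v4, v6, v6, X, v4, v4, v5, X, v4, v4,
  v4, v4, v5]"
definition tab10_7 :: rows where "tab10_7 _ = [v5, v5, v5, v4, v4, v4, v4, X, v4, v4, X, v4, v3,
  v4, v3, v4]"
definition tab10_8 :: rows where "tab10_8 _ = [v6, En W4 W4 [a33], v6, v4, v6, v4, v4, v4, X, v4,
  X, v4, v4, En W4 W4 [a8,a19,a25,a33,a40,a42], En W4 W4 [a19,a20,a21,a22,a27,a35,a37,a40,a42], En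
  W4 W4 [a20,a21,a33,a37]]"
definition tab10_9 :: rows where "tab10_9 _ = [v6, v4, v6, v4, v6, v4, v5, v4, v4, X, X, v4, v4,
  v4, v4, v4]"
definition tab10_11 :: rows where "tab10_11 _ = [v6, v5, v6, v4, v6, v4, v4, v4, v4, v4, X, X, v4,
  v4, v4, v5]"
definition tab10_12 :: rows where "tab10_12 _ = [v5, En W4 W4 [a33], v5, v4, v4, v4, v4, En W3 W3
  [a0], v4, En W4 W4 [a6,St W4 pa pi,a12,a14,a33], X, En W4 W4 [a19,a21,a22,a27,a30,a35], X, En W4
  W4 [a8,a18,a33,a42], En W3 W4 [a0,a8,St W4 pa pi,a12,a14,a35,St W4 pl pq], En W4 W4
  [a14,a20,a33]]"
definition tab10_13 :: rows where "tab10_13 _ = [v6, v6, v6, v4, v6, v4, v4, v4, v4, En W4 W4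
  [a19,a25,a33], X, En W4 W5 [a13,a15,a25,a40,St W5 pb pn,a58,St W5 ph pm,St W5 pm pj,St W5 pn
  pc,a71,St W5 pp pb,a77], v4, X, En W4 W5 [a8,a13,a18,a42,St W5 pb pn,a55,a58,St W5 pj pq,a66,St
  W5 pm pi,St W5 pn pb,a71,St W5 po pi,St W5 po pk,St W5 pp pe,a77,St W5 pq ph], En W5 W5 [St W5
  po pk]]"
definition tab10_14 :: rows where "tab10_14 _ = [En W5 W5 [a54], En W5 W5 [a58,a71,a77], v5, v4,
  v4, v4, v4, v3, v4, En W4 W4 [St W4 pa pi,a14,a19,a22,a25,a30,a31,a33], X, En W4 W4
  [a6,a12,a20,a40], En W3 W3 [a0], En W4 W4 [a8,a13,a18,a42], X, En W4 W5 [a16,a20,a37,St W5 pb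
  pq,a56,a58,St W5 pe pp,St W5 ph pq,St W5 pn pk,a71,St W5 po pk,a77]]"
definition tab10_15 :: rows where "tab10_15 _ = [v6, v6, v6, v4, v6, v4, v5, En W4 W4
  [a16,a20,a37], En W4 W4 [a20,a21,a33,a37], En W4 W4 [a14,a20,a21,a33], X, En W5 W5 [a77], En W4
  W4 [a14,a20,a33], v5, En W4 W4 [a16,a20,a37], X]"
definition tab10 :: rows where "tab10 _ = [Nd W5 W8 tab10_0, Nd W4 W8 tab10_1, Nd W5 W8 tab10_2,
  Nd W4 W7 tab10_3, Nd W4 W7 tab10_4, Nd W4 W7 tab10_5, Nd W4 W7 tab10_6, Nd W3 W6 tab10_7, Nd W4
  W7 tab10_8, Nd W4 W7 tab10_9, X, Nd W4 W7 tab10_11, Nd W3 W6 tab10_12, Nd W4 W7 tab10_13, Nd W3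
  W7 tab10_14, Nd W4 W7 tab10_15]"
definition tab11_0 :: rows where "tab11_0 _ = [v7, En W6 W6 [a95,a107], v6, v5, v6, v5, v5, En W5
  W5 [a76], En W5 W5 [a56,a63,a67,a68], En W5 W6 [a61,a78,a96,a104,a106,a108,St W6 pg pi,St W6 pi
  pg,St W6 pi pj,a121,St W6 pj pi,a131,a136], v6, X, En W5 W5 [a63,a78], En W6 W6
  [a87,a89,a91,a95,a100,a101,a115,a116,a119,a133], En W5 W6
  [a56,a76,a80,a86,a94,a97,a104,a106,a115,a118,a119,a128,a135], En W6 W6
  [a87,a89,a95,a101,a104,a107,a117,a136]]"
definition tab11_1 :: rows where "tab11_1 _ = [En W6 W6 [a95,a107], X, v6, En W4 W4 [a21], v6, v5,
  v5, En W4 W5 [a32,a62,a76], En W4 W5 [a21,a32,a56,a63,a68,a77], En W4 W5 [a21,a56,a61,a78], v5,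
  X, En W5 W5 [a63,a78], En W4 W5 [a32,a60,a70], En W4 W5 [a32,a56,a62,a70,a76], En W6 W6
  [a87,a89,a95,a101,a104,a107,a117,a136]]"
definition tab11_2 :: rows where "tab11_2 _ = [v6, v6, X, v4, v6, v4, v5, En W4 W4 [a50], En W4 W4
  [St W4 pn pa,St W4 pn pg], En W4 W5 [a51,St W5 po pn,a79], v6, X, En W4 W4 [a51], En W5 W5
  [a75], En W4 W5 [a50,St W5 pn po,St W5 pq pl], En W5 W5 [a79]]"
definition tab11_3 :: rows where "tab11_3 _ = [v5, En W4 W4 [a21], v4, X, v5, v4, v4, En W3 W3
  [a5], v4, En W4 W4 [a15,a29,a31], v4, X, v4, En W4 W4 [a21,a25,a40], En W3 W4
  [a5,a12,a29,a31,a40,St W4 pi pa,St W4 pq pl], En W4 W4 [a13,a15,a21,a29]]"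
definition tab11_4 :: rows where "tab11_4 _ = [v6, v6, v6, v5, X, v4, v4, v5, En W4 W4 [a23,a39],
  En W4 W4 [St W4 pg pn], v6, X, En W4 W4 [a39], v5, En W4 W4 [a23], En W5 W5 [a79]]"
definition tab11_5 :: rows where "tab11_5 _ = [v5, v5, v4, v4, v4, X, v4, v4, En W3 W3 [a1], En W3
  W3 [St W3 pq pg], v4, X, En W3 W3 [St W3 pq pg], En W4 W4 [a13,a15,a17,a26,a32,St W4 ph pj,a41],
  En W3 W4 [a1,a12,a20,St W4 pc pk,a29,a31,St W4 pn po], En W4 W4 [a26,a29,a32,St W4 ph pk,a52]]"
definition tab11_6 :: rows where "tab11_6 _ = [v5, v5, v5, v4, v4, v4, X, v4, v3, v4, v4, X, v3,
  v4, v4, v4]"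
definition tab11_7 :: rows where "tab11_7 _ = [v5, v4, v4, v3, v5, v4, v4, X, v3, v4, v4, X, v4,
  v4, v3, v4]"
definition tab11_8 :: rows where "tab11_8 _ = [v5, En W4 W4 [a21,a32], v4, v4, v4, v3, v3, v3, X,
  En W3 W3 [St W3 pg pn,St W3 pn pg], v4, X, En W3 W3 [St W3 pg pq,St W3 pn pg], En W4 W4
  [a15,a21,a40,St W4 ph pj,a41,a49], En W3 W4 [a1,St W3 pn pa,a12,a20,a21,St W4 pc pk,a40,St W4 pi
  pa,a41,St W4 pn po], En W4 W4 [a21,a32,St W4 ph pk,a52]]"
definition tab11_9 :: rows where "tab11_9 _ = [v5, v4, v4, v4, v4, v3, v4, v4, v3, X, v4, X, v3,
  v4, v4, v4]"
definition tab11_10 :: rows where "tab11_10 _ = [v6, v5, v6, v4, v6, v4, v4, v4, v4, v4, X, X, v4,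
  v4, v4, v5]"
definition tab11_12 :: rows where "tab11_12 _ = [v5, v5, v4, v4, v4, v3, v3, v4, En W3 W3 [St W3
  pg pq,St W3 pn pg], En W3 W4 [St W3 pg pn,St W3 pq pg,a22,a31,a33,St W4 pg pi,St W4 pi pg,St W4
  pi pj,a43,St W4 pj pi,St W4 po pn,a52], v4, X, X, En W4 W4 [a6,a9,a12,a17,a26,a32,a41], En W4 W4
  [a6,a12,a17], En W4 W4 [a6,a9,a10,a12,a17,a26,a32]]"
definition tab11_13 :: rows where "tab11_13 _ = [v6, En W4 W5 [a32,a60,a70], v5, v4, v5, v4, v4,
  v4, v4, En W4 W5 [a15,a21,St W4 ph pj,St W4 po pn,St W5 pc pn,a56,St W5 pd pn,a57,St W5 ph pn,St
  W5 pk pn,a69,St W5 pp pi,St W5 pp pk,a78], v4, X, v4, X, En W4 W5 [a32,a41,St W5 pb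
  pq,a55,a56,a62,a64,a66,a69,a70,a72,a73,St W5 pp pb,a76], En W4 W5 [a24,a32,a57,a60,a70]]"
definition tab11_14 :: rows where "tab11_14 _ = [En W5 W5 [a56,a76], En W4 W5
  [a32,a56,a62,a70,a76], v4, En W3 W3 [a5], v4, En W3 W3 [a1], v4, En W3 W3 [a5], En W3 W3 [a1,St
  W3 pn pa], En W4 W4 [a22,a29,a31], v4, X, v4, En W4 W5 [a32,a41,St W5 pb
  pq,a55,a56,a62,a64,a66,a69,a70,a72,a73,St W5 pp pb,a76], X, En W4 W5 [a32,a56,a62,a70,a76]]"
definition tab11_15 :: rows where "tab11_15 _ = [v6, v6, v5, v4, v5, v4, v4, En W4 W4
  [a7,a9,a13,a15,a29,a32], En W4 W5 [a21,a32,St W4 ph pk,a52,a59,St W5 ph pq,St W5 pi pm,St W5 pi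
  po,a66,St W5 pm pi,St W5 pn pb,St W5 pn ph,a77,a78,St W5 pq pk], En W4 W4 [a15,a21,St W4 ph pj],
  v5, X, En W4 W5 [a6,a9,a10,a12,a17,a26,a32,a53,a55,a56,a57,St W5 ph pq,St W5 pi pm,St W5 pi
  po,St W5 pl pj,a66,St W5 pm pi,St W5 pn pb,St W5 pn ph,a70,a76,a78], En W4 W5
  [a24,a32,a57,a60,a70], En W4 W5 [a32,a56,a62,a70,a76], X]"
definition tab11 :: rows where "tab11 _ = [Nd W5 W8 tab11_0, Nd W4 W8 tab11_1, Nd W4 W7 tab11_2,
  Nd W3 W6 tab11_3, Nd W4 W7 tab11_4, Nd W3 W6 tab11_5, Nd W3 W6 tab11_6, Nd W3 W6 tab11_7, Nd W3
  W6 tab11_8, Nd W3 W6 tab11_9, Nd W4 W7 tab11_10, X, Nd W3 W6 tab11_12, Nd W4 W7 tab11_13, Nd W3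
  W7 tab11_14, Nd W4 W7 tab11_15]"
definition tab12_0 :: rows where "tab12_0 _ = [v7, En W6 W6 [a83,a108], v6, v6, v6, v5, v5, En W5
  W5 [a54], En W5 W6 [a63,a68,a82,a95,a96,a110,St W6 pg pi,St W6 pi pg,St W6 pi pj,a121,St W6 pj
  pi,a128,a133], En W5 W5 [a53,a61,a69,a78], v5, En W5 W5 [a63,a78], X, En W6 W6
  [a82,a83,a92,a101,a108,a120,a126,a133], En W5 W6
  [a54,a69,a82,a84,a85,a86,a88,a91,a100,a110,a124,a127,a131], En W6 W6
  [a80,a85,a88,a92,a94,a101,a108,a120,a122,a136]]"
definition tab12_1 :: rows where "tab12_1 _ = [En W6 W6 [a83,a108], X, v6, v5, v6, v5, v5, En W4
  W5 [a9,a54,a72], En W4 W5 [a33,a63,a68,a69], En W4 W5 [a9,a33,a58,a61,a69,a78], En W4 W4 [a33],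
  En W5 W5 [a63,a78], X, En W6 W6 [a82,a83,a92,a101,a108,a120,a126,a133], En W4 W5
  [a9,a54,a57,a69,a72], En W4 W5 [a9,a57,a65]]"
definition tab12_2 :: rows where "tab12_2 _ = [v6, v6, X, v6, v6, v4, v4, v5, En W4 W4 [St W4 pn
  pg], En W4 W4 [a46,a51], v5, En W4 W4 [a51], X, En W5 W5 [a75], En W4 W4 [a46], v5]"
definition tab12_3 :: rows where "tab12_3 _ = [v6, v5, v6, X, v6, v4, v4, v4, v4, v4, v4, v4, X,
  v5, v4, v4]"
definition tab12_4 :: rows where "tab12_4 _ = [v6, v6, v6, v6, X, v5, v4, En W4 W4 [a11], En W4 W5
  [a39,St W5 pn po,a75], En W4 W4 [St W4 pa pn,St W4 pg pn], v4, En W4 W4 [a39], X, En W5 W5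
  [a75], En W4 W5 [a11,St W5 pl pq,St W5 po pn], En W5 W5 [a79]]"
definition tab12_5 :: rows where "tab12_5 _ = [v5, v5, v4, v4, v5, X, v4, v4, v4, v3, v4, v3, X,
  v4, v4, v4]"
definition tab12_6 :: rows where "tab12_6 _ = [v5, v5, v4, v4, v4, v4, X, v4, En W3 W3 [St W3 pg
  pq], En W3 W3 [a3], v4, En W3 W3 [St W3 pg pq], X, En W4 W4 [a8,a9,a26,St W4 pk ph,a49], En W3
  W4 [a3,a8,a12,a25,a35,St W4 pk pc,St W4 po pn], En W4 W4 [a6,a9,a10,a18,a26,a42,St W4 pj ph]]"
definition tab12_7 :: rows where "tab12_7 _ = [v5, v4, v5, v4, v4, v4, v4, X, v4, v3, v3, v4, X,
  v4, v3, v4]"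
definition tab12_8 :: rows where "tab12_8 _ = [v5, v4, v4, v4, v4, v4, v3, v4, X, v3, v4, v3, X,
  v4, v4, v4]"
definition tab12_9 :: rows where "tab12_9 _ = [v5, En W4 W4 [a9,a33], v4, v4, v4, v3, v3, v3, En
  W3 W3 [St W3 pg pn,St W3 pn pg], X, v4, En W3 W3 [St W3 pg pn,St W3 pq pg], X, En W4 W4
  [a9,a33,St W4 pk ph,a49], En W3 W4 [St W3 pa pn,a3,St W4 pa pi,a10,a12,a14,a25,a33,St W4 pk
  pc,St W4 po pn], En W4 W4 [a10,a14,a33,a42,St W4 pj ph,a52]]"
definition tab12_10 :: rows where "tab12_10 _ = [v5, En W4 W4 [a33], v5, v4, v4, v4, v4, En W3 W3
  [a0], En W4 W4 [a8,a35,a42], v4, X, v4, X, En W4 W4 [a8,a18,a33,a42], En W3 W4 [a0,a8,St W4 pa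
  pi,a12,a14,a35,St W4 pl pq], En W4 W4 [a14,a20,a33]]"
definition tab12_11 :: rows where "tab12_11 _ = [v5, v5, v4, v4, v4, v3, v3, v4, En W3 W4 [St W3
  pg pq,St W3 pn pg,a21,a22,a35,St W4 pg pi,St W4 pi pg,St W4 pi pj,a43,St W4 pj pi,St W4 pn
  po,a49], En W3 W3 [St W3 pg pn,St W3 pq pg], v4, X, X, En W4 W4 [a6,a9,a12,a17,a26,a32,a41], En
  W4 W4 [a6,a12,a17], En W4 W4 [a6,a9,a10,a12,a17,a26,a32]]"
definition tab12_13 :: rows where "tab12_13 _ = [v6, v6, v5, v5, v5, v4, v4, En W4 W4
  [a8,a9,a18,a24,a32,a42], En W4 W4 [a33,a42,St W4 pj ph], En W4 W5 [a9,a33,St W4 pk ph,a49,St W5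
  pb pn,a55,a58,a63,St W5 ph pn,St W5 pi pm,St W5 pk pq,St W5 pm pi,a71,St W5 po pi,St W5 pq ph],
  v4, En W4 W5 [a6,a9,a12,a17,a26,a32,a41,a54,St W5 pb pn,a55,a57,a63,St W5 ph pn,St W5 pi pm,St
  W5 pj pl,a66,St W5 pm pi,a67,a69,a70,St W5 po pi,St W5 pq ph], X, X, En W4 W5
  [a9,a54,a57,a69,a72], En W4 W5 [a7,a9,a57,a65,a70]]"
definition tab12_14 :: rows where "tab12_14 _ = [En W5 W5 [a54,a69], En W4 W5
  [a9,a54,a57,a69,a72], v4, v4, v4, v4, En W3 W3 [a3], En W3 W3 [a0], En W4 W4 [a8,a35,a43], En W3
  W3 [St W3 pa pn,a3], En W3 W3 [a0], v4, X, En W4 W5 [a9,a54,a57,a69,a72], X, En W4 W5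
  [a9,a10,a54,St W5 pb pp,a55,a56,a57,a62,a64,a66,a69,a72,a73,St W5 pq pb]]"
definition tab12_15 :: rows where "tab12_15 _ = [v6, En W4 W5 [a9,a57,a65], v5, v4, v5, v4, v4,
  v4, En W4 W5 [a33,a42,St W4 pj ph,St W4 pn po,a56,a63,St W5 pi pp,St W5 pk pp,St W5 pn pc,St W5
  pn pd,St W5 pn ph,St W5 pn pk,a69,a70], v4, v4, v4, X, En W4 W5 [a7,a9,a57,a65,a70], En W4 W5
  [a9,a10,a54,St W5 pb pp,a55,a56,a57,a62,a64,a66,a69,a72,a73,St W5 pq pb], X]"
definition tab12 :: rows where "tab12 _ = [Nd W5 W8 tab12_0, Nd W4 W8 tab12_1, Nd W4 W7 tab12_2,
  Nd W4 W7 tab12_3, Nd W4 W7 tab12_4, Nd W3 W6 tab12_5, Nd W3 W6 tab12_6, Nd W3 W6 tab12_7, Nd W3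
  W6 tab12_8, Nd W3 W6 tab12_9, Nd W3 W6 tab12_10, Nd W3 W6 tab12_11, X, Nd W4 W7 tab12_13, Nd W3
  W7 tab12_14, Nd W4 W7 tab12_15]"
definition tab13_0 :: rows where "tab13_0 _ = [v7, En W6 W6 [a107], v6, v6, v7, v6, v6, En W5 W5
  [a72], En W6 W6 [a82,a89,a93,a95,a100,a108,a111,a115,a116,a120,a122,a133], En W5 W5 [a72], v6,
  v6, En W6 W6 [a82,a83,a92,a101,a108,a120,a126,a133], X, En W5 W6
  [a72,a82,a87,a92,a100,a101,a103,a107,a111,a123,a125,a132], En W6 W6
  [a81,a83,a99,a107,a111,a132]]"
definition tab13_1 :: rows where "tab13_1 _ = [En W6 W6 [a107], X, v6, v6, v6, v6, v5, En W4 W5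
  [a32,a60,a70,a72], En W4 W5 [a32,a60,a70], En W5 W5 [a72], v6, En W4 W5 [a32,a60,a70], v6, X, En
  W5 W5 [a70,a72], v6]"
definition tab13_2 :: rows where "tab13_2 _ = [v6, v6, X, v6, v6, v6, v5, En W4 W4 [a47], v5, En
  W4 W4 [a47], v6, v5, En W5 W5 [a75], X, En W4 W4 [a47], v5]"
definition tab13_3 :: rows where "tab13_3 _ = [v6, v6, v6, X, v6, v5, v4, v4, v4, v4, v4, v4, v5,
  X, v4, v5]"
definition tab13_4 :: rows where "tab13_4 _ = [v7, v6, v6, v6, X, v6, v5, v5, En W5 W5 [a75], v5,
  v6, v5, En W5 W5 [a75], X, En W5 W5 [a74], En W5 W5 [a74]]"
definition tab13_5 :: rows where "tab13_5 _ = [v6, v6, v6, v5, v6, X, v4, v4, v4, v4, v4, v4, v4,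
  X, v4, v4]"
definition tab13_6 :: rows where "tab13_6 _ = [v6, v5, v5, v4, v5, v4, X, v4, v4, v4, v4, v4, v4,
  X, En W4 W4 [a8,a25,a26,a28,a44], En W4 W4 [a7,a9]]"
definition tab13_7 :: rows where "tab13_7 _ = [v5, v4, v4, v4, v5, v4, v4, X, v4, v3, v4, v4, v4,
  X, v3, v4]"
definition tab13_8 :: rows where "tab13_8 _ = [v6, v4, v5, v4, v5, v4, v4, v4, X, v4, v4, v4, v4,
  X, v4, v4]"
definition tab13_9 :: rows where "tab13_9 _ = [v5, v5, v4, v4, v5, v4, v4, v3, v4, X, v4, v4, v4,
  X, En W3 W4 [a4,a13,a17,a25,a26,a28,a32,a36,a41,a45,a48], En W4 W4 [a7,a9,a24,a32,a36,a48]]"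
definition tab13_10 :: rows where "tab13_10 _ = [v6, v6, v6, v4, v6, v4, v4, v4, En W4 W4
  [a8,a19,a25,a33,a40,a42], v4, X, v4, En W4 W4 [a8,a18,a33,a42], X, En W4 W4 [a8,a13,a18,a42],
  v5]"
definition tab13_11 :: rows where "tab13_11 _ = [v6, En W4 W4 [a32], v5, v4, v5, v4, v4, v4, En W4
  W4 [a15,a21,a40,St W4 ph pj,a41,a49], v4, v4, X, En W4 W4 [a6,a9,a12,a17,a26,a32,a41], X, En W4
  W4 [a32,a41], En W4 W4 [a24,a32]]"
definition tab13_12 :: rows where "tab13_12 _ = [v6, v6, v5, v5, v5, v4, v4, v4, v4, v4, v4, v4,
  X, X, v4, v4]"
definition tab13_14 :: rows where "tab13_14 _ = [En W5 W5 [a72], En W5 W5 [a70,a72], v4, v4, v5,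
  v4, v4, En W3 W3 [a4], En W4 W4 [a8,a9,a18,a24,a32,a36,a42,St W4 pj pg,a48], En W3 W3 [a4], v4,
  v4, En W4 W4 [a9], X, X, En W5 W5 [a57,a62,a64,a70,a72,a73]]"
definition tab13_15 :: rows where "tab13_15 _ = [v6, v6, v5, v5, v5, v4, v4, v4, En W4 W5
  [a7,a9,a24,a32,a36,a48,a57,a62,St W5 pk pp,St W5 pm pk,a70,a72,St W5 po pk], En W4 W4
  [a7,a9,a24,a32,a36,a48], v5, En W4 W4 [a24,a32], En W4 W5 [a7,a9,a57,a65,a70], X, En W5 W5
  [a57,a62,a64,a70,a72,a73], X]"
definition tab13 :: rows where "tab13 _ = [Nd W5 W8 tab13_0, Nd W4 W8 tab13_1, Nd W4 W7 tab13_2,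
  Nd W4 W7 tab13_3, Nd W5 W8 tab13_4, Nd W4 W7 tab13_5, Nd W4 W7 tab13_6, Nd W3 W6 tab13_7, Nd W4
  W7 tab13_8, Nd W3 W6 tab13_9, Nd W4 W7 tab13_10, Nd W4 W7 tab13_11, Nd W4 W7 tab13_12, X, Nd W3
  W7 tab13_14, Nd W4 W7 tab13_15]"
definition tab14_0 :: rows where "tab14_0 _ = [v7, v6, v6, v5, v6, v5, v5, v5, v5, v5, v5, v5, v5,
  v5, X, v5]"
definition tab14_1 :: rows where "tab14_1 _ = [v6, X, v6, v5, v6, v5, v5, v4, En W4 W4 [a32], En
  W4 W4 [a9], v5, En W4 W4 [a32], En W4 W4 [a9], v5, X, v5]"
definition tab14_2 :: rows where "tab14_2 _ = [v6, v6, X, v4, v6, v5, v4, v4, v4, v4, v5, v4, v4,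
  v4, X, v5]"
definition tab14_3 :: rows where "tab14_3 _ = [v5, v5, v4, X, v5, v4, v4, v3, v4, v4, v4, v3, v4,
  v4, X, v4]"
definition tab14_4 :: rows where "tab14_4 _ = [v6, v6, v6, v5, X, v4, v5, v4, v4, v4, v4, v4, v4,
  v5, X, v4]"
definition tab14_5 :: rows where "tab14_5 _ = [v5, v5, v5, v4, v4, X, v4, v4, v3, v4, v4, v3, v4,
  v4, X, v4]"
definition tab14_6 :: rows where "tab14_6 _ = [v5, v5, v4, v4, v5, v4, X, v4, v4, v3, v4, v4, v3,
  v4, X, v4]"
definition tab14_7 :: rows where "tab14_7 _ = [v5, v4, v4, v3, v4, v4, v4, X, v3, v3, v3, v3, v3,
  v3, X, v3]"
definition tab14_8 :: rows where "tab14_8 _ = [v5, v4, v4, v4, v4, v3, v4, v3, X, v4, v4, v3, v4,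
  v4, X, v3]"
definition tab14_9 :: rows where "tab14_9 _ = [v5, v4, v4, v4, v4, v4, v3, v3, v4, X, v4, v4, v3,
  v3, X, v4]"
definition tab14_10 :: rows where "tab14_10 _ = [v5, v5, v5, v4, v4, v4, v4, v3, v4, v4, X, v4,
  v3, v4, X, v4]"
definition tab14_11 :: rows where "tab14_11 _ = [v5, v4, v4, v3, v4, v3, v4, v3, v3, v4, v4, X,
  v4, v4, X, v4]"
definition tab14_12 :: rows where "tab14_12 _ = [v5, v4, v4, v4, v4, v4, v3, v3, v4, v3, v3, v4,
  X, v4, X, v4]"
definition tab14_13 :: rows where "tab14_13 _ = [v5, v5, v4, v4, v5, v4, v4, En W3 W3 [a4], v4, En
  W3 W3 [a4], v4, v4, v4, X, X, v5]"
definition tab14_15 :: rows where "tab14_15 _ = [v5, v5, v5, v4, v4, v4, v4, En W3 W3 [a2], En W3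
  W3 [a2], v4, v4, v4, v4, v5, X, X]"
definition tab14 :: rows where "tab14 _ = [Nd W5 W8 tab14_0, Nd W4 W7 tab14_1, Nd W4 W7 tab14_2,
  Nd W3 W6 tab14_3, Nd W4 W7 tab14_4, Nd W3 W6 tab14_5, Nd W3 W6 tab14_6, Nd W3 W6 tab14_7, Nd W3
  W6 tab14_8, Nd W3 W6 tab14_9, Nd W3 W6 tab14_10, Nd W3 W6 tab14_11, Nd W3 W6 tab14_12, Nd W3 W6
  tab14_13, X, Nd W3 W6 tab14_15]"
definition tab15_0 :: rows where "tab15_0 _ = [v7, En W6 W6 [a83], v7, v6, v6, v6, v6, En W5 W5
  [a62], En W5 W5 [a62], En W6 W6 [a88,a89,a93,a94,a95,a104,a108,a111,a116,a120,a122,a136], v6, En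
  W6 W6 [a87,a89,a95,a101,a104,a107,a117,a136], v6, En W6 W6 [a81,a83,a99,a107,a111,a132], En W5
  W6 [a62,a83,a87,a90,a92,a94,a101,a104,a109,a111,a112,a132], X]"
definition tab15_1 :: rows where "tab15_1 _ = [En W6 W6 [a83], X, v6, v6, v6, v5, v6, En W4 W5
  [a9,a57,a62,a65], En W5 W5 [a62], En W4 W5 [a9,a57,a65], v6, v6, En W4 W5 [a9,a57,a65], v6, En
  W5 W5 [a57,a62], X]"
definition tab15_2 :: rows where "tab15_2 _ = [v7, v6, X, v6, v6, v5, v6, v5, v5, En W5 W5 [a79],
  v6, En W5 W5 [a79], v5, En W5 W5 [a74], En W5 W5 [a74], X]"
definition tab15_3 :: rows where "tab15_3 _ = [v6, v6, v6, X, v6, v4, v4, v4, v4, En W4 W4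
  [a14,a15,a19,a20,a21,a29], v4, En W4 W4 [a13,a15,a21,a29], v4, v5, En W4 W4 [a13,a15,a18,a29],
  X]"
definition tab15_4 :: rows where "tab15_4 _ = [v6, v6, v6, v6, X, v5, v6, En W4 W4 [a38], En W4 W4
  [a38], v5, v6, En W5 W5 [a79], v5, v5, En W4 W4 [a38], X]"
definition tab15_5 :: rows where "tab15_5 _ = [v6, v5, v5, v4, v5, X, v4, v4, v4, v4, v4, v4, v4,
  En W4 W4 [a24,a32], En W4 W4 [a16,a20,a26,a29,a34], X]"
definition tab15_6 :: rows where "tab15_6 _ = [v6, v6, v6, v4, v6, v4, X, v4, v4, v4, v5, v4, v4,
  v4, v4, X]"
definition tab15_7 :: rows where "tab15_7 _ = [v5, v4, v5, v4, v4, v4, v4, X, v3, v4, v4, v4, v4,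
  v4, v3, X]"
definition tab15_8 :: rows where "tab15_8 _ = [v5, v5, v5, v4, v4, v4, v4, v3, X, v4, v4, v4, v4,
  En W4 W4 [a7,a9,a24,a32,a36,a48], En W3 W4 [a2,a6,a9,a10,a18,a20,a26,a34,a36,a37,a48], X]"
definition tab15_9 :: rows where "tab15_9 _ = [v6, v4, v5, v4, v5, v4, v4, v4, v4, X, v4, v4, v4,
  v4, v4, X]"
definition tab15_10 :: rows where "tab15_10 _ = [v6, v6, v6, v4, v6, v4, v5, v4, v4, v4, X, v5,
  v4, v5, v4, X]"
definition tab15_11 :: rows where "tab15_11 _ = [v6, v6, v5, v4, v5, v4, v4, v4, v4, v4, v5, X,
  v4, v4, v4, X]"
definition tab15_12 :: rows where "tab15_12 _ = [v6, En W4 W4 [a9], v5, v4, v5, v4, v4, v4, v4, En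
  W4 W4 [a10,a14,a33,a42,St W4 pj ph,a52], v4, En W4 W4 [a6,a9,a10,a12,a17,a26,a32], X, En W4 W4
  [a7,a9], En W4 W4 [a9,a10], X]"
definition tab15_13 :: rows where "tab15_13 _ = [v6, v6, v5, v5, v5, v4, v4, v4, En W4 W4
  [a7,a9,a24,a32,a36,a48], En W4 W5 [a7,a9,a24,a32,a36,a48,a57,a62,St W5 pk pm,St W5 pk
  po,a70,a72,St W5 pp pk], v5, En W4 W5 [a24,a32,a57,a60,a70], En W4 W4 [a7,a9], X, En W5 W5
  [a57,a62,a64,a70,a72,a73], X]"
definition tab15_14 :: rows where "tab15_14 _ = [En W5 W5 [a62], En W5 W5 [a57,a62], v5, v4, v4,
  v4, v4, En W3 W3 [a2], En W3 W3 [a2], En W4 W4 [a7,a9,a13,a15,a29,a32,a36,St W4 pg pj,a48], v4,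
  En W4 W4 [a32], v4, En W5 W5 [a57,a62,a64,a70,a72,a73], X, X]"
definition tab15 :: rows where "tab15 _ = [Nd W5 W8 tab15_0, Nd W4 W8 tab15_1, Nd W5 W8 tab15_2,
  Nd W4 W7 tab15_3, Nd W4 W7 tab15_4, Nd W4 W7 tab15_5, Nd W4 W7 tab15_6, Nd W3 W6 tab15_7, Nd W3
  W6 tab15_8, Nd W4 W7 tab15_9, Nd W4 W7 tab15_10, Nd W4 W7 tab15_11, Nd W4 W7 tab15_12, Nd W4 W7
  tab15_13, Nd W3 W7 tab15_14, X]"
definition tabs :: rows where "tabs _ = [Nd W5 W10 tab0, Nd W4 W10 tab1, Nd W4 W10 tab2, Nd W3 W10
  tab3, Nd W4 W10 tab4, Nd W3 W10 tab5, Nd W3 W10 tab6, Nd W3 W10 tab7, Nd W3 W10 tab8, Nd W3 W10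
  tab9, Nd W3 W10 tab10, Nd W3 W10 tab11, Nd W3 W10 tab12, Nd W3 W10 tab13, Nd W3 W10 tab14, Nd W3
  W10 tab15]"
definition tab :: tree where "tab = Nd W3 W12 tabs"
lemmas tab_unfolds = tab_def tabs_def tab0_0_def tab0_1_def tab0_2_def tab0_3_def tab0_4_def
tab0_5_def tab0_6_def tab0_7_def tab0_8_def tab0_9_def tab0_10_def tab0_11_def tab0_12_def
tab0_13_def tab0_14_def tab0_15_def tab0_def tab1_0_def tab1_2_def tab1_3_def tab1_4_def tab1_5_def
tab1_6_def tab1_7_def tab1_8_def tab1_9_def tab1_10_def tab1_11_def tab1_12_def tab1_13_def
tab1_14_def tab1_15_def tab1_def tab2_0_def tab2_1_def tab2_3_def tab2_4_def tab2_5_def tab2_6_def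
tab2_7_def tab2_8_def tab2_9_def tab2_10_def tab2_11_def tab2_12_def tab2_13_def tab2_14_def
tab2_15_def tab2_def tab3_0_def tab3_1_def tab3_2_def tab3_4_def tab3_5_def tab3_6_def tab3_7_def
tab3_8_def tab3_9_def tab3_10_def tab3_11_def tab3_12_def tab3_13_def tab3_14_def tab3_15_def
tab3_def tab4_0_def tab4_1_def tab4_2_def tab4_3_def tab4_5_def tab4_6_def tab4_7_def tab4_8_def
tab4_9_def tab4_10_def tab4_11_def tab4_12_def tab4_13_def tab4_14_def tab4_15_def tab4_def
tab5_0_def tab5_1_def tab5_2_def tab5_3_def tab5_4_def tab5_6_def tab5_7_def tab5_8_def tab5_9_def
tab5_10_def tab5_11_def tab5_12_def tab5_13_def tab5_14_def tab5_15_def tab5_def tab6_0_def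
tab6_1_def tab6_2_def tab6_3_def tab6_4_def tab6_5_def tab6_7_def tab6_8_def tab6_9_def tab6_10_def
tab6_11_def tab6_12_def tab6_13_def tab6_14_def tab6_15_def tab6_def tab7_0_def tab7_1_def
tab7_2_def tab7_3_def tab7_4_def tab7_5_def tab7_6_def tab7_8_def tab7_9_def tab7_10_def
  tab7_11_def
tab7_12_def tab7_13_def tab7_14_def tab7_15_def tab7_def tab8_0_def tab8_1_def tab8_2_def
  tab8_3_def
tab8_4_def tab8_5_def tab8_6_def tab8_7_def tab8_9_def tab8_10_def tab8_11_def tab8_12_def
tab8_13_def tab8_14_def tab8_15_def tab8_def tab9_0_def tab9_1_def tab9_2_def tab9_3_def tab9_4_def
tab9_5_def tab9_6_def tab9_7_def tab9_8_def tab9_10_def tab9_11_def tab9_12_def tab9_13_def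
tab9_14_def tab9_15_def tab9_def tab10_0_def tab10_1_def tab10_2_def tab10_3_def tab10_4_def
tab10_5_def tab10_6_def tab10_7_def tab10_8_def tab10_9_def tab10_11_def tab10_12_def tab10_13_def
tab10_14_def tab10_15_def tab10_def tab11_0_def tab11_1_def tab11_2_def tab11_3_def tab11_4_def
tab11_5_def tab11_6_def tab11_7_def tab11_8_def tab11_9_def tab11_10_def tab11_12_def tab11_13_def
tab11_14_def tab11_15_def tab11_def tab12_0_def tab12_1_def tab12_2_def tab12_3_def tab12_4_def
tab12_5_def tab12_6_def tab12_7_def tab12_8_def tab12_9_def tab12_10_def tab12_11_def tab12_13_def
tab12_14_def tab12_15_def tab12_def tab13_0_def tab13_1_def tab13_2_def tab13_3_def tab13_4_def
tab13_5_def tab13_6_def tab13_7_def tab13_8_def tab13_9_def tab13_10_def tab13_11_def tab13_12_def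
tab13_14_def tab13_15_def tab13_def tab14_0_def tab14_1_def tab14_2_def tab14_3_def tab14_4_def
tab14_5_def tab14_6_def tab14_7_def tab14_8_def tab14_9_def tab14_10_def tab14_11_def tab14_12_def
tab14_13_def tab14_15_def tab14_def tab15_0_def tab15_1_def tab15_2_def tab15_3_def tab15_4_def
tab15_5_def tab15_6_def tab15_7_def tab15_8_def tab15_9_def tab15_10_def tab15_11_def tab15_12_def
tab15_13_def tab15_14_def tab15_def

section \<open>Evaluation of the table checks\<close>

lemma dfs_8: "dfs (\<lambda>acc w. False) local_masks trues trues trues w8 0 []"
  by (simp only: dfs_eqs nat_eqs local_masks_def trues_def simp_thms)

lemma tab_covered: "dfs (leaf tab) local_masks trues trues trues w12 0 []"
  by (simp only: dfs_eqs cover_eqs near_eqs nat_eqs near_le.simps val.simps leaf.simps(1) costs_def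
      local_masks_def trues_def tab_unfolds simp_thms)

lemma tab_wf: "node_wf idrows (node_wf idrows (node_wf idrows (\<lambda>_. entry_wf))) falses tab"
  by (simp only: node_wf.simps children_wf.simps entry_wf.simps bor.simps list.pred_inject state.case val.simps cap.simps
      low.simps idrows_def far_rows.simps far_row.simps same.simps points_def falses_def nat_eqs nat.inject
      nat.distinct tab_unfolds simp_thms)

lemma tab_cap: "cap tab \<le> 13"
  by (simp add: tab_def)

lemma tab_joined: "join_level (join_level (join_level join_leaf (far_rows (far w5) points points) (far_cols (far w5) points points))
        (far_rows (far w6) points points) (far_cols (far w6) points points))
        (far_rows (far1 w7) points points) (far_cols (far w7) points points) tab tab tab"
  by (simp only: join_eqs cmp_eqs2 c2_c3_eqs far_eqs far_row.simps far_rows.simps far_col.simps far_cols.simps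
      points_def nat_eqs val.simps low.simps cap.simps states_of.simps kids.simps join_leaf_def join_level_def tab_unfolds simp_thms)

section \<open>Explicit colourings\<close>

definition col0 :: ctree where "col0 = Tri w1 w2 w3"

definition col1 :: ctree where "col1 =
  Br (Tri w1 w2 w4) (Tri 0 w1 w3) (Tri 0 0 w1)"

definition col2 :: ctree where "col2 =
  Br (Br (Tri w2 w1 w6) (Tri 0 w3 w8) (Tri 0 0 w1)) (Br (Tri 0 w2 w1) (Tri 0 w1 w7) (Tri 0 0 w5))
  (Br (Tri 0 w4 w2) (Tri 0 0 w1) (Tri 0 0 w3))"

definition col3 :: ctree where "col3 =
  Br (Br (Br (Tri w2 w1 w3) (Tri 0 w6 w5) (Tri 0 0 w1)) (Br (Tri 0 w1 w2) (Tri 0 w12 w3) (Tri 0 0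
  w1)) (Br (Tri 0 w9 w2) (Tri 0 0 w4) (Tri 0 0 w11))) (Br (Br (Tri 0 w1 w2) (Tri 0 w7 w4) (Tri 0 0
  w1)) (Br (Tri 0 w3 w1) (Tri 0 w1 w2) (Tri 0 0 w5)) (Br (Tri 0 w10 w3) (Tri 0 0 w1) (Tri 0 0 w2)))
  (Br (Br (Tri 0 w3 w1) (Tri 0 w1 w2) (Tri 0 0 w7)) (Br (Tri 0 w8 w6) (Tri 0 0 w1) (Tri 0 0 w4)) (Br
  (Tri 0 w1 w5) (Tri 0 0 w3) (Tri 0 0 w2)))"

definition col4 :: ctree where "col4 =
  Br (Br (Br (Br (Tri w1 w7 w2) (Tri 0 w1 w3) (Tri 0 0 w1)) (Br (Tri 0 w2 w4) (Tri 0 w1 w13) (Tri 0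
  0 w1)) (Br (Tri 0 w5 w14) (Tri 0 0 w2) (Tri 0 0 w1))) (Br (Br (Tri 0 w3 w10) (Tri 0 w1 w9) (Tri 0
  0 w1)) (Br (Tri 0 w2 w4) (Tri 0 w1 w6) (Tri 0 0 w1)) (Br (Tri 0 w2 w5) (Tri 0 0 w3) (Tri 0 0 w1)))
  (Br (Br (Tri 0 w3 w6) (Tri 0 w1 w8) (Tri 0 0 w1)) (Br (Tri 0 w2 w4) (Tri 0 0 w7) (Tri 0 0 w1)) (Br
  (Tri 0 w2 w11) (Tri 0 0 w3) (Tri 0 0 w1)))) (Br (Br (Br (Tri 0 w12 w3) (Tri 0 w2 w1) (Tri 0 0 w8))
  (Br (Tri 0 w7 w1) (Tri 0 w1 w3) (Tri 0 0 w11)) (Br (Tri 0 w1 w2) (Tri 0 0 w4) (Tri 0 0 w1))) (Br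
  (Br (Tri 0 w2 w5) (Tri 0 w1 w6) (Tri 0 0 w1)) (Br (Tri 0 w4 w3) (Tri 0 w1 w2) (Tri 0 0 w1)) (Br
  (Tri 0 w9 w2) (Tri 0 0 w10) (Tri 0 0 w1))) (Br (Br (Tri 0 w5 w3) (Tri 0 w2 w1) (Tri 0 0 w6)) (Br
  (Tri 0 w14 w1) (Tri 0 0 w3) (Tri 0 0 w4)) (Br (Tri 0 w1 w2) (Tri 0 0 w7) (Tri 0 0 w1)))) (Br (Br
  (Br (Tri 0 w2 w5) (Tri 0 w15 w1) (Tri 0 0 w4)) (Br (Tri 0 w3 w1) (Tri 0 w1 w6) (Tri 0 0 w2)) (Br
  (Tri 0 w1 w3) (Tri 0 0 w10) (Tri 0 0 w1))) (Br (Br (Tri 0 w4 w2) (Tri 0 w5 w1) (Tri 0 0 w9)) (Br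
  (Tri 0 w3 w1) (Tri 0 0 w13) (Tri 0 0 w2)) (Br (Tri 0 w1 w3) (Tri 0 0 w8) (Tri 0 0 w1))) (Br (Br
  (Tri 0 w2 w12) (Tri 0 w1 w7) (Tri 0 0 w1)) (Br (Tri 0 w4 w5) (Tri 0 0 w2) (Tri 0 0 w1)) (Br (Tri 0
  w3 w2) (Tri 0 0 w6) (Tri 0 0 w1))))"

definition col5 :: ctree where "col5 =
  Br (Br (Br (Br (Br (Tri w1 w3 w6) (Tri 0 w2 w1) (Tri 0 0 w4)) (Br (Tri 0 w1 w11) (Tri 0 w12 w5)
  (Tri 0 0 w1)) (Br (Tri 0 w2 w1) (Tri 0 0 w13) (Tri 0 0 w9))) (Br (Br (Tri 0 w3 w2) (Tri 0 w7 w1)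
  (Tri 0 0 w4)) (Br (Tri 0 w16 w1) (Tri 0 w1 w19) (Tri 0 0 w2)) (Br (Tri 0 w1 w6) (Tri 0 0 w3) (Tri
  0 0 w1))) (Br (Br (Tri 0 w1 w2) (Tri 0 w8 w3) (Tri 0 0 w1)) (Br (Tri 0 w2 w1) (Tri 0 0 w5) (Tri 0
  0 w18)) (Br (Tri 0 w4 w7) (Tri 0 0 w1) (Tri 0 0 w2)))) (Br (Br (Br (Tri 0 w2 w3) (Tri 0 w1 w5)
  (Tri 0 0 w1)) (Br (Tri 0 w9 w6) (Tri 0 w1 w2) (Tri 0 0 w1)) (Br (Tri 0 w4 w2) (Tri 0 0 w10) (Tri 0
  0 w1))) (Br (Br (Tri 0 w15 w3) (Tri 0 w2 w1) (Tri 0 0 w4)) (Br (Tri 0 w5 w1) (Tri 0 w1 w3) (Tri 0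
  0 w11)) (Br (Tri 0 w1 w2) (Tri 0 0 w7) (Tri 0 0 w1))) (Br (Br (Tri 0 w8 w3) (Tri 0 w1 w2) (Tri 0 0
  w1)) (Br (Tri 0 w13 w5) (Tri 0 0 w3) (Tri 0 0 w2)) (Br (Tri 0 w4 w17) (Tri 0 0 w1) (Tri 0 0 w6))))
  (Br (Br (Br (Tri 0 w1 w3) (Tri 0 w10 w6) (Tri 0 0 w1)) (Br (Tri 0 w1 w2) (Tri 0 w14 w3) (Tri 0 0
  w1)) (Br (Tri 0 w4 w2) (Tri 0 0 w5) (Tri 0 0 w1))) (Br (Br (Tri 0 w2 w1) (Tri 0 w9 w4) (Tri 0 0
  w12)) (Br (Tri 0 w1 w3) (Tri 0 0 w2) (Tri 0 0 w1)) (Br (Tri 0 w5 w2) (Tri 0 0 w7) (Tri 0 0 w1)))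
  (Br (Br (Tri 0 w11 w3) (Tri 0 w2 w1) (Tri 0 0 w15)) (Br (Tri 0 w8 w1) (Tri 0 0 w3) (Tri 0 0 w4))
  (Br (Tri 0 w1 w2) (Tri 0 0 w6) (Tri 0 0 w1))))) (Br (Br (Br (Br (Tri 0 w12 w2) (Tri 0 w4 w1) (Tri
  0 0 w8)) (Br (Tri 0 w1 w3) (Tri 0 w10 w2) (Tri 0 0 w1)) (Br (Tri 0 w14 w1) (Tri 0 0 w6) (Tri 0 0
  w2))) (Br (Br (Tri 0 w7 w1) (Tri 0 w1 w5) (Tri 0 0 w2)) (Br (Tri 0 w2 w4) (Tri 0 w3 w1) (Tri 0 0
  w6)) (Br (Tri 0 w1 w3) (Tri 0 0 w18) (Tri 0 0 w1))) (Br (Br (Tri 0 w3 w1) (Tri 0 w1 w5) (Tri 0 0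
  w9)) (Br (Tri 0 w2 w4) (Tri 0 0 w16) (Tri 0 0 w1)) (Br (Tri 0 w2 w1) (Tri 0 0 w3) (Tri 0 0 w7))))
  (Br (Br (Br (Tri 0 w13 w1) (Tri 0 w1 w2) (Tri 0 0 w11)) (Br (Tri 0 w8 w9) (Tri 0 w2 w3) (Tri 0 0
  w1)) (Br (Tri 0 w4 w1) (Tri 0 0 w2) (Tri 0 0 w5))) (Br (Br (Tri 0 w7 w1) (Tri 0 w1 w6) (Tri 0 0
  w12)) (Br (Tri 0 w10 w4) (Tri 0 w3 w1) (Tri 0 0 w5)) (Br (Tri 0 w1 w3) (Tri 0 0 w2) (Tri 0 0
  w14))) (Br (Br (Tri 0 w3 w1) (Tri 0 w1 w2) (Tri 0 0 w6)) (Br (Tri 0 w19 w4) (Tri 0 0 w1) (Tri 0 0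
  w2)) (Br (Tri 0 w1 w7) (Tri 0 0 w3) (Tri 0 0 w1)))) (Br (Br (Br (Tri 0 w1 w2) (Tri 0 w6 w4) (Tri 0
  0 w1)) (Br (Tri 0 w1 w3) (Tri 0 w2 w17) (Tri 0 0 w1)) (Br (Tri 0 w11 w5) (Tri 0 0 w2) (Tri 0 0
  w1))) (Br (Br (Tri 0 w10 w1) (Tri 0 w4 w3) (Tri 0 0 w8)) (Br (Tri 0 w2 w1) (Tri 0 0 w15) (Tri 0 0
  w5)) (Br (Tri 0 w1 w2) (Tri 0 0 w9) (Tri 0 0 w1))) (Br (Br (Tri 0 w13 w3) (Tri 0 w1 w4) (Tri 0 0
  w1)) (Br (Tri 0 w6 w2) (Tri 0 0 w3) (Tri 0 0 w1)) (Br (Tri 0 w12 w2) (Tri 0 0 w7) (Tri 0 0 w1)))))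
  (Br (Br (Br (Br (Tri 0 w3 w5) (Tri 0 w1 w2) (Tri 0 0 w1)) (Br (Tri 0 w16 w4) (Tri 0 w1 w10) (Tri 0
  0 w2)) (Br (Tri 0 w9 w7) (Tri 0 0 w1) (Tri 0 0 w3))) (Br (Br (Tri 0 w2 w3) (Tri 0 w6 w1) (Tri 0 0
  w13)) (Br (Tri 0 w1 w4) (Tri 0 w2 w7) (Tri 0 0 w1)) (Br (Tri 0 w2 w1) (Tri 0 0 w12) (Tri 0 0 w5)))
  (Br (Br (Tri 0 w1 w2) (Tri 0 w4 w6) (Tri 0 0 w1)) (Br (Tri 0 w1 w2) (Tri 0 0 w3) (Tri 0 0 w1)) (Br
  (Tri 0 w14 w8) (Tri 0 0 w19) (Tri 0 0 w2)))) (Br (Br (Br (Tri 0 w1 w3) (Tri 0 w5 w11) (Tri 0 0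
  w1)) (Br (Tri 0 w1 w2) (Tri 0 w8 w3) (Tri 0 0 w1)) (Br (Tri 0 w4 w2) (Tri 0 0 w9) (Tri 0 0 w1)))
  (Br (Br (Tri 0 w1 w2) (Tri 0 w4 w6) (Tri 0 0 w10)) (Br (Tri 0 w3 w1) (Tri 0 0 w5) (Tri 0 0 w2))
  (Br (Tri 0 w1 w3) (Tri 0 0 w14) (Tri 0 0 w1))) (Br (Br (Tri 0 w3 w6) (Tri 0 w1 w2) (Tri 0 0 w1))
  (Br (Tri 0 w4 w18) (Tri 0 0 w2) (Tri 0 0 w1)) (Br (Tri 0 w5 w7) (Tri 0 0 w3) (Tri 0 0 w1)))) (Br
  (Br (Br (Tri 0 w1 w3) (Tri 0 w4 w5) (Tri 0 0 w1)) (Br (Tri 0 w11 w1) (Tri 0 w1 w2) (Tri 0 0 w17))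
  (Br (Tri 0 w7 w2) (Tri 0 0 w1) (Tri 0 0 w10))) (Br (Br (Tri 0 w3 w6) (Tri 0 w15 w1) (Tri 0 0 w2))
  (Br (Tri 0 w4 w1) (Tri 0 0 w2) (Tri 0 0 w8)) (Br (Tri 0 w1 w5) (Tri 0 0 w3) (Tri 0 0 w12))) (Br
  (Br (Tri 0 w3 w1) (Tri 0 w1 w9) (Tri 0 0 w2)) (Br (Tri 0 w2 w4) (Tri 0 0 w1) (Tri 0 0 w13)) (Br
  (Tri 0 w1 w6) (Tri 0 0 w3) (Tri 0 0 w1)))))"

text \<open>Here also the three outer corners hold the placeholder 0, to be filled by colour 20; the
  colours inside are at most 19.\<close>

definition piece :: ctree where "piece =
  Br (Br (Br (Br (Br (Tri 0 w2 w1) (Tri 0 w1 w7) (Tri 0 0 w4)) (Br (Tri 0 w3 w13) (Tri 0 w2 w1) (Tri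
  0 0 w5)) (Br (Tri 0 w1 w3) (Tri 0 0 w2) (Tri 0 0 w1))) (Br (Br (Tri 0 w4 w1) (Tri 0 w1 w6) (Tri 0
  0 w9)) (Br (Tri 0 w2 w3) (Tri 0 w11 w1) (Tri 0 0 w12)) (Br (Tri 0 w1 w2) (Tri 0 0 w5) (Tri 0 0
  w1))) (Br (Br (Tri 0 w10 w6) (Tri 0 w1 w2) (Tri 0 0 w1)) (Br (Tri 0 w3 w4) (Tri 0 0 w8) (Tri 0 0
  w1)) (Br (Tri 0 w16 w3) (Tri 0 0 w2) (Tri 0 0 w1)))) (Br (Br (Br (Tri 0 w1 w7) (Tri 0 w4 w2) (Tri
  0 0 w1)) (Br (Tri 0 w3 w1) (Tri 0 w1 w6) (Tri 0 0 w2)) (Br (Tri 0 w5 w3) (Tri 0 0 w1) (Tri 0 0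
  w10))) (Br (Br (Tri 0 w15 w2) (Tri 0 w1 w8) (Tri 0 0 w1)) (Br (Tri 0 w2 w3) (Tri 0 w7 w1) (Tri 0 0
  w14)) (Br (Tri 0 w5 w4) (Tri 0 0 w1) (Tri 0 0 w2))) (Br (Br (Tri 0 w2 w4) (Tri 0 w1 w18) (Tri 0 0
  w1)) (Br (Tri 0 w3 w9) (Tri 0 0 w1) (Tri 0 0 w6)) (Br (Tri 0 w2 w3) (Tri 0 0 w1) (Tri 0 0 w5))))
  (Br (Br (Br (Tri 0 w5 w7) (Tri 0 w1 w4) (Tri 0 0 w1)) (Br (Tri 0 w2 w17) (Tri 0 w1 w6) (Tri 0 0
  w1)) (Br (Tri 0 w2 w3) (Tri 0 0 w9) (Tri 0 0 w1))) (Br (Br (Tri 0 w3 w19) (Tri 0 w2 w1) (Tri 0 0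
  w4)) (Br (Tri 0 w1 w13) (Tri 0 0 w7) (Tri 0 0 w1)) (Br (Tri 0 w12 w1) (Tri 0 0 w2) (Tri 0 0 w3)))
  (Br (Br (Tri 0 w11 w2) (Tri 0 w1 w4) (Tri 0 0 w1)) (Br (Tri 0 w8 w2) (Tri 0 0 w1) (Tri 0 0 w6))
  (Br (Tri 0 w5 w3) (Tri 0 0 w1) (Tri 0 0 w15))))) (Br (Br (Br (Br (Tri 0 w4 w1) (Tri 0 w1 w3) (Tri
  0 0 w6)) (Br (Tri 0 w2 w5) (Tri 0 w1 w9) (Tri 0 0 w1)) (Br (Tri 0 w12 w1) (Tri 0 0 w2) (Tri 0 0
  w11))) (Br (Br (Tri 0 w13 w3) (Tri 0 w2 w1) (Tri 0 0 w4)) (Br (Tri 0 w8 w1) (Tri 0 w1 w3) (Tri 0 0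
  w5)) (Br (Tri 0 w1 w6) (Tri 0 0 w2) (Tri 0 0 w1))) (Br (Br (Tri 0 w1 w3) (Tri 0 w2 w16) (Tri 0 0
  w1)) (Br (Tri 0 w10 w1) (Tri 0 0 w3) (Tri 0 0 w7)) (Br (Tri 0 w4 w5) (Tri 0 0 w1) (Tri 0 0 w2))))
  (Br (Br (Br (Tri 0 w4 w2) (Tri 0 w7 w1) (Tri 0 0 w19)) (Br (Tri 0 w1 w6) (Tri 0 w2 w11) (Tri 0 0
  w1)) (Br (Tri 0 w3 w1) (Tri 0 0 w2) (Tri 0 0 w5))) (Br (Br (Tri 0 w3 w1) (Tri 0 w1 w4) (Tri 0 0
  w9)) (Br (Tri 0 w14 w2) (Tri 0 0 w1) (Tri 0 0 w5)) (Br (Tri 0 w1 w2) (Tri 0 0 w3) (Tri 0 0 w1)))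
  (Br (Br (Tri 0 w1 w4) (Tri 0 w2 w3) (Tri 0 0 w1)) (Br (Tri 0 w18 w1) (Tri 0 0 w6) (Tri 0 0 w7))
  (Br (Tri 0 w10 w2) (Tri 0 0 w1) (Tri 0 0 w12)))) (Br (Br (Br (Tri 0 w3 w1) (Tri 0 w1 w8) (Tri 0 0
  w6)) (Br (Tri 0 w2 w4) (Tri 0 w9 w1) (Tri 0 0 w17)) (Br (Tri 0 w1 w2) (Tri 0 0 w3) (Tri 0 0 w1)))
  (Br (Br (Tri 0 w1 w3) (Tri 0 w2 w5) (Tri 0 0 w1)) (Br (Tri 0 w1 w4) (Tri 0 0 w3) (Tri 0 0 w1)) (Br
  (Tri 0 w2 w6) (Tri 0 0 w13) (Tri 0 0 w1))) (Br (Br (Tri 0 w15 w5) (Tri 0 w4 w1) (Tri 0 0 w2)) (Br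
  (Tri 0 w2 w1) (Tri 0 0 w3) (Tri 0 0 w11)) (Br (Tri 0 w1 w7) (Tri 0 0 w14) (Tri 0 0 w1))))) (Br (Br
  (Br (Br (Tri 0 w7 w1) (Tri 0 w1 w2) (Tri 0 0 w10)) (Br (Tri 0 w3 w14) (Tri 0 w1 w2) (Tri 0 0 w1))
  (Br (Tri 0 w4 w1) (Tri 0 0 w5) (Tri 0 0 w2))) (Br (Br (Tri 0 w6 w9) (Tri 0 w2 w4) (Tri 0 0 w1))
  (Br (Tri 0 w1 w3) (Tri 0 w18 w13) (Tri 0 0 w1)) (Br (Tri 0 w2 w5) (Tri 0 0 w11) (Tri 0 0 w1))) (Br
  (Br (Tri 0 w1 w3) (Tri 0 w8 w6) (Tri 0 0 w1)) (Br (Tri 0 w2 w1) (Tri 0 0 w3) (Tri 0 0 w4)) (Br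
  (Tri 0 w12 w2) (Tri 0 0 w1) (Tri 0 0 w7)))) (Br (Br (Br (Tri 0 w2 w1) (Tri 0 w1 w7) (Tri 0 0 w5))
  (Br (Tri 0 w3 w4) (Tri 0 w10 w1) (Tri 0 0 w2)) (Br (Tri 0 w1 w3) (Tri 0 0 w6) (Tri 0 0 w1))) (Br
  (Br (Tri 0 w2 w1) (Tri 0 w1 w5) (Tri 0 0 w8)) (Br (Tri 0 w4 w3) (Tri 0 0 w2) (Tri 0 0 w6)) (Br
  (Tri 0 w1 w2) (Tri 0 0 w9) (Tri 0 0 w1))) (Br (Br (Tri 0 w19 w2) (Tri 0 w1 w4) (Tri 0 0 w1)) (Br
  (Tri 0 w3 w2) (Tri 0 0 w12) (Tri 0 0 w1)) (Br (Tri 0 w16 w3) (Tri 0 0 w5) (Tri 0 0 w1)))) (Br (Br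
  (Br (Tri 0 w1 w3) (Tri 0 w5 w2) (Tri 0 0 w1)) (Br (Tri 0 w1 w17) (Tri 0 w2 w3) (Tri 0 0 w1)) (Br
  (Tri 0 w9 w4) (Tri 0 0 w2) (Tri 0 0 w1))) (Br (Br (Tri 0 w4 w1) (Tri 0 w1 w6) (Tri 0 0 w10)) (Br
  (Tri 0 w2 w11) (Tri 0 0 w7) (Tri 0 0 w1)) (Br (Tri 0 w2 w1) (Tri 0 0 w3) (Tri 0 0 w15))) (Br (Br
  (Tri 0 w3 w6) (Tri 0 w5 w1) (Tri 0 0 w2)) (Br (Tri 0 w1 w2) (Tri 0 0 w4) (Tri 0 0 w1)) (Br (Tri 0
  w8 w1) (Tri 0 0 w3) (Tri 0 0 0)))))"

lemmas scan_eqs = scan.simps glue.simps near_of.simps merge.simps shift.simps apart_eqs select.simps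
  umin.simps good.simps sep.simps good_upto.simps sep_upto.simps shape.simps full.simps bounded.simps
  nat_eqs nat.inject nat.distinct add_0 add_Suc One_nat_def simp_thms

lemma coloring_0: "\<exists>f. packing_coloring (ST_verts 0) (ST_edge 0) 3 f"
proof -
  have "shape 0 col0 \<and> full False False False col0 \<and> bounded w3 col0 \<and> good_upto w3 [] col0"
    by (simp only: scan_eqs col0_def)
  moreover have "0 = 0" "w3 = 3" "shifts 0 = []" by simp_all
  ultimately show ?thesis using tree_packing[of 0 col0 w3] by metis
qed

lemma coloring_1: "\<exists>f. packing_coloring (ST_verts 1) (ST_edge 1) 4 f"
proof -
  have "shape w1 col1 \<and> full False False False col1 \<and> bounded w4 col1 \<and> good_upto w4 [w1] col1"
    by (simp only: scan_eqs col1_def)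
  moreover have "w1 = 1" "w4 = 4" "shifts w1 = [w1]" by simp_all
  ultimately show ?thesis using tree_packing[of w1 col1 w4] by metis
qed

lemma coloring_2: "\<exists>f. packing_coloring (ST_verts 2) (ST_edge 2) 8 f"
proof -
  have "shape w2 col2 \<and> full False False False col2 \<and> bounded w8 col2 \<and> good_upto w8 [w2, w1] col2"
    by (simp only: scan_eqs col2_def)
  moreover have "w2 = 2" "w8 = 8" "shifts w2 = [w2, w1]" by simp_all
  ultimately show ?thesis using tree_packing[of w2 col2 w8] by metis
qed

lemma coloring_3: "\<exists>f. packing_coloring (ST_verts 3) (ST_edge 3) 12 f"
proof -
  have "shape w3 col3 \<and> full False False False col3 \<and> bounded w12 col3 \<and> good_upto w12 [w4, w2, w1] col3"
    by (simp only: scan_eqs col3_def)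
  moreover have "w3 = 3" "w12 = 12" "shifts w3 = [w4, w2, w1]" by simp_all
  ultimately show ?thesis using tree_packing[of w3 col3 w12] by metis
qed

lemma coloring_4: "\<exists>f. packing_coloring (ST_verts 4) (ST_edge 4) 15 f"
proof -
  have "shape w4 col4 \<and> full False False False col4 \<and> bounded w15 col4 \<and> good_upto w15 [w8, w4, w2, w1] col4"
    by (simp only: scan_eqs col4_def)
  moreover have "w4 = 4" "w15 = 15" "shifts w4 = [w8, w4, w2, w1]" by simp_all
  ultimately show ?thesis using tree_packing[of w4 col4 w15] by metis
qed

lemma coloring_5: "\<exists>f. packing_coloring (ST_verts 5) (ST_edge 5) 19 f"
proof -
  have "shape w5 col5 \<and> full False False False col5 \<and> bounded w19 col5 \<and> good_upto w19 [w16, w8, w4, w2, w1] col5"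
    by (simp only: scan_eqs col5_def)
  moreover have "w5 = 5" "w19 = 19" "shifts w5 = [w16, w8, w4, w2, w1]" by simp_all
  ultimately show ?thesis using tree_packing[of w5 col5 w19] by metis
qed

lemma piece_ok: "periodic_piece piece"
proof -
  have "shape w5 piece \<and> full True True True piece \<and> bounded w19 piece \<and> sep_upto w19 [w16, w8, w4, w2, w1] piece"
    by (simp only: scan_eqs piece_def)
  moreover have "w5 = 5" "w19 = 19" "shifts w5 = [w16, w8, w4, w2, w1]" by simp_all
  ultimately show ?thesis unfolding periodic_piece_def by metis
qed

section \<open>The packing chromatic numbers\<close>

lemma packing_coloring_mono: "packing_coloring V E c f \<Longrightarrow> c \<le> d \<Longrightarrow> packing_coloring V E d f"
  unfolding packing_coloring_def by fastforce

text \<open>Failure for the single value \<open>c\<close> suffices for the lower bound, because a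
  colouring with fewer colours also counts as one with \<open>c\<close> colours.\<close>

lemma packing_chromatic_number_bounds:
  assumes "\<exists>f. packing_coloring V E d f" "\<And>f. \<not> packing_coloring V E c f"
  shows "c < packing_chromatic_number V E \<and> packing_chromatic_number V E \<le> d"
proof
  have "\<exists>f. packing_coloring V E (packing_chromatic_number V E) f"
    unfolding packing_chromatic_number_def using assms(1) by (rule LeastI_ex[OF exI])
  then show "c < packing_chromatic_number V E"
    using packing_coloring_mono assms(2) by (meson not_le)
  show "packing_chromatic_number V E \<le> d"
    unfolding packing_chromatic_number_def using assms(1) by (rule Least_le)
qed

lemma no_coloring_0: "\<not> packing_coloring (ST_verts 0) (ST_edge 0) 2 f"
proof
  assume f: "packing_coloring (ST_verts 0) (ST_edge 0) 2 f"
  note P = packing_words[OF f, of 0 0, simplified]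
  have m: "[0] \<in> words 0" "[1] \<in> words 0" "[2] \<in> words 0" unfolding words_0 by auto
  have "f (cls 0 [0]) \<noteq> f (cls 0 [1])" "f (cls 0 [0]) \<noteq> f (cls 0 [2])" "f (cls 0 [1]) \<noteq> f (cls 0 [2])"
    using P(3)[OF m(1) m(2)] P(3)[OF m(1) m(3)] P(3)[OF m(2) m(3)] P(1)[OF m(1) m(1)] P(1)[OF m(2) m(2)] by auto
  moreover have "f (cls 0 [0]) = 1 \<or> f (cls 0 [0]) = 2" "f (cls 0 [1]) = 1 \<or> f (cls 0 [1]) = 2"
    "f (cls 0 [2]) = 1 \<or> f (cls 0 [2]) = 2"
    using P(1)[OF m(1) m(1)] P(1)[OF m(2) m(2)] P(1)[OF m(3) m(3)] by auto
  ultimately show False by auto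
qed

text \<open>The three midpoints are mutually adjacent and use up the colours 1, 2, 3. A corner is
  adjacent to two of them and must repeat the colour of the third, at distance 2, which only colour
  1 permits. All midpoints would then have colour 1.\<close>

lemma no_coloring_1: "\<not> packing_coloring (ST_verts 1) (ST_edge 1) 3 f"
proof
  assume f: "packing_coloring (ST_verts 1) (ST_edge 1) 3 f"
  define g where "g x = f (cls 1 (replicate 0 0 @ x))" for x
  have P: "g x \<in> {1..3}" "g x = g y \<Longrightarrow> word_dist x y = 0 \<or> g x < word_dist x y"
    if "x \<in> words 1" "y \<in> words 1" for x y
    using packing_words[OF f, of 0 1 x y] that unfolding g_def by auto
  have m: "[0,0] \<in> words 1" "[1,1] \<in> words 1" "[2,2] \<in> words 1" "[0,1] \<in> words 1" "[0,2] \<in> words 1" "[1,2] \<in> words 1"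
    by (simp_all add: sier_verts_def)
  have r: "g x = 1 \<or> g x = 2 \<or> g x = 3" if "x \<in> words 1" for x using P(1)[OF that that] by auto
  have adj: "g [0,1] \<noteq> g [0,2]" "g [0,1] \<noteq> g [1,2]" "g [0,2] \<noteq> g [1,2]" "g [0,0] \<noteq> g [0,1]" "g [0,0] \<noteq> g [0,2]"
    "g [1,1] \<noteq> g [0,1]" "g [1,1] \<noteq> g [1,2]" "g [2,2] \<noteq> g [0,2]" "g [2,2] \<noteq> g [1,2]"
    using P[OF m(4) m(5)] P[OF m(4) m(6)] P[OF m(5) m(6)] P[OF m(1) m(4)] P[OF m(1) m(5)] P[OF m(2) m(4)]
      P[OF m(2) m(6)] P[OF m(3) m(5)] P[OF m(3) m(6)] by auto
  have two: "g [0,0] = g [1,2] \<Longrightarrow> g [0,0] = 1" "g [1,1] = g [0,2] \<Longrightarrow> g [1,1] = 1" "g [2,2] = g [0,1] \<Longrightarrow> g [2,2] = 1"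
    using P[OF m(1) m(6)] P[OF m(2) m(5)] P[OF m(3) m(4)] by auto
  show False
    using r[OF m(1)] r[OF m(2)] r[OF m(3)] r[OF m(4)] r[OF m(5)] r[OF m(6)] adj two by presburger
qed

text \<open>Among seven colours those from 4 to 7 occur at most once each and cost at most 2 each,
  so the weight of TU is at most 8. With the constantly false continuation, \<open>dfs_8\<close>
  says that no admissible assignment is that cheap.\<close>

lemma no_coloring_2: "\<not> packing_coloring (ST_verts 2) (ST_edge 2) 7 f"
proof
  assume f: "packing_coloring (ST_verts 2) (ST_edge 2) 7 f"
  define g where "g x = f (cls 2 (replicate 0 0 @ x))" for x
  have P: "g x \<in> {1..7}" "g x = g y \<Longrightarrow> word_dist x y = 0 \<or> g x < word_dist x y"
    if "x \<in> words 2" "y \<in> words 2" for x y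
    using packing_words[OF f, of 0 2 x y] that unfolding g_def by auto
  have m: "v \<in> words 2" if "v \<in> set local_words" for v
    using that local_letters length_in_local by (auto simp: sier_verts_def)
  have loc: "local_ok g"
    unfolding local_ok_def
  proof (intro ballI conjI impI)
    fix u v assume u: "u \<in> set local_words"
    show "g u \<in> {1..11}" using P(1)[OF m[OF u] m[OF u]] by auto
    assume "v \<in> set local_words" "u \<noteq> v" "g u = g v"
    then show "g u < word_dist u v" using P(2)[OF m[OF u] m] local_dist_pos[OF u] by blast
  qed
  have "pin g c = 0" if "8 \<le> c" for c
  proof (cases "pin g c")
    case (Suc k)
    then have "k < 15" "g (local_words ! k) = c" using pin_Suc by auto
    then show ?thesis using P(1)[OF m m, of "local_words ! k" "local_words ! k"] length_local that by auto
  qed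
  then have "rest_weight g \<le> 2" using costs_0 costs_le[OF pin_less[of g 4]] by (simp add: rest_weight_def)
  then have "tag_weight local_masks (map (\<lambda>v. tag_of (g v)) (rev local_words)) \<le> w8"
    using costs_le[OF pin_less[of g 5]] costs_le[OF pin_less[of g 6]] costs_le[OF pin_less[of g 7]]
    unfolding tag_weight_local[OF loc] by simp
  from dfs_local[OF loc dfs_8 this] show False .
qed

interpretation table tab
  by (rule table.intro[OF tab_covered tab_wf tab_cap tab_joined])

text \<open>The words behind \<open>n - 3\<close> zeros form the copy of dimension 3 to which the
  contradiction is applied.\<close>

lemma no_coloring_3:
  assumes "3 \<le> n" shows "\<not> packing_coloring (ST_verts n) (ST_edge n) 11 f"
proof
  assume f: "packing_coloring (ST_verts n) (ST_edge n) 11 f"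
  have n: "n = (n - 3) + 3" using assms by simp
  have s: "sier_verts 4 = words 3" by simp
  show False
    by (rule no_coloring_ST3[of "\<lambda>x. f (cls n (replicate (n - 3) 0 @ x))"])
      (use packing_words[OF f n] in \<open>unfold s, blast\<close>)+
qed

interpretation periodic_piece piece
  by (rule piece_ok)

theorem theorem5:
  shows "chi_ST 0 = 3 \<and> chi_ST 1 = 4 \<and> chi_ST 2 = 8 \<and> chi_ST 3 = 12
    \<and> (12 \<le> chi_ST 4 \<and> chi_ST 4 \<le> 15)
    \<and> (12 \<le> chi_ST 5 \<and> chi_ST 5 \<le> 19)
    \<and> (\<forall>n\<ge>6. 12 \<le> chi_ST n \<and> chi_ST n \<le> 20)"
proof -
  note B = packing_chromatic_number_bounds
  have "2 < chi_ST 0 \<and> chi_ST 0 \<le> 3" using B[OF coloring_0 no_coloring_0] .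
  moreover have "3 < chi_ST 1 \<and> chi_ST 1 \<le> 4" using B[OF coloring_1 no_coloring_1] .
  moreover have "7 < chi_ST 2 \<and> chi_ST 2 \<le> 8" using B[OF coloring_2 no_coloring_2] .
  moreover have "11 < chi_ST 3 \<and> chi_ST 3 \<le> 12" using B[OF coloring_3 no_coloring_3] by simp
  moreover have "11 < chi_ST 4 \<and> chi_ST 4 \<le> 15" using B[OF coloring_4 no_coloring_3] by simp
  moreover have "11 < chi_ST 5 \<and> chi_ST 5 \<le> 19" using B[OF coloring_5 no_coloring_3] by simp
  moreover have "12 \<le> chi_ST n \<and> chi_ST n \<le> 20" if "6 \<le> n" for n
  proof -
    have "11 < chi_ST n \<and> chi_ST n \<le> 20" using B[OF periodic_packing no_coloring_3] that by simp
    then show ?thesis by simp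
  qed
  ultimately show ?thesis by auto
qed

end
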